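(* Let $d,l\ge 2$ be fixed integers. Let $Z_h$ be the number of matchings with exactly $h$ hyperedges in the random $(d,l)$-regular hypergraph $\mathcal G_{m,d,l}$, and let $Z=\sum_{h=0}^{\lfloor m/d\rfloor}Z_h$. All limits are as $m\to\infty$ through integers with $lm/d\in\mathbb N$. For $0<\beta<1/d$ put $$\Phi_{d,l}(\beta)=-\beta\log\beta+(l-1)(1-\beta)\log(1-\beta)-\frac ld(1-d\beta)\log(1-d\beta).$$ (1) Let $\beta_*$ be the unique solution in $(0,1/d)$ of $(1-d\beta)^l=\beta(1-\beta)^{l-1}$. Then $$\lim_{m\to\infty}e^{-m\Phi_{d,l}(\beta_* )}\,\mathbb E Z=\sqrt{\frac{1-\beta_*}{1+(ld-d-l)\beta_*}}.$$ (2) For $l\ge 3$ define $$L_1:=\frac1{dl-d-l+2}=\frac1{(d-1)(l-1)+1},$$ $$L_2:=\min\left\{\frac1d\left(1-\sqrt{\frac{d-1}{d^{l/(l-1)}-1}}\right),\ \frac{dl+l^2-2l-d+1}{2dl^2-dl},\ \frac1{1+\sqrt{(d-1)(l-1)}}\right\},$$ $$L_{\rm cert}:=\max\{L_1,L_2\},\qquad x_{\rm cert}:=\exp\{-\Phi_{d,l}'(L_{\rm cert})\}.$$ Assume that either (a) $l=2$, or (b) $l\ge3$ and $\beta_*\le L_{\rm cert}$ (equivalently, when $l\ge 3$, $x_{\rm cert}\ge1$). Then $\frac1m\log Z\to\Phi_{d,l}(\beta_* )$ in probability. (3) Let $x>0$ and $Z(x):=\sum_{h=0}^{\lfloor m/d\rfloor}Z_hx^h$.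 Let $\beta_*(x)$ be the unique solution in $(0,1/d)$ of $\Phi'_{d,l}(\beta)+\log x=0$. Assume that either (a) $l=2$, or (b) $l\ge3$ and $0<x\le x_{\rm cert}$ (equivalently, when $l\ge3$, $\beta_*(x)\le L_{\rm cert}$). Then $$\frac1m\log Z(x)\to\Phi_{d,l}(\beta_*(x))+\beta_*(x)\log x$$ in probability.
   Context: Random hypergraph model. Let $d,l\ge2$ and let $m$ be such that $lm/d\in\mathbb N$. The hyperedge set is $[m]$, the half-edge set is $[lm]$, and half-edge $i$ belongs to hyperedge $\lceil i/l\rceil$ (so each hyperedge contains $l$ half-edges). A $(d,l)$-regular hypergraph (configuration) is obtained by partitioning $[lm]$ into $lm/d$ classes of size $d$, called vertices; a half-edge is incident to the vertex that contains it. (Two half-edges of the same hyperedge may lie in the same vertex, and two hyperedges may share several vertices.) $\mathcal G_{m,d,l}$ is the configuration given by a uniformly random such partition. (Equivalently one may give each vertex-class a cyclic order and choose uniformly among the $(lm)!/(d^{lm/d}(lm/d)!)$ resulting objects; the law of the underlying partition is the same.) A set $M$ of hyperedges is a matching if all $l|M|$ half-edges contained in hyperedges of $M$ are incident to distinct vertices. *)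

theory Defs
  imports "HOL-Probability.Probability" "HOL-Library.Disjoint_Sets"
begin

definition configurations :: "nat \<Rightarrow> nat \<Rightarrow> nat \<Rightarrow> nat set set set" where
  "configurations m d l =
     {P. partition_on {1..l * m} P \<and> card P = l * m div d \<and> (\<forall>V\<in>P. card V = d)}"

text \<open>
  The set of configurations is finite, and it is nonempty iff \<open>d\<close> divides \<open>l * m\<close> (for \<open>d > 0\<close>);
  \<open>pmf_of_set\<close> is meaningful only in that case, which is enforced by \<open>admissible\<close> below.
\<close>

definition random_hypergraph :: "nat \<Rightarrow> nat \<Rightarrow> nat \<Rightarrow> nat set set pmf" where
  "random_hypergraph m d l = pmf_of_set (configurations m d l)"

definition hyperedge_of :: "nat \<Rightarrow> nat \<Rightarrow> nat" where
  "hyperedge_of l i = nat \<lceil>real i / real l\<rceil>"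

definition half_edges :: "nat \<Rightarrow> nat \<Rightarrow> nat set \<Rightarrow> nat set" where
  "half_edges m l M = {i \<in> {1..l * m}. hyperedge_of l i \<in> M}"

definition vertex_of :: "nat set set \<Rightarrow> nat \<Rightarrow> nat set" where
  "vertex_of P i = (THE V. V \<in> P \<and> i \<in> V)"

definition is_matching :: "nat \<Rightarrow> nat \<Rightarrow> nat set set \<Rightarrow> nat set \<Rightarrow> bool" where
  "is_matching m l P M \<longleftrightarrow> M \<subseteq> {1..m} \<and> inj_on (vertex_of P) (half_edges m l M)"

definition Z_count :: "nat \<Rightarrow> nat \<Rightarrow> nat \<Rightarrow> nat set set \<Rightarrow> nat" where
  "Z_count m l h P = card {M. is_matching m l P M \<and> card M = h}"

definition Z_total :: "nat \<Rightarrow> nat \<Rightarrow> nat \<Rightarrow> nat set set \<Rightarrow> nat" where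
  "Z_total m d l P = (\<Sum>h = 0..m div d. Z_count m l h P)"

definition Z_weighted :: "nat \<Rightarrow> nat \<Rightarrow> nat \<Rightarrow> real \<Rightarrow> nat set set \<Rightarrow> real" where
  "Z_weighted m d l x P = (\<Sum>h = 0..m div d. real (Z_count m l h P) * x ^ h)"

text \<open>\<open>m \<rightarrow> \<infinity>\<close> through the integers for which \<open>l * m / d\<close> is an integer.\<close>

definition admissible :: "nat \<Rightarrow> nat \<Rightarrow> nat filter" where
  "admissible d l = inf sequentially (principal {m. d dvd l * m})"

definition tendsto_in_prob ::
    "('i \<Rightarrow> 'a pmf) \<Rightarrow> ('i \<Rightarrow> 'a \<Rightarrow> real) \<Rightarrow> real \<Rightarrow> 'i filter \<Rightarrow> bool" where
  "tendsto_in_prob p X c F \<longleftrightarrow>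
     (\<forall>\<epsilon>>0. ((\<lambda>i. measure_pmf.prob (p i) {\<omega>. \<bar>X i \<omega> - c\<bar> > \<epsilon>}) \<longlongrightarrow> 0) F)"

definition Phi :: "nat \<Rightarrow> nat \<Rightarrow> real \<Rightarrow> real" where
  "Phi d l \<beta> = - \<beta> * ln \<beta> + (real l - 1) * (1 - \<beta>) * ln (1 - \<beta>)
     - real l / real d * (1 - real d * \<beta>) * ln (1 - real d * \<beta>)"

definition is_beta_star :: "nat \<Rightarrow> nat \<Rightarrow> real \<Rightarrow> bool" where
  "is_beta_star d l \<beta> \<longleftrightarrow>
     \<beta> \<in> {0<..<1 / real d} \<and> (1 - real d * \<beta>) ^ l = \<beta> * (1 - \<beta>) ^ (l - 1)"

definition beta_star :: "nat \<Rightarrow> nat \<Rightarrow> real" where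
  "beta_star d l = (THE \<beta>. is_beta_star d l \<beta>)"

definition is_beta_star_at :: "nat \<Rightarrow> nat \<Rightarrow> real \<Rightarrow> real \<Rightarrow> bool" where
  "is_beta_star_at d l x \<beta> \<longleftrightarrow>
     \<beta> \<in> {0<..<1 / real d} \<and> deriv (Phi d l) \<beta> + ln x = 0"

definition beta_star_at :: "nat \<Rightarrow> nat \<Rightarrow> real \<Rightarrow> real" where
  "beta_star_at d l x = (THE \<beta>. is_beta_star_at d l x \<beta>)"

definition L1 :: "nat \<Rightarrow> nat \<Rightarrow> real" where
  "L1 d l = 1 / (real d * real l - real d - real l + 2)"

lemma L1_alt: "L1 d l = 1 / ((real d - 1) * (real l - 1) + 1)"
  by (simp add: L1_def algebra_simps)

definition L2 :: "nat \<Rightarrow> nat \<Rightarrow> real" where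
  "L2 d l = Min
     {1 / real d * (1 - sqrt ((real d - 1) / (real d powr (real l / (real l - 1)) - 1))),
      (real d * real l + (real l)\<^sup>2 - 2 * real l - real d + 1)
        / (2 * real d * (real l)\<^sup>2 - real d * real l),
      1 / (1 + sqrt ((real d - 1) * (real l - 1)))}"

definition L_cert :: "nat \<Rightarrow> nat \<Rightarrow> real" where
  "L_cert d l = max (L1 d l) (L2 d l)"

definition x_cert :: "nat \<Rightarrow> nat \<Rightarrow> real" where
  "x_cert d l = exp (- deriv (Phi d l) (L_cert d l))"

end

theory Submission
  imports Defs "HOL-Combinatorics.Permutations"
begin

text \<open>
  A fixed set of \<open>k\<close> half-edges is met at most once by every vertex with probability
  \<open>(n choose k) * d ^ k / (l * m choose k)\<close>, where \<open>n = l * m / d\<close>. Stirling's formula therefore gives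
  \<open>E Z_h = S * exp (m * Phi (h / m))\<close> with an explicit prefactor \<open>S\<close>, and part (1) is Laplace's method at the
  maximum of the strictly concave function \<open>Phi\<close>.

  For the limits in probability, the second moment of \<open>Z_h\<close> is a sum over the overlap of two matchings.
  The number of pairs of half-edge sets of given overlap is at most the generating function
  \<open>(1 + 2 d s + d (d - 1) s^2 + d w) ^ n\<close> divided by a monomial in \<open>s\<close> and \<open>w\<close>. Along a rational
  parametrisation of the optimal weights \<open>s\<close> and \<open>w\<close> the exponent is unimodal, its maximum being at the
  independent overlap, as soon as an explicit polynomial inequality holds; Bernoulli's inequality proves it
  up to \<open>L_cert\<close> (and always for \<open>l = 2\<close>). So \<open>Z_h\<close> exceeds half its mean with at least inverse polynomial
  probability. On the other hand \<open>ln Z\<close> changes by a bounded amount under transposition of two half-edges,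
  so it is exponentially concentrated; hence its mean is at least \<open>ln (E Z_h) - o(m)\<close>.
  The matching upper bound is Markov's inequality.
\<close>

text \<open>At a given overlap the second-moment exponent is an infimum over the weights s and w;
  solving for the optimal weights in terms of the overlap leads to square roots. Parametrising
  overlap and weights together by t makes all of them rational. The weights are stationary along
  this curve, so the derivative only sees the explicit dependence on the densities (an envelope
  argument), and its sign is decided by comparing t^2 * N^(l-1) with a linear expression in N.

  The generating function bound and the Stirling ratios lose polynomial factors, so the second
  moment alone gives no high probability. Any subexponential loss is harmless: a probability that is
  not exponentially small already contradicts concentration around a smaller mean. Concentration is
  accessible because a uniform configuration is a fixed one relabelled by a uniform permutation.

  With t0 = \<beta> / (1 - \<beta>), the inequality follows from either of two conditions: (d-1) *
  (l-1) * t0 \<le> 1, which is \<beta> \<le> \<open>L1\<close>, or ((1 - \<beta>) / (1 - d *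
  \<beta>))^(l-1) \<le> d, which the first entry of \<open>L2\<close> secures.\<close>

section \<open>The overlap inequality\<close>

text \<open>The right side exceeds t^2 by exactly the quantity \<open>D\<close> of the proof, and N
  = 1 + k * D, so the claim is t^2 * (N^j - 1) \<le> D. Since N \<le> 1 / (1 - k * t0), a geometric
  sum bounds N^j - 1 linearly in D; the hypothesis \<open>bound\<close> says that the resulting
  coefficient, with t replaced by t0, is at most 1.\<close>

lemma overlap_poly_below:
  fixes k t t0 :: real
  assumes k: "k \<ge> 1" and t: "0 \<le> t" "t \<le> t0" and kt0: "k * t0 < 1"
    and bound: "t0 * ((1 / (1 - k * t0)) ^ j - 1) * (1 - k * t0) \<le> 1"
    and N: "N = 1 + k * (t0 - t) * (1 + t) / (1 - k * t0)"
  shows "t\<^sup>2 * N ^ j \<le> t0 * N - t * (1 - t0)"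
proof -
  define g where "g = 1 - k * t0"
  define S where "S = (\<Sum>i<j. (1 / g) ^ i)"
  define D where "D = (t0 - t) * (1 + t) / g"
  have g: "0 < g" using kt0 by (simp add: g_def)
  have D0: "0 \<le> D" unfolding D_def using g t by (intro divide_nonneg_pos mult_nonneg_nonneg) auto
  have ND: "N = 1 + k * D" by (simp add: N D_def g_def)
  have N1: "1 \<le> N" using ND D0 k by simp
  have t01: "t0 < 1"
  proof -
    have "t0 * 1 \<le> t0 * k" using t k by (intro mult_left_mono) auto
    then show ?thesis using kt0 by (simp add: mult.commute)
  qed
  have "(t0 - t) * (1 + t) = t0 - t * (1 + t - t0)" by algebra
  also have "\<dots> \<le> t0" using t t01 by simp
  finally have "D \<le> t0 / g" unfolding D_def using g by (simp add: divide_right_mono)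
  then have "N \<le> 1 + k * (t0 / g)" unfolding ND using k mult_left_mono[of D "t0 / g" k] by simp
  also have "\<dots> = 1 / g" using g by (simp add: field_simps g_def)
  finally have Ng: "N \<le> 1 / g" .
  have "(1 / g) ^ j - 1 = (1 / g - 1) * S" unfolding S_def by (rule power_diff_1_eq)
  also have "1 / g - 1 = k * t0 / g" using g by (simp add: field_simps g_def)
  finally have "t0 * ((1 / g) ^ j - 1) * g = k * t0\<^sup>2 * S" using g by (simp add: power2_eq_square)
  then have kS: "k * t0\<^sup>2 * S \<le> 1" using bound by (simp add: g_def)
  have "N ^ j - 1 = (N - 1) * (\<Sum>i<j. N ^ i)" by (rule power_diff_1_eq)
  also have "\<dots> \<le> (N - 1) * S" unfolding S_def
    using N1 Ng by (intro mult_left_mono sum_mono power_mono) auto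
  finally have "N ^ j - 1 \<le> k * D * S" by (simp add: ND)
  then have "t\<^sup>2 * (N ^ j - 1) \<le> t\<^sup>2 * (k * D * S)" by (rule mult_left_mono) simp
  also have "\<dots> \<le> t0\<^sup>2 * (k * D * S)"
    using t D0 k g by (intro mult_right_mono power_mono mult_nonneg_nonneg) (auto simp: S_def intro!: sum_nonneg)
  also have "\<dots> = (k * t0\<^sup>2 * S) * D" by simp
  also have "\<dots> \<le> 1 * D" using kS D0 by (rule mult_right_mono)
  finally have *: "t\<^sup>2 * (N ^ j - 1) \<le> D" by simp
  have "D * g = (t0 - t) * (1 + t)" using g by (simp add: D_def)
  then have "(t0 * N - t * (1 - t0) - t\<^sup>2) = D"
    unfolding ND g_def by algebra
  then show ?thesis using * by (simp add: algebra_simps)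
qed

text \<open>Now N = 1 - k * D with D \<ge> 0, and the right side exceeds the left by D - t^2 * (1 -
  N^j). Bernoulli's inequality gives 1 - N^j \<le> j * k * D.\<close>

lemma overlap_poly_above:
  fixes k t t0 :: real
  assumes k: "k \<ge> 1" and t: "0 < t0" "t0 \<le> t" and kt0: "k * t0 < 1"
    and bound: "k * real j * t\<^sup>2 \<le> 1"
    and N: "N = 1 + k * (t0 - t) * (1 + t) / (1 - k * t0)" and N0: "0 \<le> N"
  shows "t0 * N - t * (1 - t0) \<le> t\<^sup>2 * N ^ j"
proof -
  define g where "g = 1 - k * t0"
  define D where "D = (t - t0) * (1 + t) / g"
  have g: "0 < g" using kt0 by (simp add: g_def)
  have D0: "0 \<le> D" unfolding D_def using g t by (intro divide_nonneg_pos mult_nonneg_nonneg) auto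
  have ND: "N = 1 - k * D" using g by (simp add: N D_def g_def field_simps)
  have "1 + real j * (- k * D) \<le> (1 + (- k * D)) ^ j"
    using N0 ND by (intro Bernoulli_inequality) auto
  then have "1 - N ^ j \<le> real j * k * D" by (simp add: ND algebra_simps)
  then have "t\<^sup>2 * (1 - N ^ j) \<le> t\<^sup>2 * (real j * k * D)" by (rule mult_left_mono) simp
  also have "\<dots> = (k * real j * t\<^sup>2) * D" by simp
  also have "\<dots> \<le> 1 * D" using bound D0 by (rule mult_right_mono)
  finally have *: "t\<^sup>2 * (1 - N ^ j) \<le> D" by simp
  have "D * g = (t - t0) * (1 + t)" using g by (simp add: D_def)
  then have "(t0 * N - t * (1 - t0) - t\<^sup>2) = - D"
    unfolding ND g_def by algebra
  then show ?thesis using * by (simp add: algebra_simps)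
qed

text \<open>Used with k = d - 1, j = l - 1, t0 = \<beta> / (1 - \<beta>). The first alternative is
  then \<beta> \<le> \<open>L1\<close>; in the second, 1 / (1 - k * t0) is the value of N at t = 0
  and equals (1 - \<beta>) / (1 - d * \<beta>).\<close>

definition second_moment_cond :: "real \<Rightarrow> nat \<Rightarrow> real \<Rightarrow> bool" where
  "second_moment_cond k j t0 \<longleftrightarrow> k * real j * t0 \<le> 1 \<or> (1 / (1 - k * t0)) ^ j \<le> k + 1"

text \<open>The second alternative leaves t0 * k * (1 - k * t0), a product of two numbers below 1.
  Under the first one, Bernoulli gives s \<le> (1 - s)^(j-1) for s = k * t0, which bounds the main
  term by t0 / s \<le> 1.\<close>

lemma second_moment_cond_below:
  assumes k: "k \<ge> 1" and t0: "0 < t0" and kt0: "k * t0 < 1" and c: "second_moment_cond k j t0"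
  shows "t0 * ((1 / (1 - k * t0)) ^ j - 1) * (1 - k * t0) \<le> 1"
proof (cases "(1 / (1 - k * t0)) ^ j \<le> k + 1")
  case True
  then have "t0 * ((1 / (1 - k * t0)) ^ j - 1) * (1 - k * t0) \<le> t0 * k * (1 - k * t0)"
    using t0 kt0 by (intro mult_right_mono mult_left_mono) auto
  also have "\<dots> \<le> 1 * 1" using t0 kt0 k by (intro mult_mono) (auto simp: mult.commute)
  finally show ?thesis by simp
next
  case False
  define s where "s = k * t0"
  have s: "0 < s" "s < 1" using k t0 kt0 by (auto simp: s_def)
  have js: "s * real j \<le> 1" using False c by (auto simp: second_moment_cond_def s_def mult_ac)
  show ?thesis
  proof (cases j)
    case 0 then show ?thesis by simp
  next
    case (Suc i)
    have "s \<le> 1 + real i * (- s)" using js Suc by (simp add: algebra_simps)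
    also have "\<dots> \<le> (1 + (- s)) ^ i" using s by (intro Bernoulli_inequality) auto
    finally have "s \<le> (1 - s) ^ i" by simp
    then have "s * (1 / (1 - s)) ^ i \<le> 1" using s by (simp add: power_divide field_simps)
    moreover have "t0 * (1 / (1 - s)) ^ i \<le> s * (1 / (1 - s)) ^ i"
      using k t0 s by (intro mult_right_mono) (auto simp: s_def)
    ultimately have le: "t0 * (1 / (1 - s)) ^ i \<le> 1" by linarith
    have "t0 * ((1 / (1 - s)) ^ j - 1) * (1 - s) = t0 * (1 / (1 - s)) ^ i - t0 * (1 - s)"
      using s Suc by (simp add: field_simps)
    also have "\<dots> \<le> 1" using le t0 s by (smt (verit) mult_nonneg_nonneg)
    finally show ?thesis by (simp add: s_def)
  qed
qed

text \<open>Hypothesis \<open>a\<close> expresses that the overlap at t is nonnegative and keeps t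
  from running far above t0. If j \<le> k, then k * t < 1 is enough. If j > k, both alternatives
  give t0 * j \<le> 1, and negating the claim forces t * j < 1, whence k * j * t^2 \<le> (t * j)^2 <
  1.\<close>

lemma second_moment_cond_above:
  assumes k: "k \<ge> 1" and t0: "0 < t0" and kt0: "k * t0 < 1" and j: "j \<ge> 1"
    and c: "second_moment_cond k j t0" and t: "t0 \<le> t" "k * t < 1"
    and a: "t * (1 - t0) + k * t0 * t\<^sup>2 \<le> t0"
  shows "k * real j * t\<^sup>2 \<le> 1"
proof (cases "real j \<le> k")
  case True
  have "k * real j * t\<^sup>2 \<le> k * k * t\<^sup>2" using True k by (intro mult_right_mono mult_left_mono) auto
  also have "\<dots> = (k * t)\<^sup>2" by (simp add: power2_eq_square)
  also have "\<dots> \<le> 1\<^sup>2" using t t0 k by (intro power_mono) auto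
  finally show ?thesis by simp
next
  case False
  then have jk: "k < real j" by simp
  have t0j: "t0 * real j \<le> 1"
  proof (cases "k * real j * t0 \<le> 1")
    case True
    have "1 * (real j * t0) \<le> k * (real j * t0)" using k t0 by (intro mult_right_mono) auto
    then show ?thesis using True by (simp add: mult_ac)
  next
    case F: False
    then have M: "(1 / (1 - k * t0)) ^ j \<le> k + 1" using c by (auto simp: second_moment_cond_def)
    have kt: "0 < k * t0" using k t0 by simp
    have "(1 + k * t0) * (1 - k * t0) = 1 - (k * t0)\<^sup>2" by algebra
    then have "1 + k * t0 \<le> 1 / (1 - k * t0)" using kt kt0 by (simp add: pos_le_divide_eq)
    then have "(1 + k * t0) ^ j \<le> (1 / (1 - k * t0)) ^ j" using kt by (intro power_mono) auto
    moreover have "1 + real j * (k * t0) \<le> (1 + k * t0) ^ j" using kt by (intro Bernoulli_inequality) auto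
    ultimately have "real j * (k * t0) \<le> k" using M by linarith
    then have "k * (t0 * real j) \<le> k * 1" by (simp add: mult_ac)
    then show ?thesis using k by (subst (asm) mult_le_cancel_left_pos) auto
  qed
  show ?thesis
  proof (rule ccontr)
    assume neg: "\<not> ?thesis"
    have tpos: "0 < t" using t t0 by simp
    have kt2: "1 < real j * (k * t\<^sup>2)" using neg by (simp add: mult_ac)
    have pos: "0 < 1 + t - k * t\<^sup>2"
    proof -
      have "(k * t) * t \<le> 1 * t" using t tpos by (intro mult_right_mono) auto
      then show ?thesis by (simp add: power2_eq_square mult_ac)
    qed
    have "t \<le> t0 * (1 + t - k * t\<^sup>2)" using a by (simp add: algebra_simps)
    then have "t * real j \<le> t0 * (1 + t - k * t\<^sup>2) * real j" by (rule mult_right_mono) simp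
    also have "\<dots> = (t0 * real j) * (1 + t - k * t\<^sup>2)" by simp
    also have "\<dots> \<le> 1 * (1 + t - k * t\<^sup>2)" using t0j pos by (intro mult_right_mono) auto
    finally have 1: "t * real j \<le> 1 + t - k * t\<^sup>2" by simp
    have j1: "real j > 1" using jk k by linarith
    have "t * real j * real j \<le> (1 + t - k * t\<^sup>2) * real j" using 1 by (rule mult_right_mono) simp
    also have "\<dots> < real j + t * real j - 1" using kt2 by (simp add: algebra_simps)
    \<comment> \<open>Eliminating k * t^2 between the two estimates leaves a product whose second
      factor is positive.\<close>
    finally have "(t * real j - 1) * (real j - 1) < 0" by (simp add: algebra_simps)
    then have tj: "t * real j < 1" using j1 by (simp add: mult_less_0_iff)
    have "k * real j * t\<^sup>2 \<le> real j * real j * t\<^sup>2" using jk by (intro mult_right_mono) auto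
    also have "\<dots> = (t * real j)\<^sup>2" by (simp add: power2_eq_square)
    also have "\<dots> \<le> 1\<^sup>2" using tj tpos by (intro power_mono) auto
    finally show False using neg by simp
  qed
qed

text \<open>The product is 0 at 0, which is also its limit from the right: the convention 0 ln 0 = 0
  behind all entropy terms below.\<close>

lemma continuous_on_x_ln_x: "continuous_on {0..} (\<lambda>x::real. x * ln x)"
proof -
  have "((\<lambda>x::real. inverse x * ln (inverse x)) \<longlongrightarrow> 0) at_top"
  proof (rule Lim_transform_eventually)
    show "((\<lambda>x::real. - (ln x / x)) \<longlongrightarrow> 0) at_top"
      using tendsto_minus[OF ln_x_over_x_tendsto_0] by simp
    show "\<forall>\<^sub>F x::real in at_top. - (ln x / x) = inverse x * ln (inverse x)"
      using eventually_gt_at_top[of 0] by eventually_elim (simp add: ln_inverse divide_inverse mult.commute)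
  qed
  then have 0: "((\<lambda>x::real. x * ln x) \<longlongrightarrow> 0) (at_right 0)"
    by (simp add: filterlim_at_right_to_top)
  show ?thesis
    unfolding continuous_on_def
  proof
    fix x :: real assume x: "x \<in> {0..}"
    show "((\<lambda>x. x * ln x) \<longlongrightarrow> x * ln x) (at x within {0..})"
    proof (cases "x = 0")
      case True
      have "at (0::real) within {0..} = at_right 0"
        by (metis at_within_Ici_at_right)
      then show ?thesis using 0 True by simp
    next
      case False
      then have "x > 0" using x by simp
      then show ?thesis by (intro tendsto_intros) auto
    qed
  qed
qed

section \<open>The second-moment exponent along the curve of optimal weights\<close>

locale overlap =
  fixes k t0 :: real and l :: nat
  assumes k1: "k \<ge> 1" and t0: "t0 > 0" and kt0: "k * t0 < 1" and l2: "l \<ge> 2"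
begin

text \<open>With k = d - 1 and t0 = \<beta> / (1 - \<beta>), \<open>b\<close> is \<beta> and
  \<open>u\<close> is 1 - d * \<beta>. For two matchings of density b, \<open>a\<close>,
  \<open>del\<close>, \<open>q\<close> are the densities of the hyperedges in both, in exactly a
  given one of them, and in neither. The weight \<open>s\<close> marks a half-edge in one of the
  two, \<open>w\<close> a half-edge in both; \<open>P\<close> is the generating polynomial of one
  vertex of size k + 1, and \<open>G\<close> the exponential rate of the corresponding term of the
  second moment.\<close>

definition "b = t0 / (1 + t0)"
definition "u = (1 - k * t0) / (1 + t0)"
definition "A t = u / ((1 + t) * (1 - k * t))"
definition "del t = t * A t"
definition "a t = b - del t"
definition "q t = 1 - b - del t"
definition "s t = t / (1 - k * t)"
definition "w t = a t * ((1 + t) / (u * (1 - k * t)))"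
definition "P t = 1 + 2 * (k + 1) * s t + (k + 1) * k * (s t)\<^sup>2 + (k + 1) * w t"
definition "G t = (real l - 1) * (a t * ln (a t) + 2 * (del t * ln (del t)) + q t * ln (q t))
   + real l / (k + 1) * ln (P t) - real l * (a t * ln (w t) + 2 * (del t * ln (s t)))"

lemma u: "0 < u" "u = 1 - (k + 1) * b" and b: "0 < b" "b < 1"
  using t0 kt0 by (auto simp: u_def b_def field_simps)

text \<open>\<open>w\<close> is defined with this closed form in place of \<open>P\<close>. The
  lemma closes the circle: w = a * P, one of the two stationarity equations for the weights.\<close>

lemma P_eq:
  assumes "0 \<le> t" "k * t < 1"
  shows "P t = (1 + t) / (u * (1 - k * t))"
proof -
  have kt: "0 < 1 - k * t" using assms by simp
  \<comment> \<open>Naming the reciprocals r, v, x together with their defining relations turns the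
    field identity into a ring identity within reach of \<open>algebra\<close>.\<close>
  define r where "r = 1 / (1 - k * t)"
  have r: "r * (1 - k * t) = 1" using kt by (simp add: r_def)
  define v where "v = 1 / u"
  have v: "v * u = 1" using u by (simp add: v_def)
  define x where "x = 1 / (1 + t)"
  have x: "x * (1 + t) = 1" using assms by (simp add: x_def)
  have s: "s t = t * r" by (simp add: s_def r_def)
  have A: "A t = u * x * r" by (simp add: A_def r_def x_def)
  have del: "del t = t * u * x * r" by (simp add: del_def A)
  have "w t = (b - t * u * x * r) * ((1 + t) * v * r)"
    by (simp add: w_def a_def del v_def r_def)
  also have "\<dots> = b * (1 + t) * v * r - t * r * r * (u * v) * (x * (1 + t))" by algebra
  also have "\<dots> = b * (1 + t) * v * r - t * r * r" using v x by (simp add: mult.commute)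
  finally have w: "w t = b * (1 + t) * v * r - t * r\<^sup>2" by (simp add: power2_eq_square)
  have ub: "(k + 1) * b = 1 - u" using u by simp
  have "P t = 1 + 2 * (k + 1) * (t * r) + (k + 1) * k * (t * r)\<^sup>2 + ((k + 1) * b) * (1 + t) * v * r - (k + 1) * t * r\<^sup>2"
    unfolding P_def s w by algebra
  also have "\<dots> = (1 + t) * v * r"
    unfolding ub using r v by algebra
  finally show ?thesis by (simp add: v_def r_def)
qed

text \<open>After division by the common factor \<open>A\<close> the four densities become t0 * N -
  t * (1 - t0), t, t and N. These are the expressions compared in the overlap inequality.\<close>

lemma a_eq:
  assumes "0 \<le> t" "k * t < 1" and "N = 1 + k * (t0 - t) * (1 + t) / (1 - k * t0)"
  shows "a t = A t * (t0 * N - t * (1 - t0))" "q t = A t * N"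
proof -
  have D: "1 - k * t \<noteq> 0" "1 - k * t0 \<noteq> 0" "1 + t \<noteq> 0" "1 + t0 \<noteq> 0" using assms kt0 t0 by auto
  define r where "r = 1 / (1 - k * t)"
  have r: "r * (1 - k * t) = 1" using D by (simp add: r_def)
  define x where "x = 1 / (1 + t)"
  have x: "x * (1 + t) = 1" using D by (simp add: x_def)
  define y where "y = 1 / (1 + t0)"
  have y: "y * (1 + t0) = 1" using D by (simp add: y_def)
  define g where "g = 1 - k * t0"
  have Ng: "N * g = g + k * (t0 - t) * (1 + t)" using D assms(3) by (simp add: g_def field_simps)
  have A: "A t = g * y * x * r" by (simp add: A_def u_def y_def x_def r_def g_def)
  have bb: "b = t0 * y" by (simp add: b_def y_def)
  have "q t - A t * N = 1 - b - t * A t - A t * N" by (simp add: q_def del_def)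
  also have "\<dots> = 1 - t0 * y - t * (g * y * x * r) - (N * g) * (y * x * r)"
    unfolding A bb by algebra
  also have "\<dots> = 0" unfolding Ng unfolding g_def using r x y by algebra
  finally show q: "q t = A t * N" by simp
  have "a t - A t * (t0 * N - t * (1 - t0)) = t0 * y - t * (g * y * x * r) - (N * g) * (t0 * y * x * r) + t * (1 - t0) * (g * y * x * r)"
    unfolding a_def del_def A bb by algebra
  also have "\<dots> = 0" unfolding Ng unfolding g_def using r x y by algebra
  finally show "a t = A t * (t0 * N - t * (1 - t0))" by simp
qed

lemma A_pos: "0 \<le> t \<Longrightarrow> k * t < 1 \<Longrightarrow> 0 < A t"
  unfolding A_def using u by (intro divide_pos_pos mult_pos_pos) auto

text \<open>The densities here are those of two independent events of probability b, so t0
  parametrises the independent overlap.\<close>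

lemma at_t0: "A t0 = 1 / (1 + t0)\<^sup>2" "del t0 = b * (1 - b)" "a t0 = b\<^sup>2" "q t0 = (1 - b)\<^sup>2"
  "s t0 = b / u" "P t0 = 1 / u\<^sup>2" "w t0 = (b / u)\<^sup>2"
proof -
  have D: "1 - k * t0 \<noteq> 0" "1 + t0 \<noteq> 0" using kt0 t0 by auto
  have b1: "1 - b = 1 / (1 + t0)" using D by (simp add: b_def field_simps)
  show A: "A t0 = 1 / (1 + t0)\<^sup>2" using D by (simp add: A_def u_def power2_eq_square)
  show del: "del t0 = b * (1 - b)" unfolding b1 del_def A by (simp add: b_def power2_eq_square)
  show a: "a t0 = b\<^sup>2" unfolding a_def del by algebra
  show "q t0 = (1 - b)\<^sup>2" unfolding q_def del by algebra
  show "s t0 = b / u" using D by (simp add: s_def b_def u_def)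
  have *: "(1 + t0) / (u * (1 - k * t0)) = 1 / u\<^sup>2" using D by (simp add: u_def power2_eq_square)
  show "P t0 = 1 / u\<^sup>2" using P_eq[of t0] t0 kt0 * by simp
  show "w t0 = (b / u)\<^sup>2" unfolding w_def * a by (simp add: power_divide)
qed

lemma G_t0: "G t0 = 2 * (- b * ln b + (real l - 1) * (1 - b) * ln (1 - b) - real l / (k + 1) * u * ln u)"
proof -
  have 1: "ln (b\<^sup>2) = 2 * ln b" "ln ((1 - b)\<^sup>2) = 2 * ln (1 - b)" "ln (b * (1 - b)) = ln b + ln (1 - b)"
    "ln (b / u) = ln b - ln u" "ln ((b / u)\<^sup>2) = 2 * (ln b - ln u)" "ln (1 / u\<^sup>2) = - 2 * ln u"
    using b u(1) by (auto simp: ln_mult ln_div ln_realpow)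
  have k0: "k + 1 \<noteq> 0" using k1 by simp
  define m where "m = real l / (k + 1)"
  have m: "m * (k + 1) = real l" using k0 by (simp add: m_def)
  have "m * u = m - m * (k + 1) * b" unfolding u(2) by algebra
  then have mu: "m * u = m - real l * b" using m by simp
  have "G t0 = (real l - 1) * (b\<^sup>2 * (2 * ln b) + 2 * (b * (1 - b) * (ln b + ln (1 - b))) + (1 - b)\<^sup>2 * (2 * ln (1 - b)))
     + m * (- 2 * ln u) - real l * (b\<^sup>2 * (2 * (ln b - ln u)) + 2 * (b * (1 - b) * (ln b - ln u)))"
    unfolding G_def at_t0 1 m_def by simp
  also have "\<dots> = 2 * (- b * ln b + (real l - 1) * (1 - b) * ln (1 - b) - (m - real l * b) * ln u)"
    by algebra
  finally show ?thesis unfolding mu[symmetric] by (simp add: m_def)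
qed

lemma del_deriv:
  assumes "0 \<le> t" "k * t < 1"
  shows "(del has_real_derivative u * (1 + k * t\<^sup>2) / ((1 + t) * (1 - k * t))\<^sup>2) (at t)"
proof -
  have D: "1 - k * t \<noteq> 0" "1 + t \<noteq> 0" using assms by auto
  have "del = (\<lambda>t. t * (u / ((1 + t) * (1 - k * t))))" by (simp add: fun_eq_iff del_def A_def)
  moreover have "((\<lambda>t. t * (u / ((1 + t) * (1 - k * t)))) has_real_derivative u * (1 + k * t\<^sup>2) / ((1 + t) * (1 - k * t))\<^sup>2) (at t)"
  proof -
    have "((\<lambda>t. (1 + t) * (1 - k * t)) has_real_derivative 1 - k - 2 * k * t) (at t)"
      by (auto intro!: derivative_eq_intros simp: algebra_simps)
    then have "((\<lambda>t. t * (u / ((1 + t) * (1 - k * t)))) has_real_derivative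
      1 * (u / ((1 + t) * (1 - k * t))) + (0 * ((1 + t) * (1 - k * t)) - u * (1 - k - 2 * k * t)) / ((1 + t) * (1 - k * t) * ((1 + t) * (1 - k * t))) * t) (at t)"
      using D by (intro DERIV_mult DERIV_ident DERIV_divide DERIV_const) auto
    moreover have "1 * (u / c) + (0 * c - u * (1 - k - 2 * k * t)) / (c * c) * t = u * (1 + k * t\<^sup>2) / c\<^sup>2"
      if "c = (1 + t) * (1 - k * t)" "c \<noteq> 0" for c
    proof -
      have "1 * (u / c) + (0 * c - u * (1 - k - 2 * k * t)) / (c * c) * t = u * (c - (1 - k - 2 * k * t) * t) / c\<^sup>2"
        using that(2) by (simp add: field_simps power2_eq_square)
      also have "c - (1 - k - 2 * k * t) * t = 1 + k * t\<^sup>2" unfolding that(1) by algebra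
      finally show ?thesis .
    qed
    ultimately show ?thesis using D by simp
  qed
  ultimately show ?thesis by simp
qed

text \<open>Envelope argument: w = a * P and del * P = s * (1 + k * s) say that the exponent is
  stationary in both weights, so the derivatives of \<open>s\<close> and \<open>w\<close> drop out.
  What remains is the derivative \<open>D1\<close> of \<open>del\<close> times the explicit
  dependence on the densities, which all move by D1 or - D1.\<close>

lemma G_deriv:
  assumes t: "0 < t" "k * t < 1" and at: "0 < a t" and qt: "0 < q t"
  defines "D1 \<equiv> u * (1 + k * t\<^sup>2) / ((1 + t) * (1 - k * t))\<^sup>2"
  shows "(G has_real_derivative
    D1 * (real l * (ln (w t) - 2 * ln (s t)) - (real l - 1) * (ln (a t) + ln (q t) - 2 * ln (del t)))) (at t)"
proof -
  have D: "1 - k * t > 0" "1 + t > 0" using t by auto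
  have del: "(del has_real_derivative D1) (at t)" unfolding D1_def using t by (intro del_deriv) auto
  have a': "(a has_real_derivative - D1) (at t)"
    unfolding a_def[abs_def] using DERIV_diff[OF DERIV_const del, of b] by simp
  have q': "(q has_real_derivative - D1) (at t)"
    unfolding q_def[abs_def] using DERIV_diff[OF DERIV_const del, of "1 - b"] by simp
  obtain s' where s': "(s has_real_derivative s') (at t)"
  proof
    show "(s has_real_derivative 1 / (1 - k * t)\<^sup>2) (at t)" unfolding s_def[abs_def]
      using D by (auto intro!: derivative_eq_intros simp: field_simps power2_eq_square)
  qed
  obtain v' where v': "((\<lambda>t. (1 + t) / (u * (1 - k * t))) has_real_derivative v') (at t)"
  proof
    have 1: "((\<lambda>t. 1 + t) has_real_derivative 1) (at t)" by (auto intro!: derivative_eq_intros)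
    have 2: "((\<lambda>t. 1 - k * t) has_real_derivative - k) (at t)" by (auto intro!: derivative_eq_intros)
    show "((\<lambda>t. (1 + t) / (u * (1 - k * t))) has_real_derivative
        (1 * (u * (1 - k * t)) - (1 + t) * (u * (- k))) / (u * (1 - k * t) * (u * (1 - k * t)))) (at t)"
      using D u(1) by (intro DERIV_divide 1 DERIV_cmult 2) simp
  qed
  obtain w' where w': "(w has_real_derivative w') (at t)"
    unfolding w_def[abs_def] using DERIV_mult[OF a' v'] by blast
  define p' where "p' = 2 * (k + 1) * s' + 2 * (k + 1) * k * s t * s' + (k + 1) * w'"
  have P': "(P has_real_derivative p') (at t)"
    unfolding P_def[abs_def] p'_def
    by (auto intro!: derivative_eq_intros s' w' simp: power2_eq_square)
  have Pt: "P t = (1 + t) / (u * (1 - k * t))" using t by (intro P_eq) auto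
  have Ppos: "P t > 0" unfolding Pt using D u by simp
  have st: "s t > 0" using t D by (simp add: s_def)
  have wt: "w t = a t * P t" by (simp add: w_def Pt)
  have wpos: "w t > 0" using wt at Ppos by simp
  have delt: "del t > 0" using t A_pos[of t] by (simp add: del_def)
  have dP: "del t * P t = s t * (1 + k * s t)"
  proof -
    define r where "r = 1 / (1 - k * t)"
    have r: "r * (1 - k * t) = 1" using D by (simp add: r_def)
    have "del t * P t = t * r\<^sup>2" unfolding del_def A_def Pt r_def using D u by (simp add: power2_eq_square)
    also have "\<dots> = t * r * (1 + k * (t * r))" using r by algebra
    finally show ?thesis by (simp add: s_def r_def)
  qed
  have k0: "k + 1 \<noteq> 0" using k1 by simp
  have L: "((\<lambda>t. f t * ln (g t)) has_real_derivative f' * ln (g t) + g' / g t * f t) (at t)"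
    if "(f has_real_derivative f') (at t)" "(g has_real_derivative g') (at t)" "0 < g t" for f g f' g'
    using DERIV_mult[OF that(1) DERIV_chain2[OF DERIV_ln_divide[OF that(3)] that(2)]] by simp
  have LP: "((\<lambda>t. ln (P t)) has_real_derivative 1 / P t * p') (at t)"
    by (rule DERIV_chain2[OF DERIV_ln_divide[OF Ppos] P'])
  have "(G has_real_derivative (real l - 1) * (- D1 * ln (a t) + - D1 / a t * a t + 2 * (D1 * ln (del t) + D1 / del t * del t)
       + (- D1 * ln (q t) + - D1 / q t * q t))
     + real l / (k + 1) * (1 / P t * p')
     - real l * (- D1 * ln (w t) + w' / w t * a t + 2 * (D1 * ln (s t) + s' / s t * del t))) (at t)"
    unfolding G_def[abs_def]
    by (intro DERIV_add DERIV_diff DERIV_cmult L LP a' q' del s' w' at qt st wpos delt)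
  then have "(G has_real_derivative (real l - 1) * (- D1 * ln (a t) - D1 + 2 * (D1 * ln (del t) + D1) + (- D1 * ln (q t) - D1))
     + real l / (k + 1) * (p' / P t) - real l * (- D1 * ln (w t) + a t * (w' / w t) + 2 * (D1 * ln (s t) + del t * (s' / s t)))) (at t)"
    using at qt st wpos delt Ppos by (simp add: mult.commute)
  \<comment> \<open>The envelope cancellation: the vertex term changes exactly as much as the
    monomial in the weights.\<close>
  moreover have "real l / (k + 1) * (p' / P t) = real l * (a t * (w' / w t) + 2 * (del t * (s' / s t)))"
  proof -
    have 1: "a t * (w' / w t) = w' / P t" unfolding wt using at Ppos by simp
    have "del t / s t = (1 + k * s t) / P t" using dP st Ppos by (simp add: field_simps)
    moreover have "del t * (s' / s t) = s' * (del t / s t)" by simp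
    ultimately have 2: "del t * (s' / s t) = s' * (1 + k * s t) / P t" by simp
    have "p' = (k + 1) * (w' + 2 * (s' * (1 + k * s t)))" by (simp add: p'_def algebra_simps)
    then have "real l / (k + 1) * (p' / P t) = real l * ((w' + 2 * (s' * (1 + k * s t))) / P t)" using k0 by simp
    then show ?thesis unfolding 1 2 by (simp add: add_divide_distrib)
  qed
  ultimately show ?thesis by (simp add: algebra_simps)
qed

text \<open>All powers of \<open>A\<close> cancel in X by \<open>a_eq\<close>, leaving X = ln M - ln
  (t^2 * N^(l-1)) with M = t0 * N - t * (1 - t0). Since \<open>D1\<close> is positive, the
  monotonicity of G is thereby reduced to the polynomial inequality.\<close>

lemma sign_aux:
  assumes t: "0 < t" "k * t < 1" and at: "0 < a t" and qt: "0 < q t"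
    and N: "N = 1 + k * (t0 - t) * (1 + t) / (1 - k * t0)"
  defines "X \<equiv> real l * (ln (w t) - 2 * ln (s t)) - (real l - 1) * (ln (a t) + ln (q t) - 2 * ln (del t))"
  shows "t\<^sup>2 * N ^ (l - 1) \<le> t0 * N - t * (1 - t0) \<Longrightarrow> 0 \<le> X"
    and "t0 * N - t * (1 - t0) \<le> t\<^sup>2 * N ^ (l - 1) \<Longrightarrow> X \<le> 0"
proof -
  have D: "1 - k * t > 0" "1 + t > 0" using t by auto
  have A: "A t > 0" using t A_pos[of t] by simp
  note aq = a_eq[OF less_imp_le[OF t(1)] t(2) N]
  define M where "M = t0 * N - t * (1 - t0)"
  have Npos: "N > 0" using aq(2) qt A by (simp add: zero_less_mult_iff)
  have Mpos: "M > 0" using aq(1) at A by (simp add: zero_less_mult_iff M_def)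
  have Pt: "P t = (1 + t) / (u * (1 - k * t))" using t by (intro P_eq) auto
  have st: "s t > 0" using t D by (simp add: s_def)
  have wt: "w t = a t * P t" by (simp add: w_def Pt)
  have "P t = (s t / t)\<^sup>2 / A t" 
  proof -
    have "(s t / t)\<^sup>2 = 1 / (1 - k * t)\<^sup>2" using t by (simp add: s_def power_divide)
    then show ?thesis unfolding Pt A_def using t D u by (simp add: power2_eq_square)
  qed
  then have "ln (w t) = ln (a t) + 2 * (ln (s t) - ln t) - ln (A t)"
    using at st t A unfolding wt by (simp add: ln_mult ln_div ln_realpow)
  moreover have "ln (a t) = ln (A t) + ln M" using aq(1) A Mpos by (simp add: M_def ln_mult)
  moreover have "ln (q t) = ln (A t) + ln N" using aq(2) A Npos by (simp add: ln_mult)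
  moreover have "ln (del t) = ln t + ln (A t)" using A t by (simp add: del_def ln_mult)
  ultimately have "X = ln M - 2 * ln t - (real l - 1) * ln N" unfolding X_def by algebra
  also have "\<dots> = ln M - ln (t\<^sup>2 * N ^ (l - 1))"
    using t Npos l2 by (simp add: ln_mult ln_realpow of_nat_diff)
  finally have X: "X = ln M - ln (t\<^sup>2 * N ^ (l - 1))" .
  have pos: "0 < t\<^sup>2 * N ^ (l - 1)" using t Npos by simp
  show "t\<^sup>2 * N ^ (l - 1) \<le> t0 * N - t * (1 - t0) \<Longrightarrow> 0 \<le> X"
    unfolding X M_def[symmetric] using pos Mpos by simp
  show "t0 * N - t * (1 - t0) \<le> t\<^sup>2 * N ^ (l - 1) \<Longrightarrow> X \<le> 0"
    unfolding X M_def[symmetric] using pos Mpos by simp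
qed

lemma del_mono:
  assumes "0 \<le> x" "x < y" "k * y < 1"
  shows "del x < del y"
proof (rule DERIV_pos_imp_increasing[OF assms(2)])
  fix z assume z: "x \<le> z" "z \<le> y"
  have "k * z \<le> k * y" using z k1 by (intro mult_left_mono) auto
  then have "0 \<le> z" "k * z < 1" using z assms by auto
  moreover from this have "0 < u * (1 + k * z\<^sup>2) / ((1 + z) * (1 - k * z))\<^sup>2"
    using u k1 by (intro divide_pos_pos mult_pos_pos add_pos_nonneg) auto
  ultimately show "\<exists>d. (del has_real_derivative d) (at z) \<and> 0 < d"
    using del_deriv by blast
qed

lemma q_pos: "0 \<le> a t \<Longrightarrow> 0 < q t"
proof -
  assume "0 \<le> a t"
  moreover have "1 * b \<le> k * b" using k1 b by (intro mult_right_mono) auto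
  then have "2 * b < 1" using u by (simp add: algebra_simps)
  ultimately show ?thesis by (simp add: a_def q_def)
qed

text \<open>The end points have to be included: t = 0 belongs to identical matchings and a t = 0 to
  disjoint ones. There \<open>ln (s t)\<close> or \<open>ln (w t)\<close> has argument 0; splitting
  these logarithms, as in \<open>H\<close>, leaves the singularities only in products of the form x
  * ln x.\<close>

lemma G_continuous: "continuous_on {t. 0 \<le> t \<and> k * t < 1 \<and> 0 \<le> a t} G"
proof -
  define S where "S = {t. 0 \<le> t \<and> k * t < 1 \<and> 0 \<le> a t}"
  define H where "H t = (real l - 1) * (a t * ln (a t) + 2 * (del t * ln (del t)) + q t * ln (q t))
   + real l / (k + 1) * ln ((1 + t) / (u * (1 - k * t)))
   - real l * (a t * ln (a t) + a t * ln ((1 + t) / (u * (1 - k * t)))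
     + 2 * (A t * (t * ln t) - del t * ln (1 - k * t)))" for t
  have ct: "continuous_on S A" "continuous_on S (\<lambda>t. (1 + t) / (u * (1 - k * t)))"
    unfolding A_def[abs_def] using u by (auto intro!: continuous_intros simp: S_def)
  have cd: "continuous_on S del" unfolding del_def[abs_def] by (intro continuous_intros ct)
  have ca: "continuous_on S a" unfolding a_def[abs_def] by (intro continuous_intros cd)
  have cq: "continuous_on S q" unfolding q_def[abs_def] by (intro continuous_intros cd)
  have L: "continuous_on S (\<lambda>t. f t * ln (f t))" if "continuous_on S f" "\<And>t. t \<in> S \<Longrightarrow> 0 \<le> f t" for f :: "real \<Rightarrow> real"
    using that by (intro continuous_on_compose2[OF continuous_on_x_ln_x that(1)]) auto
  have dn: "0 \<le> del t" if "t \<in> S" for t using that A_pos[of t] by (simp add: del_def S_def)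
  have an: "0 \<le> a t" "0 \<le> q t" "0 \<le> t" if "t \<in> S" for t
    using that q_pos[of t] by (auto simp: S_def less_imp_le)
  have La: "continuous_on S (\<lambda>t. a t * ln (a t))" using ca an(1) by (rule L)
  have Ld: "continuous_on S (\<lambda>t. del t * ln (del t))" using cd dn by (rule L)
  have Lq: "continuous_on S (\<lambda>t. q t * ln (q t))" using cq an(2) by (rule L)
  have Lt: "continuous_on S (\<lambda>t. t * ln t)" using an(3) by (intro L continuous_on_id)
  have v: "0 < (1 + t) / (u * (1 - k * t))" if "t \<in> S" for t
    using that u(1) by (intro divide_pos_pos mult_pos_pos) (auto simp: S_def)
  have Lv: "continuous_on S (\<lambda>t. ln ((1 + t) / (u * (1 - k * t))))"
    using v by (intro continuous_on_ln ct) force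
  have Lk: "continuous_on S (\<lambda>t. ln (1 - k * t))"
    by (intro continuous_on_ln continuous_intros) (auto simp: S_def)
  have "continuous_on S H"
    unfolding H_def[abs_def]
    by (intro continuous_on_add continuous_on_diff continuous_on_mult continuous_on_const La Ld Lq Lt Lv Lk ca cd ct(1))
  moreover have "H t = G t" if "t \<in> S" for t
  proof -
    have v: "0 < (1 + t) / (u * (1 - k * t))" using that u by (intro divide_pos_pos mult_pos_pos) (auto simp: S_def)
    have "a t * ln (w t) = a t * ln (a t) + a t * ln ((1 + t) / (u * (1 - k * t)))"
    proof (cases "a t = 0")
      case False
      then show ?thesis using that v unfolding w_def by (subst ln_mult) (auto simp: algebra_simps S_def)
    qed simp
    moreover have "del t * ln (s t) = A t * (t * ln t) - del t * ln (1 - k * t)"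
    proof (cases "t = 0")
      case False
      then show ?thesis using that unfolding s_def by (subst ln_div) (auto simp: algebra_simps del_def S_def)
    qed (simp add: del_def)
    ultimately show ?thesis using that by (simp add: H_def G_def P_eq S_def)
  qed
  ultimately have "continuous_on S G" using continuous_on_cong[of S S H G] by simp
  then show ?thesis by (simp add: S_def)
qed

text \<open>The derivative is nonnegative before t0 and nonpositive after it, in the interior where
  a is positive; continuity extends the comparison to the end points.\<close>

lemma G_le:
  assumes c: "second_moment_cond k (l - 1) t0" and t: "0 \<le> t" "k * t < 1" "0 \<le> a t"
  shows "G t \<le> G t0"
proof -
  have kx: "k * x < 1" if "x \<le> max t t0" for x
  proof -
    have "k * x \<le> k * max t t0" using that k1 by (intro mult_left_mono) auto
    also have "\<dots> < 1" using t kt0 by (auto simp: max_def)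
    finally show ?thesis .
  qed
  have deriv: "\<exists>y. (G has_real_derivative y) (at x) \<and> (if x \<le> t0 then 0 \<le> y else y \<le> 0)"
    if x: "0 < x" "x \<le> max t t0" and ax: "0 < a x" for x
  proof -
    define N where "N = 1 + k * (t0 - x) * (1 + x) / (1 - k * t0)"
    define X where "X = real l * (ln (w x) - 2 * ln (s x)) - (real l - 1) * (ln (a x) + ln (q x) - 2 * ln (del x))"
    define D1 where "D1 = u * (1 + k * x\<^sup>2) / ((1 + x) * (1 - k * x))\<^sup>2"
    have kx': "k * x < 1" using x kx by blast
    have qx: "0 < q x" using ax q_pos by simp
    have D1: "0 \<le> D1" unfolding D1_def using u k1 by simp
    have der: "(G has_real_derivative D1 * X) (at x)"
      unfolding D1_def X_def using G_deriv[OF x(1) kx' ax qx] by simp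
    note sg = sign_aux[OF x(1) kx' ax qx N_def, folded X_def]
    show ?thesis
    proof (cases "x \<le> t0")
      case True
      have "0 \<le> X"
        using second_moment_cond_below[OF k1 t0 kt0 c] x True
        by (intro sg(1) overlap_poly_below[OF k1 _ _ kt0 _ N_def]) auto
      then show ?thesis using der D1 True by (auto intro!: exI[of _ "D1 * X"])
    next
      case False
      have A: "A x > 0" using x kx' A_pos[of x] by simp
      note aq = a_eq[OF less_imp_le[OF x(1)] kx' N_def]
      have N0: "N > 0" using aq(2) qx A by (simp add: zero_less_mult_iff)
      \<comment> \<open>Positivity of \<open>a x\<close>, multiplied by 1 - k * t0, is the
        restriction on x that \<open>second_moment_cond_above\<close> asks for.\<close>
      have "0 < t0 * N - x * (1 - t0)" using aq(1) ax A by (simp add: zero_less_mult_iff)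
      then have "0 < (t0 * N - x * (1 - t0)) * (1 - k * t0)" using kt0 by simp
      also have "(t0 * N - x * (1 - t0)) * (1 - k * t0)
          = t0 * (N * (1 - k * t0)) - x * (1 - t0) * (1 - k * t0)" by algebra
      also have "N * (1 - k * t0) = (1 - k * t0) + k * (t0 - x) * (1 + x)"
        unfolding N_def using kt0 by (simp add: field_simps)
      also have "t0 * (1 - k * t0 + k * (t0 - x) * (1 + x)) - x * (1 - t0) * (1 - k * t0)
          = t0 - (x * (1 - t0) + k * t0 * x\<^sup>2)" by algebra
      finally have qd: "x * (1 - t0) + k * t0 * x\<^sup>2 \<le> t0" by simp
      have "k * real (l - 1) * x\<^sup>2 \<le> 1"
        using False l2 kx' by (intro second_moment_cond_above[OF k1 t0 kt0 _ c _ _ qd]) auto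
      then have "X \<le> 0"
        using False N0 t0 by (intro sg(2) overlap_poly_above[OF k1 _ _ kt0 _ N_def]) auto
      then show ?thesis using der D1 False by (auto intro!: exI[of _ "D1 * X"] simp: mult_nonneg_nonpos)
    qed
  qed
  have at0: "0 < a t0" unfolding at_t0 using b by simp
  show ?thesis
  proof (cases "t \<le> t0")
    case True
    show ?thesis
    proof (rule DERIV_nonneg_imp_increasing_open[OF True])
      fix x assume x: "t < x" "x < t0"
      have "a t0 < a x" using del_mono[of x t0] x t kt0 by (simp add: a_def)
      then show "\<exists>y. (G has_real_derivative y) (at x) \<and> 0 \<le> y"
        using deriv[of x] x t at0 by auto
    next
      have "0 \<le> a x" if "t \<le> x" "x \<le> t0" for x
        using that at0 t kt0 del_mono[of x t0] by (cases "x = t0") (auto simp: a_def)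
      then show "continuous_on {t..t0} G"
        using t kx True by (intro continuous_on_subset[OF G_continuous]) auto
    qed
  next
    case False
    have ax: "a t < a x" if "t0 \<le> x" "x < t" for x
      using that t t0 del_mono[of x t] by (simp add: a_def)
    show ?thesis
    proof (rule DERIV_nonpos_imp_decreasing_open[of t0 t])
      show "t0 \<le> t" using False by simp
      fix x assume x: "t0 < x" "x < t"
      then have "a t < a x" by (intro ax) auto
      then show "\<exists>y. (G has_real_derivative y) (at x) \<and> y \<le> 0"
        using deriv[of x] x t0 t by auto
    next
      have "0 \<le> a x" if "t0 \<le> x" "x \<le> t" for x
        using that t ax[of x] by (cases "x = t") auto
      then show "continuous_on {t0..t} G"
        using t kx t0 by (intro continuous_on_subset[OF G_continuous]) auto
    qed
  qed
qed

text \<open>The curve meets every possible overlap. Clearing denominators in del t = x gives the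
  quadratic \<open>h\<close>, which is at most 0 at t = 0 and positive at t = 1 / k.\<close>

lemma del_surj:
  assumes "0 \<le> x" "x \<le> b"
  obtains t where "0 \<le> t" "k * t < 1" "del t = x" "0 \<le> a t"
proof -
  define h where "h t = t * u - x * ((1 + t) * (1 - k * t))" for t
  have kk: "k * (1 / k) = 1" using k1 by simp
  have h1: "h (1 / k) > 0" using u k1 by (simp add: h_def)
  have "\<exists>t\<ge>0. t \<le> 1 / k \<and> h t = 0"
    using h1 assms k1 by (intro IVT') (auto simp: h_def intro!: continuous_intros)
  then obtain t where t: "0 \<le> t" "t \<le> 1 / k" "h t = 0" by blast
  have "t \<noteq> 1 / k" using h1 t by auto
  then have "t < 1 / k" using t by simp
  then have kt: "k * t < 1" using k1 by (simp add: field_simps)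
  have "t * u = x * ((1 + t) * (1 - k * t))" "(1 + t) * (1 - k * t) \<noteq> 0" using t kt by (auto simp: h_def)
  then have "del t = x" by (simp add: del_def A_def del: mult_eq_0_iff)
  then show ?thesis using that t kt assms by (simp add: a_def)
qed

end

text \<open>Each weight vanishes exactly when the density that serves as its exponent does, so that
  the monomial in the weights stays positive by 0^0 = 1, even for disjoint or identical
  matchings.\<close>

lemma overlap_exponent_le:
  fixes d l :: nat and \<beta> y :: real
  assumes d: "d \<ge> 2" and l: "l \<ge> 2" and \<beta>: "0 < \<beta>" "\<beta> < 1 / real d"
    and c: "second_moment_cond (real d - 1) (l - 1) (\<beta> / (1 - \<beta>))"
    and y: "0 \<le> y" "y \<le> \<beta>"
  obtains s w where "0 \<le> s" "0 \<le> w" "s = 0 \<longleftrightarrow> y = \<beta>" "w = 0 \<longleftrightarrow> y = 0"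
    "(real l - 1) * (y * ln y + 2 * ((\<beta> - y) * ln (\<beta> - y)) + (1 - 2 * \<beta> + y) * ln (1 - 2 * \<beta> + y))
       + real l / real d * ln (1 + 2 * real d * s + real d * (real d - 1) * s\<^sup>2 + real d * w)
       - real l * (y * ln w + 2 * ((\<beta> - y) * ln s)) \<le> 2 * Phi d l \<beta>"
proof -
  define k where "k = real d - 1"
  define t0 where "t0 = \<beta> / (1 - \<beta>)"
  have dk: "real d = k + 1" by (simp add: k_def)
  have k1: "1 \<le> k" using d by (simp add: k_def)
  have db: "real d * \<beta> < 1" using \<beta> d by (simp add: field_simps)
  have "1 * \<beta> \<le> real d * \<beta>" using d \<beta> by (intro mult_right_mono) auto
  then have b1: "\<beta> < 1" using db by simp
  interpret overlap k t0 l
  proof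
    show "k * t0 < 1" using db b1 by (simp add: k_def t0_def field_simps)
  qed (use k1 \<beta> b1 l in \<open>auto simp: t0_def\<close>)
  have b: "b = \<beta>" unfolding b_def unfolding t0_def using b1 by (simp add: field_simps)
  obtain t where t: "0 \<le> t" "k * t < 1" "del t = \<beta> - y" "0 \<le> a t"
    using del_surj[of "\<beta> - y"] y b by auto
  have at: "a t = y" using t by (simp add: a_def b)
  have qt: "q t = 1 - 2 * \<beta> + y" using t by (simp add: q_def b)
  have v: "0 < (1 + t) / (u * (1 - k * t))" using t u by (intro divide_pos_pos mult_pos_pos) auto
  have uu: "u = 1 - real d * \<beta>" using u(2) b dk by simp
  show ?thesis
  proof (rule that[of "s t" "w t"])
    show "0 \<le> s t" using t by (simp add: s_def)
    show "0 \<le> w t" unfolding w_def using t v by (intro mult_nonneg_nonneg) auto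
    have "del t = 0 \<longleftrightarrow> t = 0" using A_pos[of t] t by (auto simp: del_def)
    then show "s t = 0 \<longleftrightarrow> y = \<beta>" using t by (auto simp: s_def)
    show "w t = 0 \<longleftrightarrow> y = 0" using v at by (auto simp: w_def)
    have "G t \<le> G t0" using t c by (intro G_le) (auto simp: k_def t0_def)
    also have "G t0 = 2 * Phi d l \<beta>"
      unfolding G_t0 Phi_def b uu dk[symmetric] by simp
    finally show "(real l - 1) * (y * ln y + 2 * ((\<beta> - y) * ln (\<beta> - y)) + (1 - 2 * \<beta> + y) * ln (1 - 2 * \<beta> + y))
       + real l / real d * ln (1 + 2 * real d * s t + real d * (real d - 1) * (s t)\<^sup>2 + real d * w t)
       - real l * (y * ln (w t) + 2 * ((\<beta> - y) * ln (s t))) \<le> 2 * Phi d l \<beta>"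
      by (simp add: G_def P_def at qt t(3) dk mult_ac)
  qed
qed

section \<open>Concentration for random permutations\<close>

text \<open>For x = - y < 0 the claim is exp y * (1 - y + y^2) \<ge> 1, and this already holds with
  exp y replaced by its quadratic Taylor polynomial.\<close>

lemma exp_le_one_plus_square:
  fixes x :: real
  assumes "\<bar>x\<bar> \<le> 1"
  shows "exp x \<le> 1 + x + x\<^sup>2"
proof (cases "0 \<le> x")
  case True
  then show ?thesis using assms exp_bound by auto
next
  case False
  define y where "y = - x"
  have y: "0 \<le> y" "y \<le> 1" using assms False by (auto simp: y_def)
  have "1 + y + y\<^sup>2 / 2 \<le> exp y" using y(1) by (rule exp_lower_Taylor_quadratic)
  moreover have "1 \<le> (1 + y + y\<^sup>2 / 2) * (1 - y + y\<^sup>2)"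
  proof -
    have "(1 + y + y\<^sup>2 / 2) * (1 - y + y\<^sup>2) = 1 + (y\<^sup>2 * (1 + y + y\<^sup>2)) / 2" by (simp add: field_simps) algebra
    then show ?thesis using y by simp
  qed
  moreover have "0 \<le> 1 - y + y\<^sup>2" using y by simp
  ultimately have "1 \<le> exp y * (1 - y + y\<^sup>2)" by (meson mult_right_mono order_trans)
  then have "exp (- y) \<le> 1 - y + y\<^sup>2" by (simp add: exp_minus field_simps)
  then show ?thesis by (simp add: y_def)
qed

text \<open>Revealing the images one at a time gives a martingale whose increments are bounded by
  \<open>2 * c\<close>; this is the exponential moment bound behind the Azuma-Hoeffding inequality.\<close>

lemma permutation_exp_moment:
  fixes f :: "('a \<Rightarrow> 'a) \<Rightarrow> real" and c t :: real
  assumes "finite A"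
    and "\<And>p x y. p permutes A \<Longrightarrow> x \<in> A \<Longrightarrow> y \<in> A \<Longrightarrow> \<bar>f (Transposition.transpose x y \<circ> p) - f p\<bar> \<le> c"
    and c: "0 \<le> c" and t: "\<bar>t\<bar> * (2 * c) \<le> 1"
  shows "(\<Sum>p | p permutes A. exp (t * (f p - (\<Sum>p | p permutes A. f p) / fact (card A))))
    \<le> fact (card A) * exp ((t * (2 * c))\<^sup>2 * real (card A))"
  using assms(1,2)
proof (induction A arbitrary: f rule: finite_induct)
  case empty
  then show ?case by simp
next
  case (insert a S)
  define n where "n = card S"
  \<comment> \<open>Composing a permutation of S with the transposition of a and b gives the
    permutations sending a to b. So \<open>\<mu> b\<close> is the conditional mean given that image,
    and \<open>\<nu>\<close> is the full mean.\<close>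
  define F where "F b p = f (Transposition.transpose a b \<circ> p)" for b p
  define \<mu> where "\<mu> b = (\<Sum>p | p permutes S. F b p) / fact n" for b
  define \<nu> where "\<nu> = (\<Sum>b\<in>insert a S. \<mu> b) / real (Suc n)"
  have cardS: "card {p. p permutes S} = fact n" using insert(1) card_permutations n_def by blast
  have cardi: "card (insert a S) = Suc n" using insert by (simp add: n_def)
  have perm: "p permutes insert a S" if "p permutes S" for p using that by (simp add: permutes_subset subset_insertI)
  have \<mu>\<nu>: "(\<Sum>p | p permutes insert a S. f p) / fact (card (insert a S)) = \<nu>"
  proof -
    have "(\<Sum>p | p permutes insert a S. f p) = (\<Sum>b\<in>insert a S. \<mu> b * fact n)"
      by (simp add: sum_over_permutations_insert[OF insert(1,2)] F_def \<mu>_def)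
    also have "\<dots> = (\<nu> * real (Suc n)) * fact n"
      unfolding \<nu>_def by (simp add: sum_distrib_right[symmetric] del: sum.insert of_nat_Suc)
    finally have "(\<Sum>p | p permutes insert a S. f p) = \<nu> * fact (Suc n)" by simp
    then show ?thesis unfolding cardi by (simp del: fact_Suc)
  qed
  have sum0: "(\<Sum>b\<in>insert a S. \<mu> b - \<nu>) = 0"
    by (simp add: sum_subtractf cardi \<nu>_def del: sum.insert)
  have bound: "\<bar>\<mu> b - \<mu> a\<bar> \<le> c" if b: "b \<in> insert a S" for b
  proof -
    have "\<mu> b - \<mu> a = (\<Sum>p | p permutes S. F b p - F a p) / fact n"
      by (simp add: \<mu>_def sum_subtractf diff_divide_distrib)
    also have "\<bar>\<dots>\<bar> \<le> (\<Sum>p | p permutes S. \<bar>F b p - F a p\<bar>) / fact n"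
      by (simp add: abs_divide divide_right_mono)
    also have "\<dots> \<le> (\<Sum>p | p permutes S. c) / fact n"
    proof (intro divide_right_mono sum_mono)
      fix p assume "p \<in> {p. p permutes S}"
      then have "p permutes insert a S" using perm by simp
      from insert.prems(1)[OF this, of a b] b show "\<bar>F b p - F a p\<bar> \<le> c" by (simp add: F_def comp_def)
    qed simp
    also have "\<dots> = c" by (simp add: cardS)
    finally show ?thesis .
  qed
  \<comment> \<open>Any two conditional means differ by at most 2 * c, via \<open>\<mu> a\<close>;
    averaging over the second one compares \<open>\<mu> b\<close> with the mean
    \<open>\<nu>\<close>.\<close>
  have bound': "\<bar>\<mu> b - \<nu>\<bar> \<le> 2 * c" if b: "b \<in> insert a S" for b
  proof -
    have "real (Suc n) * (\<mu> b - \<nu>) = (\<Sum>b'\<in>insert a S. \<mu> b - \<mu> b')"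
    proof -
      have "real (Suc n) * \<nu> = (\<Sum>b\<in>insert a S. \<mu> b)" by (simp add: \<nu>_def del: sum.insert of_nat_Suc)
      then show ?thesis by (simp add: sum_subtractf cardi right_diff_distrib del: sum.insert of_nat_Suc)
    qed
    also have "\<bar>\<dots>\<bar> \<le> (\<Sum>b'\<in>insert a S. \<bar>\<mu> b - \<mu> b'\<bar>)" by (rule sum_abs)
    also have "\<dots> \<le> (\<Sum>b'\<in>insert a S. 2 * c)"
      using bound[OF b] bound by (intro sum_mono) fastforce
    also have "\<dots> = real (Suc n) * (2 * c)" by (simp only: sum_constant cardi)
    finally show ?thesis by (simp add: abs_mult del: of_nat_Suc)
  qed
  define v where "v = (t * (2 * c))\<^sup>2"
  have IH: "(\<Sum>p | p permutes S. exp (t * (F b p - \<mu> b))) \<le> fact n * exp (v * real n)"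
    if b: "b \<in> insert a S" for b
    unfolding \<mu>_def n_def v_def
  proof (rule insert.IH)
    fix p x y assume p: "p permutes S" "x \<in> S" "y \<in> S"
    define \<tau> where "\<tau> = Transposition.transpose a b"
    \<comment> \<open>Conjugation by the transposition \<open>\<tau>\<close> moves the inner
      transposition to the outside, where the Lipschitz hypothesis on f applies.\<close>
    have "\<tau> \<circ> (Transposition.transpose x y \<circ> p) = Transposition.transpose (\<tau> x) (\<tau> y) \<circ> (\<tau> \<circ> p)"
    proof -
      have "inj \<tau>" by (simp add: \<tau>_def)
      then show ?thesis by (auto simp: fun_eq_iff Transposition.transpose_def dest: injD)
    qed
    moreover have "\<tau> permutes insert a S" using b unfolding \<tau>_def by (intro permutes_swap_id) auto
    moreover from this have "\<tau> \<circ> p permutes insert a S" "\<tau> x \<in> insert a S" "\<tau> y \<in> insert a S"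
      using p perm by (auto intro: permutes_compose simp: permutes_in_image simp del: insert_iff)
    ultimately show "\<bar>F b (Transposition.transpose x y \<circ> p) - F b p\<bar> \<le> c"
      unfolding F_def \<tau>_def[symmetric] using insert.prems by metis
  qed
  have "(\<Sum>p | p permutes insert a S. exp (t * (f p - \<nu>)))
      = (\<Sum>b\<in>insert a S. (\<Sum>p | p permutes S. exp (t * (F b p - \<mu> b))) * exp (t * (\<mu> b - \<nu>)))"
    unfolding sum_over_permutations_insert[OF insert(1,2)] F_def sum_distrib_right exp_add[symmetric]
    by (intro sum.cong refl) (simp add: algebra_simps)
  also have "\<dots> \<le> (\<Sum>b\<in>insert a S. (fact n * exp (v * real n)) * (1 + t * (\<mu> b - \<nu>) + v))"
  proof (intro sum_mono mult_mono IH)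
    fix b assume b: "b \<in> insert a S"
    have le: "\<bar>t * (\<mu> b - \<nu>)\<bar> \<le> \<bar>t\<bar> * (2 * c)"
      unfolding abs_mult using bound'[OF b] by (rule mult_left_mono) simp
    then have "exp (t * (\<mu> b - \<nu>)) \<le> 1 + t * (\<mu> b - \<nu>) + (t * (\<mu> b - \<nu>))\<^sup>2"
      using t by (intro exp_le_one_plus_square) simp
    also have "(t * (\<mu> b - \<nu>))\<^sup>2 \<le> v"
      unfolding v_def abs_le_square_iff[symmetric] using le c by (simp add: abs_mult)
    finally show "exp (t * (\<mu> b - \<nu>)) \<le> 1 + t * (\<mu> b - \<nu>) + v" by simp
  qed auto
  also have "\<dots> = (fact n * exp (v * real n)) * (\<Sum>b\<in>insert a S. 1 + t * (\<mu> b - \<nu>) + v)"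
    by (rule sum_distrib_left[symmetric])
  \<comment> \<open>The terms linear in t cancel because \<open>\<nu>\<close> is the average of the
    \<open>\<mu> b\<close>; only the quadratic remainder v survives.\<close>
  also have "(\<Sum>b\<in>insert a S. 1 + t * (\<mu> b - \<nu>) + v) = real (Suc n) * (1 + v)"
  proof -
    have "(\<Sum>b\<in>insert a S. 1 + t * (\<mu> b - \<nu>) + v) = (\<Sum>b\<in>insert a S. (1 + v) + t * (\<mu> b - \<nu>))"
      by (intro sum.cong) auto
    also have "\<dots> = real (Suc n) * (1 + v) + t * (\<Sum>b\<in>insert a S. \<mu> b - \<nu>)"
      by (simp only: sum.distrib sum_constant cardi sum_distrib_left distrib_left mult_1_right)
    finally show ?thesis by (simp only: sum0)
  qed
  also have "(fact n * exp (v * real n)) * (real (Suc n) * (1 + v)) \<le> (fact n * exp (v * real n)) * (real (Suc n) * exp v)"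
    by (intro mult_left_mono) auto
  also have "\<dots> = fact (Suc n) * exp (v * real (Suc n))" by (simp add: exp_add algebra_simps)
  finally show ?case unfolding \<mu>\<nu> unfolding cardi v_def .
qed

lemma permutation_concentration:
  fixes f :: "('a \<Rightarrow> 'a) \<Rightarrow> real" and c \<epsilon> :: real
  assumes fin: "finite A"
    and lip: "\<And>p x y. p permutes A \<Longrightarrow> x \<in> A \<Longrightarrow> y \<in> A \<Longrightarrow> \<bar>f (Transposition.transpose x y \<circ> p) - f p\<bar> \<le> c"
    and c: "0 < c" and \<epsilon>: "0 < \<epsilon>" "\<epsilon> \<le> 4 * c"
  defines "\<mu> \<equiv> (\<Sum>p | p permutes A. f p) / fact (card A)"
  shows "real (card {p. p permutes A \<and> f p \<ge> \<mu> + \<epsilon> * real (card A)}) \<le> fact (card A) * exp (- (\<epsilon> / (4 * c))\<^sup>2 * real (card A))"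
    and "real (card {p. p permutes A \<and> f p \<le> \<mu> - \<epsilon> * real (card A)}) \<le> fact (card A) * exp (- (\<epsilon> / (4 * c))\<^sup>2 * real (card A))"
proof -
  have main: "real (card {p. p permutes A \<and> \<sigma> * (f p - \<mu>) \<ge> \<epsilon> * real (card A)}) \<le> fact (card A) * exp (- (\<epsilon> / (4 * c))\<^sup>2 * real (card A))"
    if \<sigma>: "\<bar>\<sigma>\<bar> = 1" for \<sigma>
  proof -
    define B where "B = {p. p permutes A \<and> \<sigma> * (f p - \<mu>) \<ge> \<epsilon> * real (card A)}"
    define n where "n = real (card A)"
    \<comment> \<open>This value minimises (2 * c * \<tau>)^2 - \<tau> * \<epsilon>, the exponent in
      Chernoff's bound; the minimum is - (\<epsilon> / (4 * c))^2. The assumption \<epsilon> \<le> 4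
      * c keeps 2 * c * \<tau> \<le> 1, as the moment bound requires.\<close>
    define \<tau> where "\<tau> = \<epsilon> / (8 * c\<^sup>2)"
    have \<tau>: "0 < \<tau>" using c \<epsilon> by (simp add: \<tau>_def)
    have finP: "finite {p. p permutes A}" using fin by (rule finite_permutations)
    have "\<tau> * (2 * c) = \<epsilon> / (4 * c)" using c by (simp add: \<tau>_def power2_eq_square)
    then have t1: "\<tau> * (2 * c) \<le> 1" and tsq: "(\<tau> * (2 * c))\<^sup>2 = (\<epsilon> / (4 * c))\<^sup>2" using c \<epsilon> by auto
    have te: "\<tau> * \<epsilon> = 2 * (\<epsilon> / (4 * c))\<^sup>2" using c by (simp add: \<tau>_def power_divide power2_eq_square)
    have s2: "(\<sigma> * \<tau> * (2 * c))\<^sup>2 = (\<epsilon> / (4 * c))\<^sup>2"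
      using \<sigma> tsq by (metis (no_types) abs_mult abs_one mult.assoc mult_1 power2_abs power_mult_distrib)
    have "real (card B) * exp (\<tau> * \<epsilon> * n) = (\<Sum>p\<in>B. exp (\<tau> * \<epsilon> * n))" by simp
    also have "\<dots> \<le> (\<Sum>p\<in>B. exp (\<sigma> * \<tau> * (f p - \<mu>)))"
    proof (intro sum_mono)
      fix p assume "p \<in> B"
      then have "\<tau> * (\<epsilon> * n) \<le> \<tau> * (\<sigma> * (f p - \<mu>))" using \<tau> by (intro mult_left_mono) (auto simp: B_def n_def)
      then show "exp (\<tau> * \<epsilon> * n) \<le> exp (\<sigma> * \<tau> * (f p - \<mu>))" by (simp add: mult_ac)
    qed
    also have "\<dots> \<le> (\<Sum>p | p permutes A. exp (\<sigma> * \<tau> * (f p - \<mu>)))"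
      using finP by (intro sum_mono2) (auto simp: B_def)
    also have "\<dots> \<le> fact (card A) * exp ((\<sigma> * \<tau> * (2 * c))\<^sup>2 * real (card A))"
      unfolding \<mu>_def using lip c \<tau> \<sigma> t1
      by (intro permutation_exp_moment[OF fin]) (auto simp: abs_mult)
    finally have "real (card B) * exp (\<tau> * \<epsilon> * n) \<le> fact (card A) * exp ((\<epsilon> / (4 * c))\<^sup>2 * n)"
      unfolding s2 n_def .
    then have "real (card B) * exp (\<tau> * \<epsilon> * n) * exp (- \<tau> * \<epsilon> * n) \<le> fact (card A) * exp ((\<epsilon> / (4 * c))\<^sup>2 * n) * exp (- \<tau> * \<epsilon> * n)"
      by (rule mult_right_mono) simp
    then have "real (card B) \<le> fact (card A) * exp ((\<epsilon> / (4 * c))\<^sup>2 * n - \<tau> * \<epsilon> * n)"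
      by (simp add: mult.assoc exp_add[symmetric] exp_minus_inverse)
    also have "(\<epsilon> / (4 * c))\<^sup>2 * n - \<tau> * \<epsilon> * n = - (\<epsilon> / (4 * c))\<^sup>2 * n" unfolding te by (simp add: algebra_simps)
    finally show ?thesis by (simp add: B_def n_def)
  qed
  show "real (card {p. p permutes A \<and> f p \<ge> \<mu> + \<epsilon> * real (card A)}) \<le> fact (card A) * exp (- (\<epsilon> / (4 * c))\<^sup>2 * real (card A))"
    using main[of 1] by (simp add: algebra_simps)
  have "{p. p permutes A \<and> f p \<le> \<mu> - \<epsilon> * real (card A)} = {p. p permutes A \<and> -1 * (f p - \<mu>) \<ge> \<epsilon> * real (card A)}"
    by (auto simp: algebra_simps)
  then show "real (card {p. p permutes A \<and> f p \<le> \<mu> - \<epsilon> * real (card A)}) \<le> fact (card A) * exp (- (\<epsilon> / (4 * c))\<^sup>2 * real (card A))"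
    using main[of "-1"] by simp
qed

section \<open>Transversals of random configurations\<close>

text \<open>A blockwise form of injectivity of the vertex map. Unlike the definite description in
  \<open>vertex_of\<close>, it passes directly to images of P under permutations and to the
  insertion of a block.\<close>

definition transversal :: "'a set set \<Rightarrow> 'a set \<Rightarrow> bool" where
  "transversal P S \<longleftrightarrow> (\<forall>V\<in>P. \<forall>x\<in>S \<inter> V. \<forall>y\<in>S \<inter> V. x = y)"

lemma transversal_insert:
  "transversal (insert V P) S \<longleftrightarrow> (\<forall>x\<in>S \<inter> V. \<forall>y\<in>S \<inter> V. x = y) \<and> transversal P S"
  by (auto simp: transversal_def)

lemma transversal_mono: "transversal P S \<Longrightarrow> T \<subseteq> S \<Longrightarrow> transversal P T"
  by (auto simp: transversal_def)

lemma transversal_cong_blocks: "(\<And>V. V \<in> P \<Longrightarrow> S \<inter> V = T \<inter> V) \<Longrightarrow> transversal P S \<longleftrightarrow> transversal P T"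
  by (simp add: transversal_def)

lemma transversal_image:
  assumes "inj \<sigma>"
  shows "transversal ((`) \<sigma> ` P) (\<sigma> ` S) \<longleftrightarrow> transversal P S"
  unfolding transversal_def using assms by (auto simp: image_Int[symmetric] inj_eq)

definition pairs_of_type :: "'a set \<Rightarrow> nat \<Rightarrow> nat \<Rightarrow> nat \<Rightarrow> ('a set \<times> 'a set) set" where
  "pairs_of_type A i j k = {(S, T). S \<subseteq> A \<and> T \<subseteq> A \<and> card (S \<inter> T) = i \<and> card (S - T) = j \<and> card (T - S) = k}"

lemma finite_pairs_of_type: "finite A \<Longrightarrow> finite (pairs_of_type A i j k)"
  by (rule finite_subset[of _ "Pow A \<times> Pow A"]) (auto simp: pairs_of_type_def)

text \<open>The type fixes how many points of A have each of the four membership patterns. Equal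
  multisets of patterns are matched by a permutation of A, so the pairs of one type form a single
  orbit.\<close>

lemma pairs_of_type_orbit:
  assumes "finite A" "(S, T) \<in> pairs_of_type A i j k" "(S', T') \<in> pairs_of_type A i j k"
  obtains \<sigma> where "\<sigma> permutes A" "\<sigma> ` S = S'" "\<sigma> ` T = T'"
proof -
  define f where "f = (\<lambda>x. (x \<in> S, x \<in> T))"
  define f' where "f' = (\<lambda>x. (x \<in> S', x \<in> T'))"
  have fin: "finite S" "finite T" "finite S'" "finite T'"
    using assms by (auto simp: pairs_of_type_def intro: finite_subset)
  have card: "card {x\<in>A. (x \<in> U, x \<in> V) = c} =
      (case c of (True, True) \<Rightarrow> i | (True, False) \<Rightarrow> j | (False, True) \<Rightarrow> k | _ \<Rightarrow> card A - (i + j + k))"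
    if UV: "(U, V) \<in> pairs_of_type A i j k" for U V c
  proof -
    have sub: "U \<subseteq> A" "V \<subseteq> A" and c3: "card (U \<inter> V) = i" "card (U - V) = j" "card (V - U) = k"
      using UV by (auto simp: pairs_of_type_def)
    have finU: "finite U" "finite V" using sub assms(1) by (auto intro: finite_subset)
    have e: "{x\<in>A. x \<in> U \<and> x \<in> V} = U \<inter> V" "{x\<in>A. x \<in> U \<and> x \<notin> V} = U - V" "{x\<in>A. x \<notin> U \<and> x \<in> V} = V - U"
      "{x\<in>A. x \<notin> U \<and> x \<notin> V} = A - (U \<union> V)" using sub by auto
    have "U \<union> V = (U \<inter> V) \<union> (U - V) \<union> (V - U)" by auto
    also have "card \<dots> = card ((U \<inter> V) \<union> (U - V)) + card (V - U)"
      using finU by (intro card_Un_disjoint) auto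
    also have "card ((U \<inter> V) \<union> (U - V)) = card (U \<inter> V) + card (U - V)"
      using finU by (intro card_Un_disjoint) auto
    finally have "card (U \<union> V) = i + j + k" using c3 by simp
    then have "card (A - (U \<union> V)) = card A - (i + j + k)"
      using sub finU by (subst card_Diff_subset) auto
    then show ?thesis using c3 e by (auto split: prod.splits bool.splits)
  qed
  have "image_mset f (mset_set A) = image_mset f' (mset_set A)"
  proof (rule multiset_eqI)
    fix c
    have "count (image_mset g (mset_set A)) c = card {x\<in>A. g x = c}" for g :: "'a \<Rightarrow> bool \<times> bool"
      using assms(1) by (auto simp: count_image_mset' intro!: arg_cong[where f = card])
    then show "count (image_mset f (mset_set A)) c = count (image_mset f' (mset_set A)) c"
      using card[OF assms(2), of c] card[OF assms(3), of c] by (simp add: f_def f'_def)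
  qed
  then obtain \<sigma> where \<sigma>: "\<sigma> permutes A" "\<forall>x\<in>A. f x = f' (\<sigma> x)"
    using image_mset_eq_implies_permutes assms(1) by blast
  have im: "\<sigma> ` U = U'" if "U \<subseteq> A" "U' \<subseteq> A" "\<forall>x\<in>A. x \<in> U \<longleftrightarrow> \<sigma> x \<in> U'" for U U'
  proof
    show "\<sigma> ` U \<subseteq> U'" using that by auto
    show "U' \<subseteq> \<sigma> ` U"
    proof
      fix y assume y: "y \<in> U'"
      then have "y \<in> \<sigma> ` A" using that \<sigma>(1) permutes_image by blast
      then show "y \<in> \<sigma> ` U" using that y by auto
    qed
  qed
  show ?thesis
    using assms(2,3) \<sigma> by (intro that[of \<sigma>] im) (auto simp: pairs_of_type_def f_def f'_def)
qed

text \<open>A pair is chosen as its intersection followed by the two differences; the product of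
  binomials collapses to a multinomial coefficient.\<close>

lemma card_pairs_of_type:
  assumes "finite A" "i + j + k \<le> card A"
  shows "real (card (pairs_of_type A i j k)) =
    fact (card A) / (fact i * fact j * fact k * fact (card A - i - j - k))"
proof -
  define X where "X = {I. I \<subseteq> A \<and> card I = i}"
  define Y where "Y I = {J. J \<subseteq> A - I \<and> card J = j}" for I
  define Z where "Z I J = {K. K \<subseteq> A - I - J \<and> card K = k}" for I J
  define n where "n = card A"
  have "bij_betw (\<lambda>(S, T). (S \<inter> T, S - T, T - S)) (pairs_of_type A i j k) (SIGMA I:X. SIGMA J:Y I. Z I J)"
    by (rule bij_betwI[where g = "\<lambda>(I, J, K). (I \<union> J, I \<union> K)"])
       (auto simp: pairs_of_type_def X_def Y_def Z_def Int_Un_distrib Int_Un_distrib2 Un_Diff Diff_triv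
          intro!: arg_cong[where f = card])
  then have "card (pairs_of_type A i j k) = card (SIGMA I:X. SIGMA J:Y I. Z I J)"
    by (rule bij_betw_same_card)
  also have "\<dots> = (n choose i) * (((n - i) choose j) * ((n - i - j) choose k))"
  proof -
    have fX: "finite X" unfolding X_def using assms(1) by simp
    have fY: "finite (Y I)" for I unfolding Y_def using assms(1) by simp
    have fZ: "finite (Z I J)" for I J unfolding Z_def using assms(1) by simp
    have cX: "card X = n choose i" unfolding X_def n_def using assms(1) by (simp add: n_subsets)
    have cY: "card (Y I) = (n - i) choose j" if "I \<in> X" for I
    proof -
      have "card (A - I) = n - i" using that assms(1) unfolding X_def n_def
        by (auto simp: card_Diff_subset finite_subset)
      then show ?thesis unfolding Y_def using assms(1) by (simp add: n_subsets)
    qed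
    have cZ: "card (Z I J) = (n - i - j) choose k" if "I \<in> X" "J \<in> Y I" for I J
    proof -
      have "card (A - I) = n - i" using that assms(1) unfolding X_def n_def
        by (auto simp: card_Diff_subset finite_subset)
      moreover have "finite J" using that assms(1) unfolding Y_def by (auto intro: finite_subset)
      ultimately have "card (A - I - J) = n - i - j" using that assms(1) unfolding Y_def
        by (simp add: card_Diff_subset)
      then show ?thesis unfolding Z_def using assms(1) by (simp add: n_subsets)
    qed
    have "card (SIGMA J:Y I. Z I J) = ((n - i) choose j) * ((n - i - j) choose k)" if "I \<in> X" for I
      using that fY fZ cY cZ by (subst card_SigmaI) auto
    then show ?thesis using fX fY fZ cX by (subst card_SigmaI) auto
  qed
  finally have "real (card (pairs_of_type A i j k)) = real (n choose i) * (real ((n - i) choose j) * real ((n - i - j) choose k))"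
    by simp
  also have "\<dots> = fact n / (fact i * fact j * fact k * fact (n - i - j - k))"
    using assms(2) by (simp add: binomial_fact n_def)
  finally show ?thesis by (simp add: n_def)
qed

text \<open>Adding a block V, a transversal either avoids V or contains exactly one of its d points;
  the recursion is Pascal's rule with a factor d.\<close>

lemma card_transversals:
  assumes "finite P" "disjoint P" "\<And>V. V \<in> P \<Longrightarrow> finite V \<and> card V = d"
  shows "card {S. S \<subseteq> \<Union>P \<and> transversal P S \<and> card S = k} = (card P choose k) * d ^ k"
  using assms
proof (induction P arbitrary: k rule: finite_induct)
  case empty
  have "{S. S \<subseteq> \<Union>({} :: 'a set set) \<and> transversal {} S \<and> card S = k} = (if k = 0 then {{}} else {})"
    by (auto simp: transversal_def)
  then show ?case by (simp only:) simp
next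
  case (insert V P)
  let ?T = "\<lambda>k. {S. S \<subseteq> \<Union>P \<and> transversal P S \<and> card S = k}"
  have V: "finite V" "card V = d" using insert.prems by auto
  have disj: "V \<inter> \<Union>P = {}" using insert.hyps(2) insert.prems(1) by (auto simp: disjoint_def)
  have finU: "finite (\<Union>P)" using insert.hyps(1) insert.prems(2) by auto
  have IH: "card (?T k) = (card P choose k) * d ^ k" for k
    using insert.prems by (intro insert.IH) (auto simp: disjoint_def)
  show ?case
  proof (cases k)
    case 0
    have "{S. S \<subseteq> \<Union>(insert V P) \<and> transversal (insert V P) S \<and> card S = 0} = {{}}"
    proof -
      \<comment> \<open>\<open>card S = 0\<close> also holds for infinite S, so finiteness is what
        forces S = {}.\<close>
      have "finite S" if "S \<subseteq> \<Union>(insert V P)" for S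
        using finite_subset[OF that] V finU by simp
      then show ?thesis by (auto simp: transversal_def)
    qed
    then show ?thesis using 0 by simp
  next
    case (Suc k')
    define F where "F = (\<lambda>(x, S). insert x S) ` (V \<times> ?T k')"
    have "{S. S \<subseteq> \<Union>(insert V P) \<and> transversal (insert V P) S \<and> card S = Suc k'} = ?T (Suc k') \<union> F"
    proof (intro equalityI subsetI)
      fix S assume S: "S \<in> {S. S \<subseteq> \<Union>(insert V P) \<and> transversal (insert V P) S \<and> card S = Suc k'}"
      show "S \<in> ?T (Suc k') \<union> F"
      proof (cases "S \<inter> V = {}")
        case True
        then show ?thesis using S by (auto simp: transversal_insert)
      next
        case False
        then obtain x where x: "x \<in> S" "x \<in> V" by blast
        have "S \<inter> V = {x}" using S x by (auto simp: transversal_insert)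
        then have "S - {x} \<subseteq> \<Union>P" using S by auto
        moreover have "transversal P (S - {x})" using S by (auto simp: transversal_insert intro: transversal_mono)
        moreover have "card (S - {x}) = k'" using S x by (simp add: card_Diff_singleton)
        moreover have "S = insert x (S - {x})" using x by auto
        ultimately have "S \<in> F" unfolding F_def using x
          by (intro image_eqI[of _ _ "(x, S - {x})"]) simp_all
        then show ?thesis ..
      qed
    next
      fix S assume "S \<in> ?T (Suc k') \<union> F"
      then show "S \<in> {S. S \<subseteq> \<Union>(insert V P) \<and> transversal (insert V P) S \<and> card S = Suc k'}"
      proof
        assume "S \<in> ?T (Suc k')"
        then show ?thesis using disj by (auto simp: transversal_insert)
      next
        assume "S \<in> F"
        then obtain x S' where x: "x \<in> V" "S = insert x S'" "S' \<in> ?T k'" by (auto simp: F_def)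
        have "x \<notin> S'" "S' \<inter> V = {}" using x disj by auto
        moreover have "transversal P S \<longleftrightarrow> transversal P S'"
          using x disj by (intro transversal_cong_blocks) auto
        moreover have "finite S'" using x finU by (auto intro: finite_subset)
        ultimately show ?thesis using x by (auto simp: transversal_insert)
      qed
    qed
    moreover have "card (?T (Suc k') \<union> F) = card (?T (Suc k')) + card F"
      using finU V disj by (intro card_Un_disjoint) (auto simp: F_def)
    moreover have "card F = d * card (?T k')"
    proof -
      have "inj_on (\<lambda>(x, S). insert x S) (V \<times> ?T k')"
      proof (rule inj_onI, clarsimp)
        fix x S y T assume a: "insert x S = insert y T" "x \<in> V" "y \<in> V" "S \<subseteq> \<Union>P" "T \<subseteq> \<Union>P"
        then have "insert x S \<inter> V = {x}" "insert y T \<inter> V = {y}" using disj by blast+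
        then have xy: "x = y" using a(1) by (metis singleton_inject)
        have "S = insert x S - V" "T = insert y T - V" using a disj by auto
        then show "x = y \<and> S = T" using xy a(1) by simp
      qed
      then show ?thesis unfolding F_def using V by (simp add: card_image card_cartesian_product)
    qed
    ultimately show ?thesis using Suc insert.hyps(1,2) by (simp add: IH algebra_simps)
  qed
qed

text \<open>The weight is multiplicative over blocks. In one block each of S and T is empty or a
  singleton: both empty contribute 1, exactly one nonempty 2 * d * s, two different points d * (d -
  1) * s^2, a common point d * w.\<close>

lemma pair_weight_sum_le:
  fixes s w :: real
  assumes "finite P" "disjoint P" "\<And>V. V \<in> P \<Longrightarrow> finite V \<and> card V = d" and sw: "0 \<le> s" "0 \<le> w"
  shows "(\<Sum>(S, T)\<in>{(S, T). S \<subseteq> \<Union>P \<and> T \<subseteq> \<Union>P \<and> transversal P S \<and> transversal P T}.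
      w ^ card (S \<inter> T) * s ^ (card (S - T) + card (T - S)))
    \<le> (1 + 2 * real d * s + real d * (real d - 1) * s\<^sup>2 + real d * w) ^ card P"
  using assms(1-3)
proof (induction P rule: finite_induct)
  case empty
  have e: "{(S, T). S \<subseteq> \<Union>({} :: 'a set set) \<and> T \<subseteq> \<Union>({} :: 'a set set) \<and> transversal {} S \<and> transversal {} T} = {({}, {})}"
    (is "?X = _")
  proof (rule set_eqI)
    fix x show "x \<in> ?X \<longleftrightarrow> x \<in> {({}, {})}" by (cases x) (simp add: transversal_def)
  qed
  show ?case unfolding e by simp
next
  case (insert V P)
  define TP where "TP = {(S, T). S \<subseteq> \<Union>P \<and> T \<subseteq> \<Union>P \<and> transversal P S \<and> transversal P T}"
  define TI where "TI = {(S, T). S \<subseteq> \<Union>(insert V P) \<and> T \<subseteq> \<Union>(insert V P) \<and> transversal (insert V P) S \<and> transversal (insert V P) T}"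
  define wt where "wt = (\<lambda>S T :: 'a set. w ^ card (S \<inter> T) * s ^ (card (S - T) + card (T - S)))"
  define Opt where "Opt = insert {} ((\<lambda>x. {x}) ` V)"
  have V: "finite V" "card V = d" using insert.prems by auto
  have disj: "V \<inter> \<Union>P = {}" using insert.hyps(2) insert.prems(1) by (auto simp: disjoint_def)
  have finU: "finite (\<Union>P)" using insert.hyps(1) insert.prems(2) by auto
  have dP: "disjoint P" using insert.prems(1) by (auto simp: disjoint_def)
  have finTP: "finite TP" 
  proof (rule finite_subset)
    show "TP \<subseteq> Pow (\<Union>P) \<times> Pow (\<Union>P)" by (auto simp: TP_def)
  qed (use finU in simp)
  have finO: "finite Opt" using V by (simp add: Opt_def)
  have IH: "(\<Sum>(S, T)\<in>TP. wt S T) \<le> (1 + 2 * real d * s + real d * (real d - 1) * s\<^sup>2 + real d * w) ^ card P"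
    unfolding TP_def wt_def by (rule insert.IH[OF dP]) (use insert.prems(2) in simp)
  \<comment> \<open>A pair is split into its trace on V and its part outside; for an upper bound it
    is enough that this map is injective into the product set.\<close>
  define \<phi> where "\<phi> = (\<lambda>(S, T). ((S \<inter> V, T \<inter> V), (S - V, T - V)))"
  have wt_split: "wt S T = wt (S \<inter> V) (T \<inter> V) * wt (S - V) (T - V)" if "finite S" "finite T" for S T
  proof -
    have 1: "card X = card (X \<inter> V) + card (X - V)" if "finite X" for X
      using that by (metis card_Diff_subset_Int card_mono finite_Int inf_le1 le_add_diff_inverse)
    have e: "(S \<inter> T) \<inter> V = (S \<inter> V) \<inter> (T \<inter> V)" "(S \<inter> T) - V = (S - V) \<inter> (T - V)"
      "(S - T) \<inter> V = (S \<inter> V) - (T \<inter> V)" "(S - T) - V = (S - V) - (T - V)"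
      "(T - S) \<inter> V = (T \<inter> V) - (S \<inter> V)" "(T - S) - V = (T - V) - (S - V)" by auto
    show ?thesis unfolding wt_def
      using 1[of "S \<inter> T"] 1[of "S - T"] 1[of "T - S"] that unfolding e by (simp add: power_add)
  qed
  have fin_sub: "finite S" if "S \<subseteq> \<Union>(insert V P)" for S
    using finite_subset[OF that] V finU by simp
  have inj: "inj_on \<phi> TI"
  proof (rule inj_onI)
    fix x y assume eq: "\<phi> x = \<phi> y"
    obtain S T S' T' where xy: "x = (S, T)" "y = (S', T')" by (cases x; cases y)
    have "S \<inter> V = S' \<inter> V" "S - V = S' - V" "T \<inter> V = T' \<inter> V" "T - V = T' - V"
      using eq by (auto simp only: \<phi>_def xy prod.case prod.inject)
    then have "S = S'" "T = T'" by blast+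
    then show "x = y" by (simp add: xy)
  qed
  have sub: "\<phi> ` TI \<subseteq> (Opt \<times> Opt) \<times> TP"
  proof -
    have "S \<inter> V \<in> Opt" "S - V \<subseteq> \<Union>P" "transversal P (S - V)"
      if "S \<subseteq> \<Union>(insert V P)" "transversal (insert V P) S" for S
    proof -
      show "S \<inter> V \<in> Opt"
      proof (cases "S \<inter> V = {}")
        case False
        then obtain x where "x \<in> S \<inter> V" by blast
        then have "S \<inter> V = {x}" using that by (auto simp: transversal_insert)
        then show ?thesis by (auto simp: Opt_def)
      qed (simp add: Opt_def)
    qed (use that in \<open>auto simp: transversal_insert intro: transversal_mono\<close>)
    then show ?thesis by (auto simp: TI_def TP_def \<phi>_def)
  qed
  have optsum: "(\<Sum>(A, B)\<in>Opt \<times> Opt. wt A B) = 1 + 2 * real d * s + real d * (real d - 1) * s\<^sup>2 + real d * w"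
  proof -
    have O: "(\<Sum>A\<in>Opt. g A) = g {} + (\<Sum>x\<in>V. g {x})" for g :: "'a set \<Rightarrow> real"
      unfolding Opt_def using V by (subst sum.insert) (auto simp: sum.reindex inj_on_def)
    have vv: "(\<Sum>y\<in>V. wt {x} {y}) = w + (real d - 1) * s\<^sup>2" if "x \<in> V" for x
    proof -
      have "(\<Sum>y\<in>V. wt {x} {y}) = wt {x} {x} + (\<Sum>y\<in>V - {x}. wt {x} {y})"
        using that V by (simp add: sum.remove)
      also have "(\<Sum>y\<in>V - {x}. wt {x} {y}) = (\<Sum>y\<in>V - {x}. s\<^sup>2)"
        by (intro sum.cong) (auto simp: wt_def power2_eq_square insert_Diff_if)
      also have "\<dots> = (real d - 1) * s\<^sup>2"
      proof -
        have "d \<ge> 1" using that V by (metis One_nat_def Suc_leI card_gt_0_iff empty_iff)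
        then show ?thesis using that V by (simp add: card_Diff_singleton of_nat_diff)
      qed
      finally show ?thesis by (simp add: wt_def)
    qed
    have "(\<Sum>(A, B)\<in>Opt \<times> Opt. wt A B) = (\<Sum>A\<in>Opt. \<Sum>B\<in>Opt. wt A B)"
      by (simp add: sum.cartesian_product)
    also have "\<dots> = (wt {} {} + (\<Sum>y\<in>V. wt {} {y})) + (\<Sum>x\<in>V. wt {x} {} + (\<Sum>y\<in>V. wt {x} {y}))"
      by (simp add: O)
    also have "\<dots> = (1 + real d * s) + (\<Sum>x\<in>V. s + (w + (real d - 1) * s\<^sup>2))"
      using V by (simp add: vv) (simp add: wt_def)
    finally show ?thesis using V by (simp add: algebra_simps)
  qed
  define wp where "wp = (\<lambda>(S, T). wt S T)"
  have wp0: "0 \<le> wp x" for x using sw by (cases x) (simp add: wp_def wt_def)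
  have "(\<Sum>(S, T)\<in>TI. wt S T) = (\<Sum>x\<in>TI. wp (fst (\<phi> x)) * wp (snd (\<phi> x)))"
  proof (rule sum.cong[OF refl])
    fix x assume "x \<in> TI"
    then obtain S T where "x = (S, T)" "finite S" "finite T" using fin_sub by (auto simp: TI_def)
    then show "(case x of (S, T) \<Rightarrow> wt S T) = wp (fst (\<phi> x)) * wp (snd (\<phi> x))"
      using wt_split[of S T] by (simp add: \<phi>_def wp_def)
  qed
  also have "\<dots> = (\<Sum>y\<in>\<phi> ` TI. wp (fst y) * wp (snd y))"
    using sum.reindex[OF inj, of "\<lambda>y. wp (fst y) * wp (snd y)"] by (simp add: comp_def)
  also have "\<dots> \<le> (\<Sum>y\<in>(Opt \<times> Opt) \<times> TP. wp (fst y) * wp (snd y))"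
    using sub finO finTP wp0 by (intro sum_mono2) auto
  also have "\<dots> = (\<Sum>p\<in>Opt \<times> Opt. \<Sum>q\<in>TP. wp p * wp q)"
    by (subst sum.cartesian_product) (simp add: split_def)
  also have "\<dots> = (\<Sum>(A, B)\<in>Opt \<times> Opt. wt A B) * (\<Sum>(C, D)\<in>TP. wt C D)"
    unfolding wp_def by (rule sum_product[symmetric])
  also have "\<dots> \<le> (1 + 2 * real d * s + real d * (real d - 1) * s\<^sup>2 + real d * w) * (1 + 2 * real d * s + real d * (real d - 1) * s\<^sup>2 + real d * w) ^ card P"
    unfolding optsum
  proof (rule mult_left_mono[OF IH])
    have "0 \<le> real d * (real d - 1)" by (cases d) auto
    then show "0 \<le> 1 + 2 * real d * s + real d * (real d - 1) * s\<^sup>2 + real d * w" using sw by simp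
  qed
  finally have "(\<Sum>(S, T)\<in>TI. wt S T) \<le> (1 + 2 * real d * s + real d * (real d - 1) * s\<^sup>2 + real d * w) ^ card (insert V P)"
    unfolding card_insert_disjoint[OF insert(1,2)] power_Suc .
  then show ?case by (simp only: TI_def wt_def)
qed

section \<open>The symmetric group acting on configurations\<close>

lemma configurationsD:
  assumes "P \<in> configurations m d l"
  shows "\<Union>P = {1..l * m}" "disjoint P" "finite P" "card P = l * m div d" "\<And>V. V \<in> P \<Longrightarrow> finite V \<and> card V = d"
proof -
  have p: "partition_on {1..l * m} P" using assms by (simp add: configurations_def)
  show "\<Union>P = {1..l * m}" "disjoint P" using p by (auto simp: partition_on_def)
  then have "finite (\<Union>P)" by simp
  then show "finite P" by (rule finite_UnionD)
  show "card P = l * m div d" using assms by (simp add: configurations_def)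
  show "finite V \<and> card V = d" if "V \<in> P" for V
    using that assms \<open>\<Union>P = {1..l * m}\<close> finite_subset[of V "{1..l * m}"] by (auto simp: configurations_def)
qed

lemma finite_configurations: "finite (configurations m d l)"
proof (rule finite_subset)
  show "configurations m d l \<subseteq> {P. partition_on {1..l * m} P}" by (auto simp: configurations_def)
  show "finite {P. partition_on {1..l * m} P}" by (rule finitely_many_partition_on) simp
qed

lemma ex_equipartition:
  assumes "finite A" "card A = n * d" "d > 0"
  shows "\<exists>P. partition_on A P \<and> card P = n \<and> (\<forall>V\<in>P. card V = d)"
  using assms(1,2)
proof (induction n arbitrary: A)
  case 0
  then have "A = {}" by simp
  then show ?case by (intro exI[of _ "{}"]) (simp add: partition_on_empty)
next
  case (Suc n)
  have "d \<le> card A" using Suc.prems by simp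
  then obtain V where V: "V \<subseteq> A" "card V = d" by (rule obtain_subset_with_card_n)
  have finV: "finite V" using V Suc.prems finite_subset by blast
  have "card (A - V) = n * d" using V finV Suc.prems by (simp add: card_Diff_subset)
  then obtain P where P: "partition_on (A - V) P" "card P = n" "\<forall>V\<in>P. card V = d"
    using Suc.IH[of "A - V"] Suc.prems by auto
  have "V \<noteq> {}" using V assms(3) by auto
  moreover have "V \<notin> P" using P(1) \<open>V \<noteq> {}\<close> by (auto simp: partition_on_def)
  moreover have "finite P" using P(1) Suc.prems finite_elements by blast
  ultimately have "card (insert V P) = Suc n" using P by simp
  moreover have "partition_on A (insert V P)"
  proof (rule partition_onI)
    have U: "\<Union>P = A - V" using P(1) by (simp add: partition_on_def)
    then show "\<Union>(insert V P) = A" using V(1) by auto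
    show "{} \<notin> insert V P" using P(1) \<open>V \<noteq> {}\<close> by (simp add: partition_on_def)
    fix p q assume pq: "p \<in> insert V P" "q \<in> insert V P" "p \<noteq> q"
    have "disjnt V W" "disjnt W V" if "W \<in> P" for W
      using U that unfolding disjnt_def by blast+
    moreover have "disjnt p q" if "p \<in> P" "q \<in> P"
      using disjointD[OF partition_onD2[OF P(1)] that pq(3)] by (simp add: disjnt_def)
    ultimately show "disjnt p q" using pq by blast
  qed
  ultimately show ?case using P(3) V(2) by blast
qed

lemma configurations_nonempty:
  assumes "d > 0" "d dvd l * m"
  shows "configurations m d l \<noteq> {}"
  using ex_equipartition[of "{1..l * m}" "l * m div d" d] assms by (auto simp: configurations_def)

lemma configurations_act:
  assumes "\<sigma> permutes {1..l * m}" "P \<in> configurations m d l"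
  shows "(`) \<sigma> ` P \<in> configurations m d l"
proof -
  have inj: "inj \<sigma>" using assms(1) by (rule permutes_inj)
  have P: "\<Union>P = {1..l * m}" "disjoint P" "{} \<notin> P" "card P = l * m div d" "\<forall>V\<in>P. card V = d"
    using assms(2) by (simp_all add: configurations_def partition_on_def)
  have "\<Union>((`) \<sigma> ` P) = \<sigma> ` \<Union>P" by (simp add: image_Union)
  also have "\<dots> = {1..l * m}" unfolding P(1) using assms(1) by (rule permutes_image)
  finally have 1: "\<Union>((`) \<sigma> ` P) = {1..l * m}" .
  have 2: "disjoint ((`) \<sigma> ` P)"
    using inj_on_subset[OF inj] P(2) by (intro disjoint_image) simp_all
  have 3: "{} \<notin> (`) \<sigma> ` P" using P(3) by auto
  have "inj_on ((`) \<sigma>) P" using inj by (simp add: inj_on_def inj_image_eq_iff)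
  then have 4: "card ((`) \<sigma> ` P) = l * m div d" using P(4) by (simp add: card_image)
  have 5: "\<forall>V\<in>(`) \<sigma> ` P. card V = d"
    using P(5) inj_on_subset[OF inj] by (simp add: card_image)
  show ?thesis using 1 2 3 4 5 by (simp add: configurations_def partition_on_def)
qed

lemma sum_configurations_act:
  assumes "\<sigma> permutes {1..l * m}"
  shows "(\<Sum>P\<in>configurations m d l. F ((`) \<sigma> ` P)) = (\<Sum>P\<in>configurations m d l. F P)"
proof (rule sum.reindex_bij_betw)
  have inv: "inv \<sigma> permutes {1..l * m}" using assms by (rule permutes_inv)
  have 1: "(`) \<sigma> ` (`) (inv \<sigma>) ` P = P" "(`) (inv \<sigma>) ` (`) \<sigma> ` P = P" for P
    using permutes_inverses[OF assms] by (simp_all add: image_image)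
  show "bij_betw ((`) ((`) \<sigma>)) (configurations m d l) (configurations m d l)"
    by (rule bij_betwI[where g = "(`) ((`) (inv \<sigma>))"])
       (simp_all add: Pi_iff 1 configurations_act[OF assms] configurations_act[OF inv])
qed

text \<open>Label each point with its block, transporting the blocks of P to those of Q by a
  bijection \<open>g\<close>. All blocks have size d, so both labellings take each value equally
  often; a permutation matching the labels maps every V into, hence onto, g V.\<close>

lemma configurations_transitive:
  assumes P: "P \<in> configurations m d l" and Q: "Q \<in> configurations m d l"
  obtains \<sigma> where "\<sigma> permutes {1..l * m}" "(`) \<sigma> ` P = Q"
proof -
  note p = configurationsD[OF P] and q = configurationsD[OF Q]
  define A where "A = {1..l * m}"
  obtain g where g: "bij_betw g P Q"
    using finite_same_card_bij[OF p(3) q(3)] p(4) q(4) by auto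
  define b where "b R x = (THE V. V \<in> R \<and> x \<in> V)" for R :: "nat set set" and x
  have b: "b R x = V" if "disjoint R" "V \<in> R" "x \<in> V" for R x V
    unfolding b_def
  proof (rule the_equality)
    show "V \<in> R \<and> x \<in> V" using that by simp
    show "W = V" if W: "W \<in> R \<and> x \<in> W" for W
      using disjointD[OF \<open>disjoint R\<close>, of W V] W \<open>V \<in> R\<close> \<open>x \<in> V\<close> by blast
  qed
  have cnt: "count (image_mset f (mset_set A)) c = card {x\<in>A. f x = c}" for f :: "nat \<Rightarrow> nat set" and c
  proof -
    have "finite A" by (simp add: A_def)
    then show ?thesis by (auto simp: count_image_mset' intro!: arg_cong[where f = card])
  qed
  have "card {x\<in>A. g (b P x) = c} = card {x\<in>A. b Q x = c}" for c
  proof (cases "c \<in> Q")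
    case True
    then have "c \<in> g ` P" using bij_betw_imp_surj_on[OF g] by simp
    then obtain V where V: "V \<in> P" "g V = c" by blast
    have "g W = c \<longleftrightarrow> W = V" if "W \<in> P" for W
      using inj_on_eq_iff[OF bij_betw_imp_inj_on[OF g] that V(1)] V(2) by simp
    then have "{x\<in>A. g (b P x) = c} = V"
    proof (intro equalityI subsetI)
      fix x assume "x \<in> {x\<in>A. g (b P x) = c}"
      then have x: "x \<in> A" "g (b P x) = c" by auto
      then obtain W where W: "W \<in> P" "x \<in> W" using p(1) unfolding A_def by blast
      then show "x \<in> V" using x b[OF p(2) W] \<open>\<And>W. W \<in> P \<Longrightarrow> (g W = c) = (W = V)\<close>[OF W(1)] by simp
    next
      fix x assume "x \<in> V"
      moreover from this have "x \<in> A" using p(1) V(1) unfolding A_def by blast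
      ultimately show "x \<in> {x\<in>A. g (b P x) = c}" using V(2) b[OF p(2) V(1)] by simp
    qed
    moreover have "{x\<in>A. b Q x = c} = c"
    proof (intro equalityI subsetI)
      fix x assume "x \<in> {x\<in>A. b Q x = c}"
      then have x: "x \<in> A" "b Q x = c" by auto
      then obtain W where W: "W \<in> Q" "x \<in> W" using q(1) unfolding A_def by blast
      then show "x \<in> c" using x b[OF q(2) W] by simp
    next
      fix x assume "x \<in> c"
      moreover from this have "x \<in> A" using q(1) True unfolding A_def by blast
      ultimately show "x \<in> {x\<in>A. b Q x = c}" using b[OF q(2) True] by simp
    qed
    ultimately show ?thesis using p(5)[OF V(1)] q(5)[OF True] by metis
  next
    case False
    have "{x\<in>A. g (b P x) = c} = {}"
    proof -
      have "g (b P x) \<noteq> c" if "x \<in> A" for x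
      proof -
        have "x \<in> \<Union>P" using that p(1) by (simp add: A_def)
        then obtain W where W: "W \<in> P" "x \<in> W" by blast
        then have "g (b P x) \<in> Q" using b[OF p(2) W] bij_betw_apply[OF g W(1)] by simp
        then show ?thesis using False by metis
      qed
      then show ?thesis by blast
    qed
    moreover have "{x\<in>A. b Q x = c} = {}"
    proof -
      have "b Q x \<noteq> c" if "x \<in> A" for x
      proof -
        have "x \<in> \<Union>Q" using that q(1) by (simp add: A_def)
        then obtain W where W: "W \<in> Q" "x \<in> W" by blast
        then have "b Q x \<in> Q" using b[OF q(2) W] by simp
        then show ?thesis using False by metis
      qed
      then show ?thesis by blast
    qed
    ultimately show ?thesis by (simp only:)
  qed
  then have eq: "image_mset (\<lambda>x. g (b P x)) (mset_set A) = image_mset (b Q) (mset_set A)"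
    by (intro multiset_eqI) (simp add: cnt)
  have "finite A" by (simp add: A_def)
  from image_mset_eq_implies_permutes[OF this eq]
  obtain \<sigma> where \<sigma>: "\<sigma> permutes A" "\<forall>x\<in>A. g (b P x) = b Q (\<sigma> x)" by blast
  have im: "\<sigma> ` V = g V" if V: "V \<in> P" for V
  proof (rule card_subset_eq)
    have gV: "g V \<in> Q" using V g by (auto simp: bij_betw_def)
    show "finite (g V)" using q(5)[OF gV] by simp
    show "\<sigma> ` V \<subseteq> g V"
    proof
      fix y assume "y \<in> \<sigma> ` V"
      then obtain x where x: "x \<in> V" "y = \<sigma> x" by blast
      have xA: "x \<in> A" using x V p(1) unfolding A_def by blast
      then have "y \<in> A" using x \<sigma>(1) by (simp add: permutes_in_image)
      then obtain W where W: "W \<in> Q" "y \<in> W" using q(1) unfolding A_def by blast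
      have "g (b P x) = b Q y" using \<sigma>(2) xA x(2) by simp
      then have "g V = W" by (simp add: b[OF p(2) V x(1)] b[OF q(2) W])
      then show "y \<in> g V" using W by simp
    qed
    show "card (\<sigma> ` V) = card (g V)"
      using p(5)[OF V] q(5)[OF gV] permutes_inj[OF \<sigma>(1)] by (simp add: card_image inj_on_subset)
  qed
  have "(`) \<sigma> ` P = g ` P" using im by (intro image_cong) auto
  then show ?thesis using that \<sigma>(1) g by (auto simp: A_def bij_betw_def)
qed

text \<open>A uniform configuration is a fixed one relabelled by a uniform permutation: by
  transitivity the sum over the orbit is the same for every base point. This opens the way to
  concentration results for permutations.\<close>

lemma average_configurations:
  fixes F :: "nat set set \<Rightarrow> real"
  assumes P0: "P0 \<in> configurations m d l"
  shows "(\<Sum>P\<in>configurations m d l. F P) / real (card (configurations m d l)) =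
    (\<Sum>\<sigma> | \<sigma> permutes {1..l * m}. F ((`) \<sigma> ` P0)) / fact (l * m)"
proof -
  let ?C = "configurations m d l" and ?S = "{\<sigma>. \<sigma> permutes {1..l * m}}"
  have orb: "(\<Sum>\<sigma>\<in>?S. F ((`) \<sigma> ` P)) = (\<Sum>\<sigma>\<in>?S. F ((`) \<sigma> ` P0))" if P: "P \<in> ?C" for P
  proof -
    obtain \<tau> where \<tau>: "\<tau> permutes {1..l * m}" "(`) \<tau> ` P0 = P"
      using configurations_transitive[OF P0 P] by blast
    have "(\<Sum>\<sigma>\<in>?S. F ((`) \<sigma> ` P)) = (\<Sum>\<sigma>\<in>?S. F ((`) (\<sigma> \<circ> \<tau>) ` P0))"
      unfolding \<tau>(2)[symmetric] by (simp add: image_comp image_image)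
    also have "\<dots> = (\<Sum>\<sigma>\<in>?S. F ((`) \<sigma> ` P0))"
      using sum_permutations_compose_right[OF \<tau>(1), of "\<lambda>\<sigma>. F ((`) \<sigma> ` P0)"] by simp
    finally show ?thesis .
  qed
  have "fact (l * m) * (\<Sum>P\<in>?C. F P) = (\<Sum>\<sigma>\<in>?S. \<Sum>P\<in>?C. F ((`) \<sigma> ` P))"
    by (simp add: sum_configurations_act card_permutations)
  also have "\<dots> = (\<Sum>P\<in>?C. \<Sum>\<sigma>\<in>?S. F ((`) \<sigma> ` P))" by (rule sum.swap)
  also have "\<dots> = real (card ?C) * (\<Sum>\<sigma>\<in>?S. F ((`) \<sigma> ` P0))" using orb by simp
  finally show ?thesis using P0 finite_configurations[of m d l]
    by (subst frac_eq_eq) (auto simp: mult_ac card_gt_0_iff)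
qed

lemma transversal_count_invariant:
  assumes \<sigma>: "\<sigma> permutes {1..l * m}"
  shows "card {P\<in>configurations m d l. transversal P (\<sigma> ` S) \<and> transversal P (\<sigma> ` T)}
    = card {P\<in>configurations m d l. transversal P S \<and> transversal P T}"
proof -
  have inj: "inj \<sigma>" using \<sigma> by (rule permutes_inj)
  have c: "card {P\<in>C. Q P} = (\<Sum>P\<in>C. if Q P then 1 else 0)" if "finite C" for C :: "nat set set set" and Q
    using that by (simp add: sum.If_cases Int_def)
  show ?thesis
    unfolding c[OF finite_configurations]
    by (subst sum_configurations_act[OF \<sigma>, symmetric]) (simp add: transversal_image[OF inj])
qed

text \<open>Double counting of configurations together with a transversal of the given size. By
  symmetry all sets of that size are transversal to equally many configurations, while each
  configuration has the same number of transversals.\<close>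

lemma card_configurations_transversal:
  assumes S: "S \<subseteq> {1..l * m}"
  shows "real (card {P\<in>configurations m d l. transversal P S}) * real ((l * m) choose card S)
    = real (card (configurations m d l)) * (real ((l * m div d) choose card S) * real d ^ card S)"
proof -
  let ?C = "configurations m d l"
  define k where "k = card S"
  define O' where "O' = {T. T \<subseteq> {1..l * m} \<and> card T = k}"
  have finO: "finite O'" unfolding O'_def by simp
  have cO: "card O' = (l * m) choose k" unfolding O'_def by (simp add: n_subsets)
  have inv: "card {P\<in>?C. transversal P T} = card {P\<in>?C. transversal P S}" if "T \<in> O'" for T
  proof -
    have "(S, S) \<in> pairs_of_type {1..l * m} k 0 0" "(T, T) \<in> pairs_of_type {1..l * m} k 0 0"
      using S that by (auto simp: pairs_of_type_def k_def O'_def)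
    then obtain \<sigma> where "\<sigma> permutes {1..l * m}" "\<sigma> ` S = T"
      using pairs_of_type_orbit[of "{1..l * m}" S S k 0 0 T T] by auto
    then show ?thesis using transversal_count_invariant[of \<sigma> l m d S S] by simp
  qed
  have "card O' * card {P\<in>?C. transversal P S} = (\<Sum>T\<in>O'. card {P\<in>?C. transversal P T})"
    using inv by simp
  also have "\<dots> = (\<Sum>P\<in>?C. card {T\<in>O'. transversal P T})"
    using sum.swap_restrict[OF finO finite_configurations, where g = "\<lambda>_ _. 1 :: nat" and R = "\<lambda>T P. transversal P T"] by simp
  also have "\<dots> = (\<Sum>P\<in>?C. ((l * m div d) choose k) * d ^ k)"
  proof (intro sum.cong refl)
    fix P assume "P \<in> ?C"
    note p = configurationsD[OF this]
    have "{T\<in>O'. transversal P T} = {S. S \<subseteq> \<Union>P \<and> transversal P S \<and> card S = k}"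
      using p(1) by (auto simp: O'_def)
    then show "card {T\<in>O'. transversal P T} = ((l * m div d) choose k) * d ^ k"
      using card_transversals[OF p(3,2,5)] p(4) by simp
  qed
  finally show ?thesis unfolding cO k_def
    by (simp flip: of_nat_mult of_nat_power add: mult.commute)
qed

text \<open>The same double counting for pairs. Within one configuration the pairs of the given type
  contribute one monomial to a generating function with nonnegative terms, so their weighted number
  is at most its value. The product form leaves s = 0 and w = 0 admissible.\<close>

lemma card_configurations_transversal_pair:
  fixes s w :: real
  assumes ST: "(S, T) \<in> pairs_of_type {1..l * m} i j k" and sw: "0 \<le> s" "0 \<le> w"
  shows "real (card {P\<in>configurations m d l. transversal P S \<and> transversal P T}) * real (card (pairs_of_type {1..l * m} i j k))
      * (w ^ i * s ^ (j + k))
    \<le> real (card (configurations m d l)) * (1 + 2 * real d * s + real d * (real d - 1) * s\<^sup>2 + real d * w) ^ (l * m div d)"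
proof -
  let ?C = "configurations m d l"
  define O' where "O' = pairs_of_type {1..l * m} i j k"
  define R where "R = (\<lambda>(S, T) P. transversal P S \<and> transversal P (T :: nat set))"
  define W where "W = w ^ i * s ^ (j + k)"
  have finO: "finite O'" unfolding O'_def by (simp add: finite_pairs_of_type)
  have inv: "card {P\<in>?C. R x P} = card {P\<in>?C. R (S, T) P}" if x: "x \<in> O'" for x
  proof -
    obtain S' T' where x': "x = (S', T')" by (cases x)
    obtain \<sigma> where "\<sigma> permutes {1..l * m}" "\<sigma> ` S = S'" "\<sigma> ` T = T'"
      using pairs_of_type_orbit[of "{1..l * m}" S T i j k S' T'] ST x x' by (auto simp: O'_def)
    then show ?thesis using transversal_count_invariant[of \<sigma> l m d S T] by (simp add: R_def x')
  qed
  have "card {P\<in>?C. R (S, T) P} * card O' = (\<Sum>x\<in>O'. card {P\<in>?C. R x P})"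
    using inv by simp
  also have "\<dots> = (\<Sum>P\<in>?C. card {x\<in>O'. R x P})"
    using sum.swap_restrict[OF finO finite_configurations, where g = "\<lambda>_ _. 1 :: nat" and R = R] by simp
  finally have "real (card {P\<in>?C. R (S, T) P}) * real (card O') * W = (\<Sum>P\<in>?C. real (card {x\<in>O'. R x P}) * W)"
    by (simp flip: of_nat_mult add: sum_distrib_right)
  also have "\<dots> \<le> (\<Sum>P\<in>?C. (1 + 2 * real d * s + real d * (real d - 1) * s\<^sup>2 + real d * w) ^ (l * m div d))"
  proof (intro sum_mono)
    fix P assume "P \<in> ?C"
    note p = configurationsD[OF this]
    let ?D = "{(S, T). S \<subseteq> \<Union>P \<and> T \<subseteq> \<Union>P \<and> transversal P S \<and> transversal P T}"
    have finD: "finite ?D"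
      by (rule finite_subset[of _ "Pow {1..l * m} \<times> Pow {1..l * m}"]) (use p(1) in auto)
    have "real (card {x\<in>O'. R x P}) * W
        = (\<Sum>(S, T)\<in>{x\<in>O'. R x P}. w ^ card (S \<inter> T) * s ^ (card (S - T) + card (T - S)))"
      unfolding W_def by (subst sum.cong[OF refl, of _ _ "\<lambda>_. w ^ i * s ^ (j + k)"]) (auto simp: O'_def pairs_of_type_def)
    also have "\<dots> \<le> (\<Sum>(S, T)\<in>?D. w ^ card (S \<inter> T) * s ^ (card (S - T) + card (T - S)))"
      using finD sw p(1) by (intro sum_mono2) (auto simp: O'_def pairs_of_type_def R_def)
    also have "\<dots> \<le> (1 + 2 * real d * s + real d * (real d - 1) * s\<^sup>2 + real d * w) ^ card P"
      using pair_weight_sum_le[OF p(3,2,5) sw] .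
    finally show "real (card {x\<in>O'. R x P}) * W \<le> (1 + 2 * real d * s + real d * (real d - 1) * s\<^sup>2 + real d * w) ^ (l * m div d)"
      using p(4) by simp
  qed
  finally show ?thesis by (simp add: R_def O'_def W_def)
qed

section \<open>Matchings\<close>

text \<open>Half-edges and hyperedges are numbered from 1; shifting both by one turns the ceiling
  into integer division.\<close>

lemma hyperedge_of_eq:
  assumes "l > 0" "i > 0"
  shows "hyperedge_of l i = Suc ((i - 1) div l)"
proof -
  define q where "q = (i - 1) div l"
  define r where "r = (i - 1) mod l"
  have "i = l * q + r + 1" using assms by (simp add: q_def r_def)
  then have i: "real i = real l * real q + real r + 1" by simp
  have "r < l" using assms by (simp add: r_def)
  then have r: "real r + 1 \<le> real l" by linarith
  have "\<lceil>real i / real l\<rceil> = int q + 1"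
    using assms r by (intro ceiling_unique) (simp_all add: i field_simps)
  then show ?thesis unfolding hyperedge_of_def q_def by simp
qed

lemma card_hyperedge:
  assumes l: "l > 0" and e: "e \<in> {1..m}"
  shows "card {i \<in> {1..l * m}. hyperedge_of l i = e} = l"
proof -
  have "{i \<in> {1..l * m}. hyperedge_of l i = e} = {l * (e - 1) + 1..l * e}"
  proof (intro equalityI subsetI)
    fix i assume "i \<in> {i \<in> {1..l * m}. hyperedge_of l i = e}"
    then have i: "1 \<le> i" "(i - 1) div l = e - 1" using l by (auto simp: hyperedge_of_eq)
    have "i - 1 = l * (e - 1) + (i - 1) mod l" using i(2) by (metis mult_div_mod_eq)
    moreover have "(i - 1) mod l < l" using l by simp
    moreover have "l * e = l * (e - 1) + l" using e by (cases e) auto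
    ultimately show "i \<in> {l * (e - 1) + 1..l * e}" using i(1) by auto
  next
    fix i assume i: "i \<in> {l * (e - 1) + 1..l * e}"
    have le: "l * e = l * (e - 1) + l" using e by (cases e) auto
    have "(i - 1) div l = e - 1"
      by (rule div_nat_eqI) (use i le in \<open>auto simp: mult.commute\<close>)
    moreover have "i \<le> l * m" using i e by (meson atLeastAtMost_iff mult_le_mono2 order_trans)
    ultimately show "i \<in> {i \<in> {1..l * m}. hyperedge_of l i = e}" using i e l by (auto simp: hyperedge_of_eq)
  qed
  moreover have "l * e = l * (e - 1) + l" using e by (cases e) auto
  ultimately show ?thesis by simp
qed

lemma half_edges_subset: "half_edges m l M \<subseteq> {1..l * m}"
  by (auto simp: half_edges_def)

lemma half_edges_Int: "half_edges m l M \<inter> half_edges m l N = half_edges m l (M \<inter> N)"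
  and half_edges_Diff: "half_edges m l M - half_edges m l N = half_edges m l (M - N)"
  by (auto simp: half_edges_def)

lemma card_half_edges:
  assumes "l > 0" "M \<subseteq> {1..m}"
  shows "card (half_edges m l M) = l * card M"
proof -
  have "half_edges m l M = (\<Union>e\<in>M. {i \<in> {1..l * m}. hyperedge_of l i = e})"
    by (auto simp: half_edges_def)
  also have "card \<dots> = (\<Sum>e\<in>M. card {i \<in> {1..l * m}. hyperedge_of l i = e})"
    by (rule card_UN_disjoint) (use assms in \<open>auto intro: finite_subset\<close>)
  also have "\<dots> = (\<Sum>e\<in>M. l)" using assms by (intro sum.cong refl card_hyperedge) auto
  finally show ?thesis by simp
qed

lemma half_edges_pairs_of_type:
  assumes "l > 0" "(M, N) \<in> pairs_of_type {1..m} i j k"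
  shows "(half_edges m l M, half_edges m l N) \<in> pairs_of_type {1..l * m} (l * i) (l * j) (l * k)"
proof -
  have "M \<subseteq> {1..m}" "N \<subseteq> {1..m}" "card (M \<inter> N) = i" "card (M - N) = j" "card (N - M) = k"
    using assms(2) by (auto simp: pairs_of_type_def)
  moreover from this have "M \<inter> N \<subseteq> {1..m}" "M - N \<subseteq> {1..m}" "N - M \<subseteq> {1..m}" by auto
  ultimately show ?thesis
    using assms(1) half_edges_subset[of m l M] half_edges_subset[of m l N]
    by (simp add: pairs_of_type_def half_edges_Int half_edges_Diff card_half_edges)
qed

lemma is_matching_iff:
  assumes P: "P \<in> configurations m d l"
  shows "is_matching m l P M \<longleftrightarrow> M \<subseteq> {1..m} \<and> transversal P (half_edges m l M)"
proof -
  note p = configurationsD[OF P]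
  have v: "vertex_of P x = V" if "V \<in> P" "x \<in> V" for V x
    unfolding vertex_of_def
  proof (rule the_equality)
    show "V \<in> P \<and> x \<in> V" using that by simp
    show "W = V" if W: "W \<in> P \<and> x \<in> W" for W
      using disjointD[OF p(2), of W V] W \<open>V \<in> P\<close> \<open>x \<in> V\<close> by blast
  qed
  have "inj_on (vertex_of P) S \<longleftrightarrow> transversal P S" if S: "S \<subseteq> {1..l * m}" for S
  proof
    assume inj: "inj_on (vertex_of P) S"
    show "transversal P S" unfolding transversal_def
    proof (intro ballI)
      fix V x y assume V: "V \<in> P" and x: "x \<in> S \<inter> V" and y: "y \<in> S \<inter> V"
      have "vertex_of P x = vertex_of P y" using v[OF V] x y by simp
      then show "x = y" using inj_onD[OF inj] x y by simp
    qed
  next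
    assume tr: "transversal P S"
    show "inj_on (vertex_of P) S"
    proof (rule inj_onI)
      fix x y assume xy: "x \<in> S" "y \<in> S" "vertex_of P x = vertex_of P y"
      have "x \<in> \<Union>P" "y \<in> \<Union>P" using xy S p(1) by blast+
      then obtain V W where V: "V \<in> P" "x \<in> V" and W: "W \<in> P" "y \<in> W" by blast
      have "V = W" using v[OF V] v[OF W] xy by simp
      then show "x = y" using tr V W xy unfolding transversal_def by blast
    qed
  qed
  then show ?thesis unfolding is_matching_def using half_edges_subset by blast
qed

definition matchings :: "nat \<Rightarrow> nat \<Rightarrow> nat set set \<Rightarrow> nat set set" where
  "matchings m l P = {M. M \<subseteq> {1..m} \<and> transversal P (half_edges m l M)}"

lemma finite_matchings: "finite (matchings m l P)"
  by (rule finite_subset[of _ "Pow {1..m}"]) (auto simp: matchings_def)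

lemma Z_count_eq:
  assumes "P \<in> configurations m d l"
  shows "Z_count m l h P = card {M \<in> matchings m l P. card M = h}"
  unfolding Z_count_def matchings_def by (simp add: is_matching_iff[OF assms] conj_assoc)

text \<open>A transversal has at most as many points as there are vertices, since otherwise the
  binomial coefficient counting it is 0. Hence the cut-off h \<le> m div d in the definition of Z
  discards no matching.\<close>

lemma card_matching_le:
  assumes P: "P \<in> configurations m d l" and l: "l > 0" and d: "d > 0" and M: "M \<in> matchings m l P"
  shows "card M \<le> m div d"
proof -
  note p = configurationsD[OF P]
  define S where "S = half_edges m l M"
  have cS: "card S = l * card M" unfolding S_def using M l by (intro card_half_edges) (auto simp: matchings_def)
  have "S \<in> {S. S \<subseteq> \<Union>P \<and> transversal P S \<and> card S = l * card M}"
    using M p(1) half_edges_subset cS by (auto simp: S_def matchings_def)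
  moreover have "finite {S. S \<subseteq> \<Union>P \<and> transversal P S \<and> card S = l * card M}"
    by (rule finite_subset[of _ "Pow {1..l * m}"]) (use p(1) in auto)
  ultimately have "card {S. S \<subseteq> \<Union>P \<and> transversal P S \<and> card S = l * card M} \<noteq> 0"
    by auto
  then have "l * card M \<le> l * m div d"
    using card_transversals[OF p(3,2,5), of "l * card M"] p(4) by (metis binomial_eq_0 mult_eq_0_iff not_le)
  then have "d * (l * card M) \<le> l * m" by (meson d dual_order.trans mult_le_mono2 times_div_less_eq_dividend)
  then have "l * (card M * d) \<le> l * m" by (simp add: mult_ac)
  then have "card M * d \<le> m" using l by simp
  then show ?thesis using d by (simp add: less_eq_div_iff_mult_less_eq)
qed

lemma Z_weighted_eq:
  assumes P: "P \<in> configurations m d l" and "l > 0" "d > 0"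
  shows "Z_weighted m d l x P = (\<Sum>M\<in>matchings m l P. x ^ card M)"
proof -
  have "(\<Sum>M\<in>matchings m l P. x ^ card M) = (\<Sum>h\<in>{0..m div d}. \<Sum>M\<in>{M \<in> matchings m l P. card M = h}. x ^ card M)"
    using card_matching_le[OF assms(1-3)] by (intro sum.group[symmetric] finite_matchings) auto
  also have "\<dots> = (\<Sum>h\<in>{0..m div d}. real (Z_count m l h P) * x ^ h)"
    by (intro sum.cong refl) (simp add: Z_count_eq[OF P])
  finally show ?thesis by (simp add: Z_weighted_def)
qed

lemma Z_weighted_ge:
  assumes "0 \<le> x" "h \<le> m div d"
  shows "real (Z_count m l h P) * x ^ h \<le> Z_weighted m d l x P"
  unfolding Z_weighted_def using assms by (intro member_le_sum) auto

lemma Z_weighted_pos: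
  assumes "P \<in> configurations m d l" "l > 0" "d > 0" "x > 0"
  shows "1 \<le> Z_weighted m d l x P"
proof -
  have "{} \<in> matchings m l P" by (auto simp: matchings_def transversal_def half_edges_def)
  then have "x ^ card ({} :: nat set) \<le> (\<Sum>M\<in>matchings m l P. x ^ card M)"
    using assms by (intro member_le_sum finite_matchings) auto
  then show ?thesis using assms by (simp add: Z_weighted_eq)
qed

lemma Z_weighted_one: "Z_weighted m d l 1 P = real (Z_total m d l P)"
  by (simp add: Z_weighted_def Z_total_def)

text \<open>Deleting the two hyperedges that contain the transposed half-edges turns a matching into
  one that survives the transposition.\<close>

lemma Z_weighted_transpose_le:
  assumes P: "P \<in> configurations m d l" and l: "l > 0" and d: "d > 0" and x: "x > 0"
    and uv: "u \<in> {1..l * m}" "v \<in> {1..l * m}"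
  defines "\<sigma> \<equiv> Transposition.transpose u v"
  shows "Z_weighted m d l x P \<le> (1 + x)\<^sup>2 * Z_weighted m d l x ((`) \<sigma> ` P)"
proof -
  define E where "E = {hyperedge_of l u, hyperedge_of l v}"
  have \<sigma>: "\<sigma> permutes {1..l * m}" unfolding \<sigma>_def using uv by (rule permutes_swap_id)
  define Q where "Q = (`) \<sigma> ` P"
  have Q: "Q \<in> configurations m d l" unfolding Q_def using \<sigma> P by (rule configurations_act)
  have sub: "M - E \<in> matchings m l Q" if M: "M \<in> matchings m l P" for M
  proof -
    have H: "\<sigma> y = y" if y: "y \<in> half_edges m l (M - E)" for y
    proof -
      have "y \<noteq> u" "y \<noteq> v" using y by (auto simp: half_edges_def E_def)
      then show ?thesis by (simp add: \<sigma>_def)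
    qed
    then have "\<sigma> ` half_edges m l (M - E) = half_edges m l (M - E)" by auto
    moreover have "transversal P (half_edges m l (M - E))"
      using M by (auto simp: matchings_def half_edges_def intro: transversal_mono)
    ultimately have "transversal Q (half_edges m l (M - E))"
      using transversal_image[OF permutes_inj[OF \<sigma>], of P "half_edges m l (M - E)"] by (simp add: Q_def)
    then show ?thesis using M by (auto simp: matchings_def)
  qed
  have card: "card M = card (M - E) + card (M \<inter> E)" if M: "M \<in> matchings m l P" for M
  proof -
    have "finite M" using M by (auto simp: matchings_def intro: finite_subset)
    then show ?thesis by (metis add.commute card_Diff_subset_Int card_mono finite_Int inf_le1 le_add_diff_inverse)
  qed
  have "Z_weighted m d l x P = (\<Sum>M\<in>matchings m l P. x ^ card (M - E) * x ^ card (M \<inter> E))"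
    unfolding Z_weighted_eq[OF P l d] by (intro sum.cong refl) (simp add: card power_add)
  also have "\<dots> = (\<Sum>z\<in>(\<lambda>M. (M - E, M \<inter> E)) ` matchings m l P. x ^ card (fst z) * x ^ card (snd z))"
  proof -
    have "inj_on (\<lambda>M. (M - E, M \<inter> E)) (matchings m l P)" by (rule inj_onI) blast
    then show ?thesis by (simp add: sum.reindex)
  qed
  also have "\<dots> \<le> (\<Sum>z\<in>matchings m l Q \<times> Pow E. x ^ card (fst z) * x ^ card (snd z))"
    using sub x by (intro sum_mono2 finite_cartesian_product finite_matchings) (auto simp: E_def)
  also have "\<dots> = (\<Sum>N\<in>matchings m l Q. \<Sum>B\<in>Pow E. x ^ card N * x ^ card B)"
    by (subst sum.cartesian_product) (simp add: split_def)
  also have "\<dots> = (\<Sum>N\<in>matchings m l Q. x ^ card N) * (\<Sum>B\<in>Pow E. x ^ card B)"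
    by (rule sum_product[symmetric])
  also have "\<dots> \<le> (\<Sum>N\<in>matchings m l Q. x ^ card N) * (1 + x)\<^sup>2"
  proof (rule mult_left_mono)
    \<comment> \<open>Each deleted hyperedge contributes a factor 1 + x. If both half-edges lie in
      one hyperedge, E is a singleton and there is only one such factor.\<close>
    show "(\<Sum>B\<in>Pow E. x ^ card B) \<le> (1 + x)\<^sup>2"
    proof (cases "hyperedge_of l u = hyperedge_of l v")
      case True
      have "Pow E = {{}, E}" unfolding E_def using True by auto
      then show ?thesis using True x by (simp add: E_def power2_eq_square algebra_simps)
    next
      case False
      have "Pow E = {{}, {hyperedge_of l u}, {hyperedge_of l v}, E}" unfolding E_def by auto
      then show ?thesis using False by (simp add: E_def doubleton_eq_iff power2_eq_square algebra_simps)
    qed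
  qed (use x in \<open>simp add: sum_nonneg\<close>)
  also have "\<dots> = (1 + x)\<^sup>2 * Z_weighted m d l x Q" unfolding Z_weighted_eq[OF Q l d] by simp
  finally show ?thesis by (simp add: Q_def)
qed

text \<open>A transposition is an involution, so the one-sided estimate applied to P and to its
  image bounds the difference in both directions.\<close>

lemma ln_Z_weighted_lipschitz:
  assumes P: "P \<in> configurations m d l" and l: "l > 0" and d: "d > 0" and x: "x > 0"
    and uv: "u \<in> {1..l * m}" "v \<in> {1..l * m}"
  shows "\<bar>ln (Z_weighted m d l x ((`) (Transposition.transpose u v) ` P)) - ln (Z_weighted m d l x P)\<bar> \<le> 2 * ln (1 + x)"
proof -
  define \<sigma> where "\<sigma> = Transposition.transpose u v"
  have \<sigma>: "\<sigma> permutes {1..l * m}" unfolding \<sigma>_def using uv by (rule permutes_swap_id)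
  define Q where "Q = (`) \<sigma> ` P"
  have Q: "Q \<in> configurations m d l" unfolding Q_def using \<sigma> P by (rule configurations_act)
  have PQ: "(`) \<sigma> ` Q = P" unfolding Q_def \<sigma>_def by (simp add: image_image)
  have le: "ln (Z_weighted m d l x R) \<le> 2 * ln (1 + x) + ln (Z_weighted m d l x ((`) \<sigma> ` R))"
    if R: "R \<in> configurations m d l" for R
  proof -
    have 1: "1 \<le> Z_weighted m d l x R" using Z_weighted_pos R l d x by blast
    have "1 \<le> Z_weighted m d l x ((`) \<sigma> ` R)" using Z_weighted_pos configurations_act[OF \<sigma> R] l d x by blast
    moreover have "ln (Z_weighted m d l x R) \<le> ln ((1 + x)\<^sup>2 * Z_weighted m d l x ((`) \<sigma> ` R))"
      using Z_weighted_transpose_le[OF R l d x uv] 1 by (simp add: \<sigma>_def)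
    ultimately show ?thesis using x by (simp add: ln_mult ln_realpow)
  qed
  show ?thesis using le[OF P] le[OF Q] PQ unfolding Q_def \<sigma>_def by simp
qed

section \<open>First and second moments of the matching counts\<close>

lemma expectation_random_hypergraph:
  fixes F :: "nat set set \<Rightarrow> real"
  assumes "d > 0" "d dvd l * m"
  shows "measure_pmf.expectation (random_hypergraph m d l) F
    = (\<Sum>P\<in>configurations m d l. F P) / real (card (configurations m d l))"
  unfolding random_hypergraph_def
  using configurations_nonempty[OF assms] finite_configurations by (rule integral_pmf_of_set)

lemma prob_random_hypergraph:
  assumes "d > 0" "d dvd l * m"
  shows "measure_pmf.prob (random_hypergraph m d l) A
    = real (card (configurations m d l \<inter> A)) / real (card (configurations m d l))"
  unfolding random_hypergraph_def
  using configurations_nonempty[OF assms] finite_configurations by (rule measure_pmf_of_set)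

lemma sum_card_swap:
  assumes "finite A" "finite B"
  shows "(\<Sum>x\<in>A. card {y\<in>B. R x y}) = (\<Sum>y\<in>B. card {x\<in>A. R x y})"
  using sum.swap_restrict[OF assms, where g = "\<lambda>_ _. 1 :: nat" and R = R] by simp

lemma expectation_Z_count:
  assumes d: "d > 0" and dvd: "d dvd l * m" and l: "l > 0" and h: "h \<le> m"
  shows "measure_pmf.expectation (random_hypergraph m d l) (\<lambda>P. real (Z_count m l h P))
    = real (m choose h) * real ((l * m div d) choose (l * h)) * real d ^ (l * h) / real ((l * m) choose (l * h))"
proof -
  let ?C = "configurations m d l"
  define Ms where "Ms = {M. M \<subseteq> {1..m} \<and> card M = h}"
  have finM: "finite Ms" unfolding Ms_def by simp
  have cM: "card Ms = m choose h" unfolding Ms_def by (simp add: n_subsets)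
  have "0 < card ?C" using configurations_nonempty[OF d dvd] finite_configurations by (simp add: card_gt_0_iff)
  then have c0: "real (card ?C) > 0" by simp
  have b0: "real ((l * m) choose (l * h)) > 0" using h by (simp add: zero_less_binomial_iff)
  have each: "real (card {P\<in>?C. transversal P (half_edges m l M)})
      = real (card ?C) * (real ((l * m div d) choose (l * h)) * real d ^ (l * h)) / real ((l * m) choose (l * h))"
    if "M \<in> Ms" for M
  proof -
    have c: "card (half_edges m l M) = l * h" using that l by (simp add: Ms_def card_half_edges)
    have "b \<noteq> 0 \<Longrightarrow> a * b = e \<Longrightarrow> a = e / b" for a b e :: real by (simp add: eq_divide_eq)
    from this[OF less_imp_neq[OF b0, symmetric] card_configurations_transversal[OF half_edges_subset[of m l M], of d, unfolded c]]
    show ?thesis .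
  qed
  have "(\<Sum>P\<in>?C. Z_count m l h P) = (\<Sum>P\<in>?C. card {M\<in>Ms. transversal P (half_edges m l M)})"
  proof (intro sum.cong refl)
    fix P assume P: "P \<in> ?C"
    show "Z_count m l h P = card {M\<in>Ms. transversal P (half_edges m l M)}"
      unfolding Z_count_eq[OF P] by (rule arg_cong[where f = card]) (auto simp: matchings_def Ms_def)
  qed
  also have "\<dots> = (\<Sum>M\<in>Ms. card {P\<in>?C. transversal P (half_edges m l M)})"
    by (rule sum_card_swap[OF finite_configurations finM])
  finally have "(\<Sum>P\<in>?C. real (Z_count m l h P)) = (\<Sum>M\<in>Ms. real (card {P\<in>?C. transversal P (half_edges m l M)}))"
    by (simp flip: of_nat_sum)
  also have "\<dots> = real (card Ms) * (real (card ?C) * (real ((l * m div d) choose (l * h)) * real d ^ (l * h)) / real ((l * m) choose (l * h)))"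
    using each by simp
  finally show ?thesis
    unfolding expectation_random_hypergraph[OF d dvd] cM using c0 by simp
qed

text \<open>The square counts ordered pairs of matchings, grouped here by the size i of their
  intersection. The weights may depend on i; each of the h + 1 groups contributes at most K to the
  mean.\<close>

lemma expectation_Z_count_square_le:
  fixes K :: real
  assumes d: "d > 0" and dvd: "d dvd l * m" and l: "l > 0" and K: "0 \<le> K"
    and bound: "\<And>i. i \<le> h \<Longrightarrow> \<exists>s\<ge>0. \<exists>w\<ge>0. 0 < w ^ (l * i) * s ^ (l * (h - i) + l * (h - i)) \<and>
      real (card (pairs_of_type {1..m} i (h - i) (h - i))) *
        (1 + 2 * real d * s + real d * (real d - 1) * s\<^sup>2 + real d * w) ^ (l * m div d)
      \<le> K * (real (card (pairs_of_type {1..l * m} (l * i) (l * (h - i)) (l * (h - i))))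
        * (w ^ (l * i) * s ^ (l * (h - i) + l * (h - i))))"
  shows "measure_pmf.expectation (random_hypergraph m d l) (\<lambda>P. (real (Z_count m l h P))\<^sup>2) \<le> real (Suc h) * K"
proof -
  let ?C = "configurations m d l"
  define R where "R = (\<lambda>P (M, N). transversal P (half_edges m l M) \<and> transversal P (half_edges m l N))"
  define T where "T i = pairs_of_type {1..m} i (h - i) (h - i)" for i
  have finT: "finite (T i)" for i unfolding T_def by (simp add: finite_pairs_of_type)
  have "0 < card ?C" using configurations_nonempty[OF d dvd] finite_configurations by (simp add: card_gt_0_iff)
  then have c0: "real (card ?C) > 0" by simp
  have sq: "(Z_count m l h P)\<^sup>2 = (\<Sum>i\<le>h. card {x\<in>T i. R P x})" if P: "P \<in> ?C" for P
  proof -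
    define Zs where "Zs = {M \<in> matchings m l P. card M = h}"
    have "(Z_count m l h P)\<^sup>2 = card (Zs \<times> Zs)"
      unfolding Z_count_eq[OF P] Zs_def[symmetric] by (simp add: card_cartesian_product power2_eq_square)
    also have "Zs \<times> Zs = (\<Union>i\<in>{..h}. {x\<in>T i. R P x})"
    proof (intro equalityI subsetI)
      fix x assume x: "x \<in> Zs \<times> Zs"
      then obtain M N where MN: "x = (M, N)" "M \<in> Zs" "N \<in> Zs" by blast
      have fin: "finite M" "finite N" using MN by (auto simp: Zs_def matchings_def intro: finite_subset)
      have c: "card (M - N) = h - card (M \<inter> N)" "card (N - M) = h - card (M \<inter> N)"
        using MN fin card_Diff_subset_Int[of M N] card_Diff_subset_Int[of N M] by (auto simp: Zs_def Int_commute)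
      have "card (M \<inter> N) \<le> h" using MN fin card_mono[of M "M \<inter> N"] by (auto simp: Zs_def)
      moreover have "x \<in> {x\<in>T (card (M \<inter> N)). R P x}"
        using MN c by (auto simp: T_def pairs_of_type_def R_def Zs_def matchings_def)
      ultimately show "x \<in> (\<Union>i\<in>{..h}. {x\<in>T i. R P x})" by blast
    next
      fix x assume "x \<in> (\<Union>i\<in>{..h}. {x\<in>T i. R P x})"
      then obtain i M N where i: "i \<le> h" "x = (M, N)" "(M, N) \<in> T i" "R P (M, N)" by (cases x) auto
      have s: "M \<subseteq> {1..m}" "N \<subseteq> {1..m}" "card (M \<inter> N) = i" "card (M - N) = h - i" "card (N - M) = h - i"
        using i(3) by (auto simp: T_def pairs_of_type_def)
      have fin: "finite M" "finite N" using s finite_subset by blast+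
      have "card M = card (M \<inter> N) + card (M - N)" "card N = card (M \<inter> N) + card (N - M)"
        using fin card_Diff_subset_Int[of M N] card_Diff_subset_Int[of N M]
          card_mono[of M "M \<inter> N"] card_mono[of N "M \<inter> N"] by (auto simp: Int_commute)
      then show "x \<in> Zs \<times> Zs" using s i by (auto simp: Zs_def matchings_def R_def)
    qed
    also have "card \<dots> = (\<Sum>i\<le>h. card {x\<in>T i. R P x})"
      by (rule card_UN_disjoint) (use finT in \<open>auto simp: T_def pairs_of_type_def\<close>)
    finally show ?thesis .
  qed
  have each: "(\<Sum>x\<in>T i. real (card {P\<in>?C. R P x})) \<le> real (card ?C) * K" if i: "i \<le> h" for i
  proof -
    obtain s w where sw: "s \<ge> 0" "w \<ge> 0" and pos: "0 < w ^ (l * i) * s ^ (l * (h - i) + l * (h - i))"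
      and b: "real (card (T i)) * (1 + 2 * real d * s + real d * (real d - 1) * s\<^sup>2 + real d * w) ^ (l * m div d)
        \<le> K * (real (card (pairs_of_type {1..l * m} (l * i) (l * (h - i)) (l * (h - i))))
        * (w ^ (l * i) * s ^ (l * (h - i) + l * (h - i))))"
      using bound[OF i] unfolding T_def by blast
    define W where "W = w ^ (l * i) * s ^ (l * (h - i) + l * (h - i))"
    define Y where "Y = pairs_of_type {1..l * m} (l * i) (l * (h - i)) (l * (h - i))"
    define G where "G = (1 + 2 * real d * s + real d * (real d - 1) * s\<^sup>2 + real d * w) ^ (l * m div d)"
    show ?thesis
    \<comment> \<open>Some overlaps may admit no pair at all. Otherwise an existing pair shows that
      the half-edge type is inhabited, which justifies cancelling its cardinality.\<close>
    proof (cases "T i = {}")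
      case True
      then show ?thesis using K by simp
    next
      case False
      then obtain M N where MN: "(M, N) \<in> T i" by auto
      have HY: "(half_edges m l M, half_edges m l N) \<in> Y" if "(M, N) \<in> T i" for M N
        unfolding Y_def by (rule half_edges_pairs_of_type[OF l]) (use that in \<open>simp add: T_def\<close>)
      have "finite Y" unfolding Y_def by (simp add: finite_pairs_of_type)
      then have "0 < card Y" using HY[OF MN] by (auto simp: card_gt_0_iff)
      then have YW: "0 < real (card Y) * W" using pos by (simp add: W_def)
      have "(\<Sum>x\<in>T i. real (card {P\<in>?C. R P x})) * (real (card Y) * W)
          = (\<Sum>x\<in>T i. real (card {P\<in>?C. R P x}) * real (card Y) * W)"
        by (simp add: sum_distrib_right mult.assoc)
      also have "\<dots> \<le> (\<Sum>x\<in>T i. real (card ?C) * G)"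
      proof (rule sum_mono)
        fix x assume x: "x \<in> T i"
        obtain M N where x': "x = (M, N)" by (cases x)
        have "(half_edges m l M, half_edges m l N) \<in> Y" using HY x x' by simp
        then show "real (card {P\<in>?C. R P x}) * real (card Y) * W \<le> real (card ?C) * G"
          unfolding x' R_def Y_def W_def G_def prod.case
          by (rule card_configurations_transversal_pair[OF _ sw])
      qed
      also have "\<dots> = real (card ?C) * (real (card (T i)) * G)" by simp
      also have "\<dots> \<le> real (card ?C) * (K * (real (card Y) * W))"
        using b by (intro mult_left_mono) (simp_all add: W_def G_def Y_def)
      also have "\<dots> = (real (card ?C) * K) * (real (card Y) * W)" by simp
      finally show ?thesis using YW by (rule mult_right_le_imp_le)
    qed
  qed
  have "(\<Sum>P\<in>?C. (real (Z_count m l h P))\<^sup>2) = (\<Sum>P\<in>?C. \<Sum>i\<le>h. real (card {x\<in>T i. R P x}))"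
  proof (rule sum.cong[OF refl])
    fix P assume "P \<in> ?C"
    from sq[OF this] have "real ((Z_count m l h P)\<^sup>2) = real (\<Sum>i\<le>h. card {x\<in>T i. R P x})" by (rule arg_cong)
    then show "(real (Z_count m l h P))\<^sup>2 = (\<Sum>i\<le>h. real (card {x\<in>T i. R P x}))" by simp
  qed
  also have "\<dots> = (\<Sum>i\<le>h. \<Sum>P\<in>?C. real (card {x\<in>T i. R P x}))" by (rule sum.swap)
  also have "\<dots> = (\<Sum>i\<le>h. \<Sum>x\<in>T i. real (card {P\<in>?C. R P x}))"
  proof (rule sum.cong[OF refl])
    fix i
    have "real (\<Sum>P\<in>?C. card {x\<in>T i. R P x}) = real (\<Sum>x\<in>T i. card {P\<in>?C. R P x})"
      by (rule arg_cong[OF sum_card_swap[OF finite_configurations finT]])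
    then show "(\<Sum>P\<in>?C. real (card {x\<in>T i. R P x})) = (\<Sum>x\<in>T i. real (card {P\<in>?C. R P x}))" by simp
  qed
  also have "\<dots> \<le> (\<Sum>i\<le>h. real (card ?C) * K)" using each by (intro sum_mono) simp
  also have "\<dots> = (real (Suc h) * K) * real (card ?C)" by simp
  finally show ?thesis
    unfolding expectation_random_hypergraph[OF d dvd] using c0 by (simp add: pos_divide_le_eq)
qed

section \<open>Stirling asymptotics\<close>

text \<open>The factor by which n! exceeds (n/e)^n; it equals 1 at n = 0 because 0^0 = 1, so
  products over possibly empty cells need no case split.\<close>

definition stirling_ratio :: "nat \<Rightarrow> real" where
  "stirling_ratio n = fact n * exp (real n) / real n ^ n"

lemma fact_stirling: "fact n = stirling_ratio n * (real n ^ n / exp (real n))"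
  by (cases "n = 0") (auto simp: stirling_ratio_def)

lemma stirling_ratio_pos: "0 < stirling_ratio n"
  by (cases "n = 0") (auto simp: stirling_ratio_def)

text \<open>At x = 1/n, multiplying the left side by n + 1/2 gives exactly 1, which is what the
  monotonicity of Stirling's sequence requires.\<close>

lemma ln_one_plus_lower:
  fixes x :: real assumes "0 \<le> x" shows "2 * x / (2 + x) \<le> ln (1 + x)"
proof -
  define f where "f x = ln (1 + x) - 2 * x / (2 + x)" for x :: real
  have "f 0 \<le> f x"
  proof (rule DERIV_nonneg_imp_nondecreasing[OF assms])
    fix y :: real assume y: "0 \<le> y" "y \<le> x"
    have 1: "((\<lambda>x. ln (1 + x)) has_real_derivative 1 / (1 + y)) (at y)"
      using y by (auto intro!: derivative_eq_intros)
    have 2: "((\<lambda>x. 2 * x / (2 + x)) has_real_derivative (2 * (2 + y) - 2 * y * 1) / ((2 + y) * (2 + y))) (at y)"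
      using y by (intro DERIV_divide) (auto intro!: derivative_eq_intros)
    have "(f has_real_derivative 1 / (1 + y) - 4 / (2 + y)\<^sup>2) (at y)"
      unfolding f_def[abs_def] using DERIV_diff[OF 1 2] by (simp add: power2_eq_square)
    moreover have "4 / (2 + y)\<^sup>2 \<le> 1 / (1 + y)"
    proof -
      have "4 * (1 + y) \<le> (2 + y)\<^sup>2" by (simp add: power2_eq_square algebra_simps)
      then show ?thesis using y by (simp add: field_simps)
    qed
    ultimately show "\<exists>z. (f has_real_derivative z) (at y) \<and> 0 \<le> z" by force
  qed
  then show ?thesis by (simp add: f_def)
qed

text \<open>Third order is the useful precision: in (n + 1/2) * ln (1 + 1/n) - 1 the terms of order
  1/n cancel, and a summable remainder of order 1/n^2 is left.\<close>

lemma ln_one_plus_upper: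
  fixes x :: real assumes "0 \<le> x" shows "ln (1 + x) \<le> x - x\<^sup>2 / 2 + x ^ 3 / 3"
proof -
  define f where "f x = x - x\<^sup>2 / 2 + x ^ 3 / 3 - ln (1 + x)" for x :: real
  have "f 0 \<le> f x"
  proof (rule DERIV_nonneg_imp_nondecreasing[OF assms])
    fix y :: real assume y: "0 \<le> y" "y \<le> x"
    have "(f has_real_derivative 1 - y + y\<^sup>2 - 1 / (1 + y)) (at y)"
    proof -
      have 1: "((\<lambda>x. ln (1 + x)) has_real_derivative 1 / (1 + y)) (at y)"
        using y by (auto intro!: derivative_eq_intros)
      have 2: "((\<lambda>x. x - x\<^sup>2 / 2 + x ^ 3 / 3) has_real_derivative 1 - y + y\<^sup>2) (at y)"
        by (auto intro!: derivative_eq_intros)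
      show ?thesis unfolding f_def[abs_def] using DERIV_diff[OF 2 1] .
    qed
    moreover have "1 \<le> (1 - y + y\<^sup>2) * (1 + y)"
    proof -
      have "(1 - y + y\<^sup>2) * (1 + y) = 1 + y ^ 3" by algebra
      then show ?thesis using y by simp
    qed
    then have "1 / (1 + y) \<le> 1 - y + y\<^sup>2" using y by (simp add: divide_le_eq)
    ultimately show "\<exists>z. (f has_real_derivative z) (at y) \<and> 0 \<le> z" by force
  qed
  then show ?thesis by (simp add: f_def)
qed

lemma stirling_ratio_Suc:
  assumes "n > 0"
  shows "stirling_ratio (Suc n) = stirling_ratio n * exp (1 - real n * ln (1 + 1 / real n))"
proof -
  have "exp (real n * ln (1 + 1 / real n)) = (1 + 1 / real n) ^ n"
    using assms by (simp add: exp_of_nat_mult add_pos_nonneg)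
  also have "(1 + 1 / real n) ^ n = real (Suc n) ^ n / real n ^ n"
    using assms by (simp add: power_divide[symmetric] add_divide_distrib add.commute)
  finally have "exp (1 - real n * ln (1 + 1 / real n)) = exp 1 * (real n ^ n / real (Suc n) ^ n)"
    unfolding exp_diff by (simp del: of_nat_Suc)
  moreover have "exp (real (Suc n)) = exp 1 * exp (real n)" by (simp add: exp_add)
  ultimately show ?thesis using assms by (simp add: stirling_ratio_def field_simps del: of_nat_Suc)
qed

text \<open>The logarithm of n! / ((n/e)^n * sqrt n) for n > 0. It decreases from 1 to ln (sqrt (2 *
  pi)).\<close>

definition stirling_norm :: "nat \<Rightarrow> real" where
  "stirling_norm n = ln (stirling_ratio n) - ln (real n) / 2"

lemma stirling_norm_diff:
  assumes "n > 0"
  shows "stirling_norm n - stirling_norm (Suc n) = (real n + 1 / 2) * ln (1 + 1 / real n) - 1"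
proof -
  have "real (Suc n) = real n * (1 + 1 / real n)" using assms by (simp add: distrib_left)
  then have "ln (real (Suc n)) = ln (real n * (1 + 1 / real n))" by (rule arg_cong)
  also have "\<dots> = ln (real n) + ln (1 + 1 / real n)" using assms by (intro ln_mult_pos) (auto simp: add_pos_nonneg)
  finally have "ln (real (Suc n)) = ln (real n) + ln (1 + 1 / real n)" .
  moreover have "ln (stirling_ratio (Suc n)) = ln (stirling_ratio n) + (1 - real n * ln (1 + 1 / real n))"
    unfolding stirling_ratio_Suc[OF assms] using stirling_ratio_pos[of n] by (subst ln_mult) auto
  moreover have "(real n + 1 / 2) * ln (1 + 1 / real n) = real n * ln (1 + 1 / real n) + ln (1 + 1 / real n) / 2"
    by (simp add: distrib_right)
  ultimately show ?thesis unfolding stirling_norm_def by argo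
qed

lemma stirling_norm_decreasing: "n > 0 \<Longrightarrow> stirling_norm (Suc n) \<le> stirling_norm n"
proof -
  assume n: "n > 0"
  have "1 = (real n + 1 / 2) * (2 * (1 / real n) / (2 + 1 / real n))" using n by (simp add: field_simps)
  also have "\<dots> \<le> (real n + 1 / 2) * ln (1 + 1 / real n)"
    by (intro mult_left_mono ln_one_plus_lower) auto
  finally show ?thesis using stirling_norm_diff[OF n] by simp
qed

text \<open>Each decrement is at most 1/n - 1/(n+1), so subtracting 1/n reverses the monotonicity
  and yields a lower bound for the decreasing sequence.\<close>

lemma stirling_norm_lower_step: "n > 0 \<Longrightarrow> stirling_norm n - 1 / real n \<le> stirling_norm (Suc n) - 1 / real (Suc n)"
proof -
  assume n: "n > 0"
  define x where "x = 1 / real n"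
  have x: "0 < x" "x \<le> 1" using n by (auto simp: x_def)
  have nx: "real n * x = 1" using n by (simp add: x_def)
  have "(real n + 1 / 2) * ln (1 + x) - 1 \<le> (real n + 1 / 2) * (x - x\<^sup>2 / 2 + x ^ 3 / 3) - 1"
    using ln_one_plus_upper[of x] x by (intro diff_right_mono mult_left_mono) auto
  also have "\<dots> = x\<^sup>2 / 12 + x ^ 3 / 6"
  proof -
    have "(real n + 1 / 2) * (x - x\<^sup>2 / 2 + x ^ 3 / 3) - 1
      = (real n * x) * (1 - x / 2 + x\<^sup>2 / 3) + x / 2 - x\<^sup>2 / 4 + x ^ 3 / 6 - 1"
      by (simp add: field_simps power2_eq_square power3_eq_cube)
    then show ?thesis unfolding nx by (simp add: field_simps)
  qed
  also have "\<dots> \<le> x\<^sup>2 / 2"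
  proof -
    have "x ^ 3 \<le> x\<^sup>2" using x by (simp add: power_decreasing)
    then show ?thesis using zero_le_power2[of x] by linarith
  qed
  also have "\<dots> \<le> 1 / real n - 1 / real (Suc n)"
  proof -
    have "1 / real n - 1 / real (Suc n) = 1 / (real n * real (Suc n))" using n by (simp add: field_simps)
    moreover have "1 / (2 * (real n)\<^sup>2) \<le> 1 / (real n * real (Suc n))"
      using n by (intro divide_left_mono) (auto simp: power2_eq_square)
    ultimately show ?thesis by (simp add: x_def power_divide)
  qed
  finally show ?thesis using stirling_norm_diff[OF n] by (simp add: x_def)
qed

lemma stirling_norm_bounds:
  assumes "n > 0"
  shows "stirling_norm n \<le> 1" "0 \<le> stirling_norm n"
proof -
  have 1: "stirling_norm 1 = 1" by (simp add: stirling_norm_def stirling_ratio_def)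
  have a: "stirling_norm (Suc n) \<le> 1" for n
    by (induction n) (use 1 stirling_norm_decreasing in \<open>auto intro: order_trans\<close>)
  have b: "0 \<le> stirling_norm (Suc n) - 1 / real (Suc n)" for n
  proof (induction n)
    case (Suc n)
    then show ?case using stirling_norm_lower_step[of "Suc n"] by linarith
  qed (use 1 in simp)
  obtain k where k: "n = Suc k" using assms gr0_implies_Suc by blast
  have "0 \<le> 1 / real (Suc k)" by simp
  then show "stirling_norm n \<le> 1" "0 \<le> stirling_norm n" unfolding k using a[of k] b[of k] by linarith+
qed

lemma stirling_ratio_bounds:
  assumes "n > 0"
  shows "sqrt (real n) \<le> stirling_ratio n" "stirling_ratio n \<le> 3 * sqrt (real n)"
proof -
  have "stirling_ratio n = exp (stirling_norm n + ln (real n) / 2)"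
    unfolding stirling_norm_def using stirling_ratio_pos[of n] by simp
  also have "\<dots> = exp (stirling_norm n) * sqrt (real n)"
    using assms by (simp add: exp_add ln_sqrt[symmetric])
  finally have e: "stirling_ratio n = exp (stirling_norm n) * sqrt (real n)" .
  have "1 \<le> exp (stirling_norm n)" "exp (stirling_norm n) \<le> 3"
    using stirling_norm_bounds[OF assms] exp_le by (simp, meson exp_le_cancel_iff order_trans)
  then show "sqrt (real n) \<le> stirling_ratio n" "stirling_ratio n \<le> 3 * sqrt (real n)"
    unfolding e using mult_right_mono[of 1 "exp (stirling_norm n)" "sqrt (real n)"]
      mult_right_mono[of "exp (stirling_norm n)" 3 "sqrt (real n)"] by auto
qed

section \<open>The constant in Stirling's formula\<close>

lemma gbinomial_minus_half: "((- 1 / 2 :: real) gchoose n) = (- 1) ^ n * fact (2 * n) / (4 ^ n * (fact n)\<^sup>2)"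
proof (induction n)
  case (Suc n)
  have "((- 1 / 2 :: real) gchoose Suc n) = (- 1 / 2 - real n) * ((- 1 / 2) gchoose n) / real (Suc n)"
    using gbinomial_mult_1[of "- 1 / 2 :: real" n] by (simp add: field_simps)
  also have "\<dots> = (- 1) ^ Suc n * fact (2 * n) * (2 * real n + 1) / (2 * real (Suc n) * 4 ^ n * (fact n)\<^sup>2)"
    unfolding Suc.IH by (simp add: field_simps)
  also have "\<dots> = (- 1) ^ Suc n * fact (2 * Suc n) / (4 ^ Suc n * (fact (Suc n))\<^sup>2)"
  proof -
    have "(fact (2 * Suc n) :: real) = 2 * real (Suc n) * (2 * real n + 1) * fact (2 * n)"
      by (simp add: algebra_simps)
    moreover have "(fact (Suc n) :: real)\<^sup>2 = real (Suc n) * real (Suc n) * (fact n)\<^sup>2"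
      by (simp only: fact_Suc of_nat_mult power2_eq_square mult_ac)
    ultimately show ?thesis by (simp add: field_simps del: fact_Suc of_nat_Suc)
  qed
  finally show ?case .
qed simp

text \<open>The limit is identified by comparing n with 2n:
  \<open>stirling_norm (2 * n) - 2 * stirling_norm n + ln 2 / 2\<close> is the logarithm of sqrt n
  times the central binomial coefficient over 4^n. Up to sign, that quotient is the generalised
  binomial coefficient of -1/2, whose asymptotics involve Gamma (1/2) = sqrt pi.\<close>

lemma stirling_norm_limit: "stirling_norm \<longlonglongrightarrow> ln (sqrt (2 * pi))"
proof -
  have "decseq (\<lambda>n. stirling_norm (Suc n))" by (rule decseq_SucI) (simp add: stirling_norm_decreasing)
  moreover have "\<And>n. 0 \<le> stirling_norm (Suc n)" by (simp add: stirling_norm_bounds)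
  ultimately obtain L where "(\<lambda>n. stirling_norm (Suc n)) \<longlonglongrightarrow> L" using decseq_convergent by blast
  then have L: "stirling_norm \<longlonglongrightarrow> L" by (rule LIMSEQ_imp_Suc)
  have 2: "(\<lambda>n. stirling_norm (2 * n)) \<longlonglongrightarrow> L"
    using LIMSEQ_subseq_LIMSEQ[OF L, of "\<lambda>n. 2 * n"] by (simp add: strict_mono_def comp_def)
  let ?g = "\<lambda>n. ((- 1 / 2 :: real) gchoose n) / ((-1) ^ n / exp (ln (real n) / 2))"
  have "(\<lambda>n. ((- 1 / 2 :: real) gchoose n) / ((-1) ^ n / exp ((- 1 / 2 + 1) * of_real (ln (real n))))) \<longlonglongrightarrow> inverse (Gamma (- (- 1 / 2)))"
    by (rule gbinomial_asymptotic)
  then have g: "?g \<longlonglongrightarrow> inverse (sqrt pi)"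
    by (simp add: Gamma_one_half_real)
  have lim: "(\<lambda>n. exp (stirling_norm (2 * n) - 2 * stirling_norm n + ln 2 / 2)) \<longlonglongrightarrow> exp (L - 2 * L + ln 2 / 2)"
    by (intro tendsto_intros L 2)
  have "eventually (\<lambda>n. exp (stirling_norm (2 * n) - 2 * stirling_norm n + ln 2 / 2) = ?g n) sequentially"
    using eventually_gt_at_top[of 0]
  proof eventually_elim
    case (elim n)
    have sp: "stirling_ratio n > 0" "stirling_ratio (2 * n) > 0" by (rule stirling_ratio_pos)+
    have e: "stirling_norm (2 * n) - 2 * stirling_norm n + ln 2 / 2
        = ln (stirling_ratio (2 * n)) - 2 * ln (stirling_ratio n) + ln (real n) / 2"
    proof -
      have "ln (real (2 * n)) = ln 2 + ln (real n)" using elim by (simp add: ln_mult)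
      then show ?thesis unfolding stirling_norm_def by argo
    qed
    have e2: "exp (2 * ln (stirling_ratio n)) = (stirling_ratio n)\<^sup>2"
    proof -
      have "exp (2 * ln (stirling_ratio n)) = exp (ln (stirling_ratio n)) * exp (ln (stirling_ratio n))"
        by (simp only: mult_2 exp_add)
      then show ?thesis using sp by (simp only: exp_ln power2_eq_square)
    qed
    have "exp (stirling_norm (2 * n) - 2 * stirling_norm n + ln 2 / 2)
        = stirling_ratio (2 * n) / (stirling_ratio n)\<^sup>2 * exp (ln (real n) / 2)"
      unfolding e exp_add exp_diff e2 using sp by simp
    also have "stirling_ratio (2 * n) / (stirling_ratio n)\<^sup>2 = fact (2 * n) / (4 ^ n * (fact n)\<^sup>2)"
    proof -
      have "real (2 * n) ^ (2 * n) = 4 ^ n * (real n ^ n)\<^sup>2"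
      proof -
        have "(4 :: real) ^ n = (2\<^sup>2) ^ n" by simp
        also have "\<dots> = (2 ^ n)\<^sup>2" by (simp only: power_mult[symmetric] mult.commute)
        finally have 4: "(4 :: real) ^ n = (2 ^ n)\<^sup>2" .
        have "real (2 * n) ^ (2 * n) = ((2 * real n) ^ n)\<^sup>2" by (simp only: of_nat_mult of_nat_numeral power_mult[symmetric] mult.commute)
        then show ?thesis unfolding 4 by (simp only: power_mult_distrib)
      qed
      moreover have "exp (real (2 * n)) = (exp (real n))\<^sup>2" by (simp only: mult_2 of_nat_add exp_add power2_eq_square)
      ultimately have "stirling_ratio (2 * n) = fact (2 * n) * (exp (real n))\<^sup>2 / (4 ^ n * (real n ^ n)\<^sup>2)"
        unfolding stirling_ratio_def by (simp only:)
      moreover have "a * e\<^sup>2 / (b * r\<^sup>2) / (c * e / r)\<^sup>2 = a / (b * c\<^sup>2)"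
        if "e > 0" "r > 0" for a b c e r :: real
        using that by (simp add: power_divide power_mult_distrib)
      ultimately show ?thesis using elim by (simp only: stirling_ratio_def[of n]) simp
    qed
    also have "\<dots> * exp (ln (real n) / 2) = ?g n"
    proof -
      have "(- 1) ^ n * x / (y) / ((- 1) ^ n / z) = x / y * z" for x y z :: real
        by (cases "even n") auto
      then show ?thesis unfolding gbinomial_minus_half by (simp only:)
    qed
    finally show ?case .
  qed
  then have "?g \<longlonglongrightarrow> exp (L - 2 * L + ln 2 / 2)"
    by (rule Lim_transform_eventually[OF lim])
  then have "exp (L - 2 * L + ln 2 / 2) = inverse (sqrt pi)" using g by (rule LIMSEQ_unique)
  moreover have "exp (L - 2 * L + ln 2 / 2) = exp (- L) * sqrt 2"
  proof -
    have "exp (ln 2 / 2 :: real) = sqrt 2" by (simp add: ln_sqrt[symmetric])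
    moreover have "L - 2 * L + ln 2 / 2 = - L + ln 2 / 2" by simp
    ultimately show ?thesis by (simp only: exp_add)
  qed
  ultimately have "inverse (exp L) * sqrt 2 = inverse (sqrt pi)" by (simp add: exp_minus)
  moreover have "e = s * p" if "inverse e * s = inverse p" "e > 0" "p > 0" for e s p :: real
    using that by (simp add: field_simps)
  ultimately have "exp L = sqrt 2 * sqrt pi" by simp
  then have "L = ln (sqrt 2 * sqrt pi)" using ln_exp[of L] by simp
  then have "L = ln (sqrt (2 * pi))" by (simp only: real_sqrt_mult)
  then show ?thesis using L by simp
qed

lemma stirling_ratio_asymp:
  assumes "filterlim f at_top F"
  shows "((\<lambda>x. stirling_ratio (f x) / sqrt (real (f x))) \<longlongrightarrow> sqrt (2 * pi)) F"
proof -
  have "((\<lambda>x. exp (stirling_norm (f x))) \<longlongrightarrow> exp (ln (sqrt (2 * pi)))) F"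
    by (intro tendsto_intros filterlim_compose[OF stirling_norm_limit assms])
  then have lim: "((\<lambda>x. exp (stirling_norm (f x))) \<longlongrightarrow> sqrt (2 * pi)) F" by simp
  have "eventually (\<lambda>x. f x > 0) F" using assms eventually_gt_at_top[of 0] by (rule eventually_compose_filterlim[rotated])
  then have "eventually (\<lambda>x. exp (stirling_norm (f x)) = stirling_ratio (f x) / sqrt (real (f x))) F"
  proof eventually_elim
    case (elim x)
    then show ?case using stirling_ratio_pos[of "f x"]
      by (simp add: stirling_norm_def exp_diff ln_sqrt[symmetric])
  qed
  then show ?thesis by (rule Lim_transform_eventually[OF lim])
qed

section \<open>The rate function\<close>

lemma ln_deriv_scaled:
  fixes c y :: real
  assumes "c * y < 1"
  shows "((\<lambda>y. ln (1 - c * y)) has_real_derivative - c / (1 - c * y)) (at y)"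
proof -
  have "((\<lambda>y. 1 - c * y) has_real_derivative 0 - c * 1) (at y)"
    by (intro DERIV_diff DERIV_const DERIV_cmult DERIV_ident)
  from DERIV_chain2[OF DERIV_ln_divide[of "1 - c * y"] this] assms
  show ?thesis by simp
qed

definition phi' :: "nat \<Rightarrow> nat \<Rightarrow> real \<Rightarrow> real" where
  "phi' d l y = - ln y - (real l - 1) * ln (1 - y) + real l * ln (1 - real d * y)"

definition phi'' :: "nat \<Rightarrow> nat \<Rightarrow> real \<Rightarrow> real" where
  "phi'' d l y = - (1 / y) + (real l - 1) / (1 - y) - real l * real d / (1 - real d * y)"

context
  fixes d l :: nat
  assumes d: "d \<ge> 2" and l: "l \<ge> 2"
begin

lemma unit_interval:
  assumes "0 \<le> y" "y \<le> 1 / real d"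
  shows "real d * y \<le> 1" "y \<le> 1 / 2"
proof -
  show "real d * y \<le> 1" using assms d by (simp add: field_simps)
  have "1 / real d \<le> 1 / 2" using d by (intro divide_left_mono) auto
  then show "y \<le> 1 / 2" using assms by linarith
qed

lemma open_unit_interval:
  assumes "y \<in> {0<..<1 / real d}"
  shows "0 < y" "real d * y < 1" "y < 1 / 2" "y < 1"
proof -
  show "0 < y" using assms by simp
  show "real d * y < 1" using assms d by (simp add: field_simps)
  have "1 / real d \<le> 1 / 2" using d by (intro divide_left_mono) auto
  then show "y < 1 / 2" using assms by simp
  then show "y < 1" by simp
qed

lemma Phi_deriv:
  assumes "y \<in> {0<..<1 / real d}"
  shows "(Phi d l has_real_derivative phi' d l y) (at y)"
proof -
  note y = open_unit_interval[OF assms]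
  have ln1: "((\<lambda>y. ln (1 - y)) has_real_derivative - 1 / (1 - y)) (at y)"
    using ln_deriv_scaled[of 1 y] y by simp
  have lnd: "((\<lambda>y. ln (1 - real d * y)) has_real_derivative - real d / (1 - real d * y)) (at y)"
    using ln_deriv_scaled[of "real d" y] y by simp
  have ln0: "(ln has_real_derivative 1 / y) (at y)" using y by (intro DERIV_ln_divide)
  have 1: "((\<lambda>y. - y * ln y) has_real_derivative (- 1) * ln y + 1 / y * (- y)) (at y)"
    by (intro DERIV_mult DERIV_minus DERIV_ident ln0)
  have c: "((\<lambda>y. (real l - 1) * (1 - y)) has_real_derivative (real l - 1) * (0 - 1)) (at y)"
    by (intro DERIV_cmult DERIV_diff DERIV_const DERIV_ident)
  have e: "((\<lambda>y. real l / real d * (1 - real d * y)) has_real_derivative real l / real d * (0 - real d * 1)) (at y)"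
    by (intro DERIV_cmult DERIV_diff DERIV_const DERIV_ident)
  have "(Phi d l has_real_derivative ((- 1) * ln y + 1 / y * (- y))
     + ((real l - 1) * (0 - 1) * ln (1 - y) + - 1 / (1 - y) * ((real l - 1) * (1 - y)))
     - (real l / real d * (0 - real d * 1) * ln (1 - real d * y)
       + - real d / (1 - real d * y) * (real l / real d * (1 - real d * y)))) (at y)"
    unfolding Phi_def[abs_def]
    by (intro DERIV_add DERIV_diff 1 DERIV_mult[OF c ln1] DERIV_mult[OF e lnd])
  moreover have "((- 1) * ln y + 1 / y * (- y))
     + ((real l - 1) * (0 - 1) * ln (1 - y) + - 1 / (1 - y) * ((real l - 1) * (1 - y)))
     - (real l / real d * (0 - real d * 1) * ln (1 - real d * y)
       + - real d / (1 - real d * y) * (real l / real d * (1 - real d * y))) = phi' d l y"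
  proof -
    have "1 / y * (- y) = -1" "- 1 / (1 - y) * ((real l - 1) * (1 - y)) = - (real l - 1)"
      "- real d / (1 - real d * y) * (real l / real d * (1 - real d * y)) = - real l"
      "real l / real d * (0 - real d * 1) = - real l"
      using y d by auto
    then show ?thesis unfolding phi'_def by (simp add: algebra_simps)
  qed
  ultimately show ?thesis by simp
qed

lemma phi'_deriv:
  assumes "y \<in> {0<..<1 / real d}"
  shows "(phi' d l has_real_derivative phi'' d l y) (at y)"
proof -
  note y = open_unit_interval[OF assms]
  have ln1: "((\<lambda>y. ln (1 - y)) has_real_derivative - 1 / (1 - y)) (at y)"
    using ln_deriv_scaled[of 1 y] y by simp
  have lnd: "((\<lambda>y. ln (1 - real d * y)) has_real_derivative - real d / (1 - real d * y)) (at y)"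
    using ln_deriv_scaled[of "real d" y] y by simp
  have ln0: "(ln has_real_derivative 1 / y) (at y)" using y by (intro DERIV_ln_divide)
  have "(phi' d l has_real_derivative - (1 / y) - (real l - 1) * (- 1 / (1 - y)) + real l * (- real d / (1 - real d * y))) (at y)"
    unfolding phi'_def[abs_def] by (intro DERIV_add DERIV_diff DERIV_minus DERIV_cmult ln0 ln1 lnd)
  then show ?thesis by (simp add: phi''_def)
qed

text \<open>The last two terms of \<open>phi''\<close> have a nonpositive sum, because l - 1 \<le> l
  * d and 1 - d * y \<le> 1 - y; then y < 1/d bounds the curvature uniformly.\<close>

lemma phi''_le:
  assumes "y \<in> {0<..<1 / real d}"
  shows "phi'' d l y \<le> - (1 / y)" "phi'' d l y < - real d"
proof -
  note y = open_unit_interval[OF assms]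
  have "(real l - 1) / (1 - y) \<le> real l * real d / (1 - real d * y)"
  proof (rule frac_le)
    show "real l - 1 \<le> real l * real d" 
    proof -
      have "real l * 1 \<le> real l * real d" using d by (intro mult_left_mono) auto
      then show ?thesis by simp
    qed
    have "1 * y \<le> real d * y" using y d by (intro mult_right_mono) auto
    then show "1 - real d * y \<le> 1 - y" by simp
  qed (use y in auto)
  then show 1: "phi'' d l y \<le> - (1 / y)" by (simp add: phi''_def)
  have "real d < 1 / y" using y by (simp add: field_simps)
  then show "phi'' d l y < - real d" using 1 by linarith
qed

text \<open>Strong concavity of \<open>Phi\<close> with constant d, in integrated form.\<close>

lemma phi'_decreasing:
  assumes "x < y" "0 < x" "y < 1 / real d"
  shows "phi' d l y + real d * y \<le> phi' d l x + real d * x"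
proof (rule DERIV_nonpos_imp_nonincreasing[of x y "\<lambda>y. phi' d l y + real d * y"])
  show "x \<le> y" using assms by simp
  fix z assume z: "x \<le> z" "z \<le> y"
  then have zi: "z \<in> {0<..<1 / real d}" using assms by simp
  have "((\<lambda>y. phi' d l y + real d * y) has_real_derivative phi'' d l z + real d * 1) (at z)"
    by (intro DERIV_add DERIV_cmult DERIV_ident phi'_deriv zi)
  moreover have "phi'' d l z + real d * 1 \<le> 0" using phi''_le(2)[OF zi] by simp
  ultimately show "\<exists>v. ((\<lambda>y. phi' d l y + real d * y) has_real_derivative v) (at z) \<and> v \<le> 0" by blast
qed

lemma phi'_strict:
  assumes "x < y" "0 < x" "y < 1 / real d"
  shows "phi' d l y < phi' d l x"
proof -
  have "real d * x < real d * y" using assms d by simp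
  then show ?thesis using phi'_decreasing[OF assms] by linarith
qed

lemma deriv_Phi: "y \<in> {0<..<1 / real d} \<Longrightarrow> deriv (Phi d l) y = phi' d l y"
  using Phi_deriv by (rule DERIV_imp_deriv)

lemma phi'_eq_iff:
  assumes "y \<in> {0<..<1 / real d}" "x > 0"
  shows "phi' d l y + ln x = 0 \<longleftrightarrow> x * (1 - real d * y) ^ l = y * (1 - y) ^ (l - 1)"
proof -
  note y = open_unit_interval[OF assms(1)]
  have pos: "0 < x * (1 - real d * y) ^ l" "0 < y * (1 - y) ^ (l - 1)" using y assms(2) by auto
  have "ln (x * (1 - real d * y) ^ l) = ln x + real l * ln (1 - real d * y)"
    using y assms(2) by (simp add: ln_mult ln_realpow)
  moreover have "ln (y * (1 - y) ^ (l - 1)) = ln y + (real l - 1) * ln (1 - y)"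
    using y l by (simp add: ln_mult ln_realpow of_nat_diff)
  ultimately have "phi' d l y + ln x = ln (x * (1 - real d * y) ^ l) - ln (y * (1 - y) ^ (l - 1))"
    by (simp add: phi'_def)
  then show ?thesis using ln_inj_iff[OF pos] by auto
qed

text \<open>Existence uses the exponentiated equation, both sides of which are polynomials up to the
  end points, where \<open>phi'\<close> itself is singular. Uniqueness is the strict monotonicity of
  \<open>phi'\<close>.\<close>

lemma is_beta_star_at_ex1:
  assumes "x > 0"
  shows "\<exists>!y. is_beta_star_at d l x y"
proof -
  define h where "h y = y * (1 - y) ^ (l - 1) - x * (1 - real d * y) ^ l" for y
  have dd: "real d * (1 / real d) = 1" using d by simp
  have "1 / real d < 1" using d by simp
  moreover have "h (1 / real d) = 1 / real d * (1 - 1 / real d) ^ (l - 1)"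
    unfolding h_def dd using l by (simp add: zero_power)
  ultimately have h1: "0 < h (1 / real d)" using d by simp
  have h0: "h 0 < 0" using assms by (simp add: h_def)
  have "\<exists>y\<ge>0. y \<le> 1 / real d \<and> h y = 0"
    using h0 h1 by (intro IVT') (auto simp: h_def intro!: continuous_intros)
  then obtain y where y: "0 \<le> y" "y \<le> 1 / real d" "h y = 0" by blast
  then have yi: "y \<in> {0<..<1 / real d}" using h0 h1 by (auto simp: less_le)
  have "phi' d l y + ln x = 0" using y(3) phi'_eq_iff[OF yi assms] by (simp add: h_def)
  then have "is_beta_star_at d l x y" using yi deriv_Phi[OF yi] by (simp add: is_beta_star_at_def)
  moreover have "z = y" if z: "is_beta_star_at d l x z" for z
  proof -
    have zi: "z \<in> {0<..<1 / real d}" and "phi' d l z + ln x = 0"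
      using z deriv_Phi by (auto simp: is_beta_star_at_def)
    then have "phi' d l z = phi' d l y" using \<open>phi' d l y + ln x = 0\<close> by simp
    then show ?thesis using phi'_strict[of z y] phi'_strict[of y z] zi yi
      by (cases z y rule: linorder_cases) auto
  qed
  ultimately show ?thesis by blast
qed

lemma beta_star_at:
  assumes "x > 0"
  shows "beta_star_at d l x \<in> {0<..<1 / real d}" "phi' d l (beta_star_at d l x) = - ln x"
proof -
  have "is_beta_star_at d l x (beta_star_at d l x)"
    unfolding beta_star_at_def by (rule theI'[OF is_beta_star_at_ex1[OF assms]])
  then show "beta_star_at d l x \<in> {0<..<1 / real d}" "phi' d l (beta_star_at d l x) = - ln x"
    using deriv_Phi by (auto simp: is_beta_star_at_def)
qed

lemma is_beta_star_eq: "is_beta_star d l y \<longleftrightarrow> is_beta_star_at d l 1 y"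
  unfolding is_beta_star_def is_beta_star_at_def
  using phi'_eq_iff[of y 1] deriv_Phi[of y] by auto

lemma beta_star_eq: "beta_star d l = beta_star_at d l 1"
  unfolding beta_star_def beta_star_at_def is_beta_star_eq ..

lemma Phi_continuous: "continuous_on {0..1 / real d} (Phi d l)"
proof -
  let ?I = "{0..1 / real d}"
  have L: "continuous_on ?I (\<lambda>y. f y * ln (f y))"
    if "continuous_on ?I f" "\<And>y. y \<in> ?I \<Longrightarrow> 0 \<le> f y" for f :: "real \<Rightarrow> real"
    using that by (intro continuous_on_compose2[OF continuous_on_x_ln_x that(1)]) auto
  have c0: "continuous_on ?I (\<lambda>y. y * ln y)" by (rule L) (auto intro: continuous_on_id)
  have c1: "continuous_on ?I (\<lambda>y. (1 - y) * ln (1 - y))"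
  proof (rule L)
    show "0 \<le> 1 - y" if "y \<in> ?I" for y using that unit_interval[of y] by simp
  qed (intro continuous_on_diff continuous_on_const continuous_on_id)
  have c2: "continuous_on ?I (\<lambda>y. (1 - real d * y) * ln (1 - real d * y))"
  proof (rule L)
    show "0 \<le> 1 - real d * y" if "y \<in> ?I" for y using that unit_interval[of y] by simp
  qed (intro continuous_on_diff continuous_on_const continuous_on_id continuous_on_mult)
  have "continuous_on ?I (\<lambda>y. - (y * ln y) + (real l - 1) * ((1 - y) * ln (1 - y))
      - real l / real d * ((1 - real d * y) * ln (1 - real d * y)))"
    by (intro continuous_on_add continuous_on_diff continuous_on_minus continuous_on_mult continuous_on_const c0 c1 c2)
  then show ?thesis by (simp add: Phi_def[abs_def] mult.assoc)
qed

text \<open>With the quadratic added, the derivative is a difference of values of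
  \<open>phi' + d * y\<close>, which has a known sign on either side of \<beta>. The quadratic gap
  later serves as the Gaussian majorant in Laplace's method.\<close>

lemma Phi_le:
  assumes x: "x > 0" and y: "0 \<le> y" "y \<le> 1 / real d"
  defines "\<beta> \<equiv> beta_star_at d l x"
  shows "Phi d l y + y * ln x \<le> Phi d l \<beta> + \<beta> * ln x - real d / 2 * (y - \<beta>)\<^sup>2"
proof -
  note b = beta_star_at[OF x, folded \<beta>_def]
  define f where "f y = Phi d l y + y * ln x + real d / 2 * (y - \<beta>)\<^sup>2" for y
  have f': "(f has_real_derivative (phi' d l z + real d * z) - (phi' d l \<beta> + real d * \<beta>)) (at z)"
    if z: "z \<in> {0<..<1 / real d}" for z
  proof -
    have "((\<lambda>y. y * ln x) has_real_derivative ln x) (at z)"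
      using DERIV_cmult_right[OF DERIV_ident, of "ln x"] by simp
    moreover have "((\<lambda>y. real d / 2 * (y - \<beta>)\<^sup>2) has_real_derivative real d * (z - \<beta>)) (at z)"
      by (auto intro!: derivative_eq_intros)
    ultimately have "(f has_real_derivative phi' d l z + ln x + real d * (z - \<beta>)) (at z)"
      unfolding f_def[abs_def] by (intro DERIV_add Phi_deriv z)
    then show ?thesis using b(2) by (simp add: algebra_simps)
  qed
  have cf: "continuous_on {u..v} f" if "0 \<le> u" "v \<le> 1 / real d" for u v
    unfolding f_def[abs_def]
    by (intro continuous_on_add continuous_on_subset[OF Phi_continuous] continuous_intros) (use that in auto)
  have "f y \<le> f \<beta>"
  proof (cases "y \<le> \<beta>")
    case True
    show ?thesis
    proof (rule DERIV_nonneg_imp_increasing_open[OF True])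
      fix z assume z: "y < z" "z < \<beta>"
      then have "z \<in> {0<..<1 / real d}" using b y by auto
      moreover have "phi' d l \<beta> + real d * \<beta> \<le> phi' d l z + real d * z"
        using z y b by (intro phi'_decreasing) auto
      ultimately show "\<exists>v. (f has_real_derivative v) (at z) \<and> 0 \<le> v" using f' by (metis diff_ge_0_iff_ge)
    qed (use cf y b in auto)
  next
    case False
    show ?thesis
    proof (rule DERIV_nonpos_imp_decreasing_open[of \<beta> y])
      fix z assume z: "\<beta> < z" "z < y"
      then have "z \<in> {0<..<1 / real d}" using b y by auto
      moreover have "phi' d l z + real d * z \<le> phi' d l \<beta> + real d * \<beta>"
        using z y b by (intro phi'_decreasing) auto
      ultimately show "\<exists>v. (f has_real_derivative v) (at z) \<and> v \<le> 0" using f' by (metis diff_le_0_iff_le)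
    qed (use cf y b False in auto)
  qed
  then show ?thesis by (simp add: f_def)
qed

section \<open>The certified range of densities\<close>

lemma L_cert_range:
  assumes "l \<ge> 3"
  shows "L_cert d l \<in> {0<..<1 / real d}"
proof -
  have dl: "real d \<ge> 2" "real l \<ge> 3" using d assms by auto
  have "(real d - 1) * 2 \<le> (real d - 1) * (real l - 1)" using dl by (intro mult_left_mono) auto
  moreover have "real d < (real d - 1) * 2 + 1" using dl by simp
  ultimately have L1d: "real d < (real d - 1) * (real l - 1) + 1" by (meson add_le_cancel_right less_le_trans)
  have L1: "0 < L1 d l" "L1 d l < 1 / real d"
    unfolding L1_alt using L1d dl by (auto intro!: divide_strict_left_mono mult_pos_pos)
  have "1 < real d powr (real l / (real l - 1))" using dl by (intro gr_one_powr) auto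
  then have "0 < sqrt ((real d - 1) / (real d powr (real l / (real l - 1)) - 1))" using dl by simp
  then have "1 / real d * (1 - sqrt ((real d - 1) / (real d powr (real l / (real l - 1)) - 1))) < 1 / real d * 1"
    using dl by (intro mult_strict_left_mono) auto
  moreover have "L2 d l \<le> 1 / real d * (1 - sqrt ((real d - 1) / (real d powr (real l / (real l - 1)) - 1)))"
    unfolding L2_def by (rule Min_le) auto
  ultimately have "L2 d l < 1 / real d" by simp
  then show ?thesis using L1 by (simp add: L_cert_def)
qed

text \<open>\<open>phi'\<close> equals - ln x at the maximiser and is strictly decreasing, so
  comparing activities amounts to comparing maximisers in the same order.\<close>

lemma x_cert_iff:
  assumes "l \<ge> 3" "x > 0"
  shows "x \<le> x_cert d l \<longleftrightarrow> beta_star_at d l x \<le> L_cert d l"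
proof -
  note L = L_cert_range[OF assms(1)] and b = beta_star_at[OF assms(2)]
  have "x \<le> x_cert d l \<longleftrightarrow> ln x \<le> - phi' d l (L_cert d l)"
    unfolding x_cert_def deriv_Phi[OF L] using assms(2) by (metis exp_le_cancel_iff exp_ln)
  also have "\<dots> \<longleftrightarrow> phi' d l (L_cert d l) \<le> phi' d l (beta_star_at d l x)" using b by auto
  also have "\<dots> \<longleftrightarrow> beta_star_at d l x \<le> L_cert d l"
    using phi'_strict[of "beta_star_at d l x" "L_cert d l"] phi'_strict[of "L_cert d l" "beta_star_at d l x"] b L
    by (cases "beta_star_at d l x" "L_cert d l" rule: linorder_cases) auto
  finally show ?thesis .
qed

text \<open>For l = 2 the first alternative says (d - 1) * y \<le> 1 - y, that is d * y \<le> 1. For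
  l \<ge> 3, y \<le> \<open>L1\<close> is the first alternative rewritten, and the first entry of
  the minimum in \<open>L2\<close> implies the second one.\<close>

lemma second_moment_cond_cert:
  assumes y: "y \<in> {0<..<1 / real d}" and c: "l = 2 \<or> l \<ge> 3 \<and> y \<le> L_cert d l"
  shows "second_moment_cond (real d - 1) (l - 1) (y / (1 - y))"
proof -
  note yi = open_unit_interval[OF y]
  have jl: "real (l - 1) = real l - 1" using l by simp
  have k: "real d - 1 \<ge> 1" using d by simp
  consider "l = 2" | "l \<ge> 3" "y \<le> L1 d l" | "l \<ge> 3" "y \<le> L2 d l"
    using c by (auto simp: L_cert_def max_def split: if_splits)
  then show ?thesis
  proof cases
    case 1
    have "(real d - 1) * y \<le> 1 - y" using yi by (simp add: algebra_simps)
    then have "(real d - 1) * (y / (1 - y)) \<le> 1" using yi by (simp add: field_simps)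
    then show ?thesis using 1 by (simp add: second_moment_cond_def)
  next
    case 2
    have "0 \<le> (real d - 1) * (real l - 1)" using k l by (intro mult_nonneg_nonneg) auto
    then have "y * ((real d - 1) * (real l - 1) + 1) \<le> 1"
      using 2(2) unfolding L1_alt by (simp add: pos_le_divide_eq)
    then have "(real d - 1) * (real l - 1) * y \<le> 1 - y" by (simp add: algebra_simps)
    then have "(real d - 1) * (real l - 1) * (y / (1 - y)) \<le> 1" using yi by (simp add: pos_divide_le_eq)
    then show ?thesis unfolding second_moment_cond_def jl by simp
  next
    case 3
    \<comment> \<open>Since p^(l-1) = d, the goal is (1 - y) / u \<le> p, equivalently 1 + (d - 1) /
      u \<le> D = d * p. The square root in \<open>L2\<close> provides 1 + (d - 1) / u^2 \<le> D,
      which is stronger because u < 1.\<close>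
    define p where "p = real d powr (1 / (real l - 1))"
    define D where "D = real d powr (real l / (real l - 1))"
    define u where "u = 1 - real d * y"
    have l1: "real l - 1 > 0" using l by simp
    have "real l / (real l - 1) = 1 + 1 / (real l - 1)" using l1 by (simp add: field_simps)
    then have Dp: "D = real d * p" unfolding D_def p_def using d by (simp add: powr_add)
    have D1: "D > 1" unfolding D_def using l1 d l by (intro gr_one_powr) auto
    have u0: "0 < u" "u < 1" using yi d by (auto simp: u_def)
    have "y \<le> 1 / real d * (1 - sqrt ((real d - 1) / (D - 1)))"
    proof -
      have "L2 d l \<le> 1 / real d * (1 - sqrt ((real d - 1) / (D - 1)))"
        unfolding L2_def D_def by (rule Min_le) auto
      then show ?thesis using 3(2) by simp
    qed
    then have "real d * y \<le> 1 - sqrt ((real d - 1) / (D - 1))" using d by (simp add: field_simps)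
    then have "sqrt ((real d - 1) / (D - 1)) \<le> u" by (simp add: u_def)
    then have "(real d - 1) / (D - 1) \<le> u\<^sup>2" using sqrt_le_D by blast
    then have "(real d - 1) / u\<^sup>2 \<le> D - 1" using u0 D1 by (simp add: divide_le_eq mult.commute)
    moreover have "(real d - 1) / u \<le> (real d - 1) / u\<^sup>2"
      using u0 k by (intro divide_left_mono) (auto simp: power2_eq_square mult_le_one)
    ultimately have 1: "1 + (real d - 1) / u \<le> real d * p" using Dp by linarith
    have "1 / (1 - (real d - 1) * (y / (1 - y))) = (1 - y) / u"
    proof -
      have "1 - (real d - 1) * (y / (1 - y)) = u / (1 - y)" using yi by (simp add: u_def field_simps)
      then show ?thesis by simp
    qed
    also have "\<dots> = (1 + (real d - 1) / u) / real d"
    proof -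
      have "(1 - y) * real d = u + (real d - 1)" by (simp add: u_def algebra_simps)
      moreover have "x / v = (1 + e / v) / z" if "x * z = v + e" "v > 0" "z > 0" for x v e z :: real
        using that by (simp add: field_simps)
      ultimately show ?thesis using u0 d by simp
    qed
    also have "\<dots> \<le> p" using 1 d by (simp add: pos_divide_le_eq mult.commute)
    finally have "1 / (1 - (real d - 1) * (y / (1 - y))) \<le> p" .
    moreover have "0 \<le> 1 / (1 - (real d - 1) * (y / (1 - y)))"
      using \<open>1 / (1 - (real d - 1) * (y / (1 - y))) = (1 - y) / u\<close> yi u0 by simp
    ultimately have "(1 / (1 - (real d - 1) * (y / (1 - y)))) ^ (l - 1) \<le> p ^ (l - 1)" by (intro power_mono)
    also have "p ^ (l - 1) = p powr real (l - 1)" using d by (simp add: p_def powr_realpow)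
    also have "\<dots> = real d" unfolding p_def jl using l1 d by (simp add: powr_powr)
    finally show ?thesis by (simp add: second_moment_cond_def)
  qed
qed

end

section \<open>Exponential rates of the moments\<close>

definition xlnx :: "nat \<Rightarrow> real" where "xlnx n = real n * ln (real n)"

lemma fact_stirling_exp: "fact n = stirling_ratio n * exp (xlnx n - real n)"
proof -
  have "real n ^ n = exp (xlnx n)"
    by (cases "n = 0") (auto simp: xlnx_def exp_of_nat_mult)
  then show ?thesis using fact_stirling[of n] by (simp add: exp_diff)
qed

lemma xlnx_mult: "xlnx (a * b) = real b * (real a * ln (real a)) + real a * xlnx b"
proof (cases "a = 0 \<or> b = 0")
  case False
  then have "ln (real (a * b)) = ln (real a) + ln (real b)" by (simp add: ln_mult)
  then show ?thesis unfolding xlnx_def by (simp add: algebra_simps)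
qed (auto simp: xlnx_def)

text \<open>Splits off the multiple of m ln m, which cancels in every balanced quotient of
  factorials, from the entropy term of order m.\<close>

lemma xlnx_scale:
  assumes "m > 0" "real n = y * real m"
  shows "xlnx n = real m * (y * ln y) + y * xlnx m"
proof (cases "n = 0")
  case True
  then show ?thesis using assms by (auto simp: xlnx_def)
next
  case False
  then have "y > 0" using assms by (metis of_nat_0_less_iff not_gr_zero zero_less_mult_pos2)
  then have "ln (real n) = ln y + ln (real m)" using assms by (simp add: ln_mult)
  then show ?thesis unfolding xlnx_def by (simp add: assms(2) algebra_simps)
qed

lemma stirling_ratio_ge_1: "1 \<le> stirling_ratio n"
proof (cases "n = 0")
  case False
  have "1 \<le> sqrt (real n)" using False by simp
  then show ?thesis using stirling_ratio_bounds(1)[of n] False by linarith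
qed (simp add: stirling_ratio_def)

text \<open>The shift by 1 under the root covers n = 0.\<close>

lemma stirling_ratio_le: "stirling_ratio n \<le> 3 * sqrt (real n + 1)"
proof (cases "n = 0")
  case False
  have "sqrt (real n) \<le> sqrt (real n + 1)" by simp
  then show ?thesis using stirling_ratio_bounds(2)[of n] False by linarith
qed (simp add: stirling_ratio_def)

text \<open>The mean of Z_h is a quotient of factorials times d^(l*h); this is that quotient with
  every factorial replaced by its Stirling ratio.\<close>

definition Z_count_prefactor :: "nat \<Rightarrow> nat \<Rightarrow> nat \<Rightarrow> nat \<Rightarrow> real" where
  "Z_count_prefactor m d l h = stirling_ratio m * stirling_ratio (l * m div d) * stirling_ratio (l * m - l * h)
    / (stirling_ratio h * stirling_ratio (m - h) * stirling_ratio (l * m div d - l * h) * stirling_ratio (l * m))"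

text \<open>The identity is exact: all subexponential behaviour is kept in the prefactor, to be
  bounded crudely for the convergence in probability and sharply for the limit of the mean.\<close>

lemma expectation_Z_count_exp:
  assumes d: "d \<ge> 2" and l: "l \<ge> 2" and m: "m > 0" and dvd: "d dvd l * m" and h: "h \<le> m div d"
  shows "measure_pmf.expectation (random_hypergraph m d l) (\<lambda>P. real (Z_count m l h P))
    = Z_count_prefactor m d l h * exp (real m * Phi d l (real h / real m))"
proof -
  define n where "n = l * m div d"
  have nd: "d * n = l * m" unfolding n_def using dvd by simp
  have dh: "d * h \<le> m" using h d by (simp add: less_eq_div_iff_mult_less_eq mult.commute)
  have "h \<le> d * h" using d by (cases d) auto
  then have hm: "h \<le> m" using dh by (rule order_trans)
  have "d * (l * h) \<le> d * n" unfolding nd using dh by (simp add: mult.left_commute)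
  then have lhn: "l * h \<le> n" using d by simp
  have lhm: "l * h \<le> l * m" using hm by simp
  define y where "y = real h / real m"
  have y: "real h = y * real m" using m by (simp add: y_def)
  have rn: "real n = (real l / real d) * real m"
  proof -
    have "real d * real n = real l * real m" using nd by (metis of_nat_mult)
    then show ?thesis using d by (simp add: field_simps)
  qed
  have rd: "real (l * m) = real l * real m" "real (l * m - l * h) = (real l * (1 - y)) * real m"
    "real (m - h) = (1 - y) * real m"
    "real (n - l * h) = (real l / real d * (1 - real d * y)) * real m"
    using hm lhm lhn y rn d by (simp_all add: of_nat_diff algebra_simps)
  have ymul: "real d * y \<le> 1"
  proof -
    have "real d * real h \<le> real m" using dh by (metis of_nat_le_iff of_nat_mult)
    then show ?thesis using m by (simp add: y_def)
  qed
  have y0: "0 \<le> y" by (simp add: y_def)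
  have y1: "y < 1"
  proof -
    have "2 * y \<le> real d * y" using d y0 by (intro mult_right_mono) auto
    then show ?thesis using ymul by linarith
  qed
  have l0: "real l > 0" and d0: "real d > 0" using l d by auto
  have L: "(a * b) * ln (a * b) = a * b * ln a + a * (b * ln b)" if "a > 0" "b \<ge> 0" for a b :: real
    using that by (cases "b = 0") (auto simp: ln_mult algebra_simps)
  have L1: "real l * (1 - y) * ln (real l * (1 - y)) = real l * (1 - y) * ln (real l) + real l * ((1 - y) * ln (1 - y))"
    using l0 y1 by (intro L) auto
  have L2: "real l / real d * (1 - real d * y) * ln (real l / real d * (1 - real d * y))
      = real l / real d * (1 - real d * y) * ln (real l / real d) + real l / real d * ((1 - real d * y) * ln (1 - real d * y))"
    using l0 d0 ymul by (intro L) auto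
  have X: "xlnx n = real m * (real l / real d * ln (real l / real d)) + real l / real d * xlnx m"
      "xlnx (l * m) = real m * (real l * ln (real l)) + real l * xlnx m"
      "xlnx (l * m - l * h) = real m * (real l * (1 - y) * ln (real l) + real l * ((1 - y) * ln (1 - y))) + real l * (1 - y) * xlnx m"
      "xlnx (m - h) = real m * ((1 - y) * ln (1 - y)) + (1 - y) * xlnx m"
      "xlnx h = real m * (y * ln y) + y * xlnx m"
      "xlnx (n - l * h) = real m * (real l / real d * (1 - real d * y) * ln (real l / real d)
        + real l / real d * ((1 - real d * y) * ln (1 - real d * y))) + real l / real d * (1 - real d * y) * xlnx m"
    by (rule xlnx_scale[OF m rn] xlnx_scale[OF m rd(1)] xlnx_scale[OF m rd(3)] xlnx_scale[OF m y]
        | simp only: xlnx_scale[OF m rd(2)] xlnx_scale[OF m rd(4)] L1 L2)+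
  define lr where "lr = real l / real d"
  have lrd: "lr * real d = real l" using d0 by (simp add: lr_def)
  have lnlr: "ln lr = ln (real l) - ln (real d)" unfolding lr_def using l0 d0 by (simp add: ln_div)
  \<comment> \<open>The linear terms and all multiples of \<open>xlnx m\<close>, ln l and ln d
    cancel. The auxiliary identity \<open>alg\<close> is stated for free real variables so that only
    ring arithmetic is involved.\<close>
  have ex: "xlnx m + xlnx n + xlnx (l * m - l * h) + real (l * h) * ln (real d) - xlnx h - xlnx (m - h) - xlnx (n - l * h) - xlnx (l * m)
     - (real m + real n + real (l * m - l * h) - real h - real (m - h) - real (n - l * h) - real (l * m))
     = real m * Phi d l y"
  proof -
    have lh: "real (l * h) = real l * y * real m" using y by simp
    have alg: "xm + (M * (r * (a - b)) + r * xm) + (M * (L * (1 - y) * a + L * ((1 - y) * p)) + L * (1 - y) * xm)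
        + L * y * M * b - (M * (y * q) + y * xm) - (M * ((1 - y) * p) + (1 - y) * xm)
        - (M * (r * (1 - D * y) * (a - b) + r * ((1 - D * y) * t)) + r * (1 - D * y) * xm) - (M * (L * a) + L * xm)
        - (M + r * M + L * (1 - y) * M - y * M - (1 - y) * M - r * (1 - D * y) * M - L * M)
      = M * (- y * q + (L - 1) * (1 - y) * p - r * (1 - D * y) * t)"
      if "L = r * D" for xm M r a b L y p q D t :: real
      unfolding that by (simp add: algebra_simps)
    show ?thesis
      unfolding X lh y rn rd Phi_def lr_def[symmetric] lnlr
      by (rule alg) (simp add: lrd)
  qed
  have st: "stirling_ratio k \<noteq> 0" for k using stirling_ratio_pos[of k] by simp
  have "real (m choose h) * real (n choose (l * h)) * real d ^ (l * h) / real ((l * m) choose (l * h))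
     = fact m * fact n * fact (l * m - l * h) * real d ^ (l * h) / (fact h * fact (m - h) * fact (n - l * h) * fact (l * m))"
    using hm lhn lhm by (simp add: binomial_fact mult_ac)
  also have "\<dots> = fact m * fact n * fact (l * m - l * h) * exp (real (l * h) * ln (real d)) / (fact h * fact (m - h) * fact (n - l * h) * fact (l * m))"
    using d by (simp add: exp_of_nat_mult del: of_nat_mult)
  also have "fact m * fact n * fact (l * m - l * h) * exp (real (l * h) * ln (real d)) / (fact h * fact (m - h) * fact (n - l * h) * fact (l * m))
     = Z_count_prefactor m d l h * exp (real m * Phi d l y)"
    unfolding ex[symmetric] Z_count_prefactor_def n_def[symmetric] fact_stirling_exp exp_diff exp_add
    by (simp add: mult_ac)
  finally show ?thesis
    using expectation_Z_count[of d l m h] d dvd l hm unfolding n_def y_def by simp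
qed

text \<open>Each Stirling ratio lies between 1 and 3 * sqrt (l * m + 1). Four of them in the
  denominator give 81 = 3^4, three in the numerator give 27 = 3^3.\<close>

lemma Z_count_prefactor_bounds:
  assumes h: "h \<le> m" and l: "l \<ge> 1"
  shows "1 / (81 * (real (l * m) + 1) ^ 2) \<le> Z_count_prefactor m d l h"
    and "Z_count_prefactor m d l h \<le> 27 * (real (l * m) + 1) ^ 2"
proof -
  define r where "r = sqrt (real (l * m) + 1)"
  have r1: "1 \<le> r" by (simp add: r_def)
  have r4: "r ^ 4 = (real (l * m) + 1) ^ 2"
  proof -
    have "r ^ 4 = (r\<^sup>2)\<^sup>2" by (simp flip: power_mult)
    then show ?thesis by (simp add: r_def)
  qed
  have st: "stirling_ratio k \<le> 3 * r" if "k \<le> l * m" for k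
  proof -
    have "real k \<le> real (l * m)" using that by (simp only: of_nat_le_iff)
    then have "sqrt (real k + 1) \<le> r" unfolding r_def by simp
    then show ?thesis using stirling_ratio_le[of k] by linarith
  qed
  note ge = stirling_ratio_ge_1
  define Nu where "Nu = stirling_ratio m * stirling_ratio (l * m div d) * stirling_ratio (l * m - l * h)"
  define De where "De = stirling_ratio h * stirling_ratio (m - h) * stirling_ratio (l * m div d - l * h) * stirling_ratio (l * m)"
  have pre: "Z_count_prefactor m d l h = Nu / De" by (simp add: Z_count_prefactor_def Nu_def De_def)
  have ge2: "1 \<le> a * b" if "1 \<le> a" "1 \<le> b" for a b :: real
    using mult_mono[of 1 a 1 b] that by simp
  have Nu1: "1 \<le> Nu" and De1: "1 \<le> De" unfolding Nu_def De_def by (intro ge2 ge)+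
  have dv: "l * m div d \<le> l * m" by simp
  have ml: "m \<le> l * m" using l by (cases l) auto
  have le: "h \<le> l * m" "m - h \<le> l * m" "l * m div d - l * h \<le> l * m"
    using h ml dv by linarith+
  show "1 / (81 * (real (l * m) + 1) ^ 2) \<le> Z_count_prefactor m d l h"
  proof -
    have "De \<le> (3 * r) * (3 * r) * (3 * r) * (3 * r)"
      unfolding De_def using r1
      by (intro mult_mono st le le_refl mult_nonneg_nonneg less_imp_le[OF stirling_ratio_pos]) auto
    also have "\<dots> = 81 * r ^ 4" by (simp add: power4_eq_xxxx)
    finally have "De \<le> 81 * (real (l * m) + 1) ^ 2" unfolding r4 .
    then have "1 / (81 * (real (l * m) + 1) ^ 2) \<le> 1 / De" 
    proof (rule divide_left_mono)
      have "0 < (real (l * m) + 1) ^ 2" by (intro zero_less_power add_nonneg_pos) auto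
      then show "0 < (81 * (real (l * m) + 1)\<^sup>2) * De" using De1 by (intro mult_pos_pos) auto
    qed simp
    also have "\<dots> \<le> Nu / De" using Nu1 De1 by (intro divide_right_mono) auto
    finally show ?thesis unfolding pre .
  qed
  show "Z_count_prefactor m d l h \<le> 27 * (real (l * m) + 1) ^ 2"
  proof -
    have "Nu / De \<le> Nu / 1" using Nu1 De1 by (intro divide_left_mono) auto
    also have "Nu / 1 \<le> (3 * r) * (3 * r) * (3 * r) * r"
    proof -
      have "Nu \<le> (3 * r) * (3 * r) * (3 * r)"
        unfolding Nu_def using ml dv r1
        by (intro mult_mono st mult_nonneg_nonneg less_imp_le[OF stirling_ratio_pos]) auto
      also have "\<dots> \<le> (3 * r) * (3 * r) * (3 * r) * r"
        using r1 mult_left_mono[of 1 r "(3 * r) * (3 * r) * (3 * r)"] by simp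
      finally show ?thesis by simp
    qed
    also have "\<dots> = 27 * r ^ 4" by (simp add: power4_eq_xxxx)
    finally show ?thesis unfolding pre r4 .
  qed
qed

lemma multinomial_stirling_exp:
  assumes "real n = real a + 2 * real b + real c"
  shows "fact n / (fact a * fact b * fact b * fact c)
    = stirling_ratio n / (stirling_ratio a * stirling_ratio b * stirling_ratio b * stirling_ratio c)
      * exp (xlnx n - xlnx a - 2 * xlnx b - xlnx c)"
proof -
  have ex: "exp (z0 - z1 - z2 - z2 - z3) = exp z0 / (exp z1 * exp z2 * exp z2 * exp z3)" for z0 z1 z2 z3 :: real
    by (simp only: exp_diff divide_divide_eq_left mult.assoc)
  have "xlnx n - xlnx a - 2 * xlnx b - xlnx c
      = (xlnx n - real n) - (xlnx a - real a) - (xlnx b - real b) - (xlnx b - real b) - (xlnx c - real c)"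
    using assms by simp
  then have e: "exp (xlnx n - xlnx a - 2 * xlnx b - xlnx c) = exp (xlnx n - real n)
      / (exp (xlnx a - real a) * exp (xlnx b - real b) * exp (xlnx b - real b) * exp (xlnx c - real c))"
    by (simp only: ex)
  show ?thesis unfolding fact_stirling_exp e by (simp add: mult_ac)
qed

text \<open>The half-edge type of a pair is l times its hyperedge type, so its multinomial
  coefficient has exponent l * U when that of the hyperedges has exponent U. The difference accounts
  for the factor l - 1 in front of the entropy in \<open>overlap_exponent_le\<close>.\<close>

lemma expectation_Z_count_square_exp_le:
  assumes d: "d \<ge> 2" and l: "l \<ge> 2" and m: "m > 0" and dvd: "d dvd l * m"
    and h: "h > 0" "real h / real m < 1 / real d"
    and c: "second_moment_cond (real d - 1) (l - 1) (real h / real m / (1 - real h / real m))"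
  shows "measure_pmf.expectation (random_hypergraph m d l) (\<lambda>P. (real (Z_count m l h P))\<^sup>2)
    \<le> real (Suc h) * (243 * (real (l * m) + 1) ^ 3 * exp (2 * real m * Phi d l (real h / real m)))"
proof (rule expectation_Z_count_square_le)
  show "d > 0" "l > 0" "d dvd l * m" using d l dvd by auto
  define \<beta> where "\<beta> = real h / real m"
  have \<beta>: "0 < \<beta>" "\<beta> < 1 / real d" using h m by (auto simp: \<beta>_def)
  have dd: "1 / real d \<le> 1 / 2" using d by (intro divide_left_mono) auto
  have "2 * \<beta> < 1" using \<beta> dd by simp
  then have "2 * real h < real m" using m by (simp add: \<beta>_def field_simps)
  then have hm: "2 * h < m" by linarith
  define n where "n = l * m div d"
  have nd: "d * n = l * m" unfolding n_def using dvd by simp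
  have rn: "real n = real m * (real l / real d)"
  proof -
    have "real d * real n = real l * real m" using nd by (metis of_nat_mult)
    then show ?thesis using d by (simp add: field_simps)
  qed
  define r where "r = sqrt (real (l * m) + 1)"
  have r1: "1 \<le> r" by (simp add: r_def)
  define K where "K = 243 * (real (l * m) + 1) ^ 3 * exp (2 * real m * Phi d l \<beta>)"
  show "0 \<le> 243 * (real (l * m) + 1) ^ 3 * exp (2 * real m * Phi d l (real h / real m))" by simp
  fix i assume i: "i \<le> h"
  define j where "j = h - i"
  define g where "g = m - i - j - j"
  have ijm: "i + j + j \<le> m" using i hm by (simp add: j_def)
  define y where "y = real i / real m"
  have y: "0 \<le> y" "y \<le> \<beta>" using i m by (auto simp: y_def \<beta>_def divide_right_mono)
  have ry: "real j = (\<beta> - y) * real m" "real i = y * real m" "real g = (1 - 2 * \<beta> + y) * real m"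
    using i m ijm by (auto simp: j_def g_def y_def \<beta>_def of_nat_diff field_simps)
  obtain s w where sw: "0 \<le> s" "0 \<le> w" "s = 0 \<longleftrightarrow> y = \<beta>" "w = 0 \<longleftrightarrow> y = 0"
    and le: "(real l - 1) * (y * ln y + 2 * ((\<beta> - y) * ln (\<beta> - y)) + (1 - 2 * \<beta> + y) * ln (1 - 2 * \<beta> + y))
       + real l / real d * ln (1 + 2 * real d * s + real d * (real d - 1) * s\<^sup>2 + real d * w)
       - real l * (y * ln w + 2 * ((\<beta> - y) * ln s)) \<le> 2 * Phi d l \<beta>"
    using overlap_exponent_le[OF d l \<beta> c[folded \<beta>_def] y] by blast
  define Q where "Q = 1 + 2 * real d * s + real d * (real d - 1) * s\<^sup>2 + real d * w"
  have Q: "Q > 0"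
  proof -
    have "0 \<le> real d * (real d - 1)" using d by simp
    then show ?thesis unfolding Q_def using sw by (intro add_pos_nonneg) auto
  qed
  have pw: "x ^ (l * k) = exp (real (l * k) * ln x)" if "0 \<le> x" "x = 0 \<longrightarrow> k = 0" for x :: real and k
    using that by (cases "x = 0") (auto simp: exp_of_nat_mult simp del: of_nat_mult)
  have wi: "w ^ (l * i) = exp (real (l * i) * ln w)" using sw y m by (intro pw) (auto simp: y_def)
  have sj: "s ^ (l * j) = exp (real (l * j) * ln s)" using sw m by (intro pw) (auto simp: j_def y_def \<beta>_def)
  define W where "W = w ^ (l * i) * s ^ (l * j + l * j)"
  have W: "W = exp (real (l * i) * ln w + 2 * (real (l * j) * ln s))"
    unfolding W_def power_add wi sj by (simp add: exp_add[symmetric])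
  have Qn: "Q ^ n = exp (real n * ln Q)" using Q by (simp add: exp_of_nat_mult)
  let ?c = "real (card (pairs_of_type {1..m} i j j))"
  let ?C = "real (card (pairs_of_type {1..l * m} (l * i) (l * j) (l * j)))"
  have lij: "l * i + l * j + l * j \<le> l * m"
  proof -
    have "l * (i + j + j) \<le> l * m" using ijm by (rule mult_le_mono2)
    then show ?thesis by (simp add: distrib_left)
  qed
  have lg: "l * m - l * i - l * j - l * j = l * g" unfolding g_def by (simp add: diff_mult_distrib2 distrib_left)
  have cm: "?c = fact m / (fact i * fact j * fact j * fact g)"
    using card_pairs_of_type[of "{1..m}" i j j] ijm by (simp add: g_def)
  have cl: "?C = fact (l * m) / (fact (l * i) * fact (l * j) * fact (l * j) * fact (l * g))"
    using card_pairs_of_type[of "{1..l * m}" "l * i" "l * j" "l * j"] lij lg by simp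
  define U where "U = xlnx m - xlnx i - 2 * xlnx j - xlnx g"
  have sum_m: "real m = real i + 2 * real j + real g" using ijm by (simp add: g_def of_nat_diff)
  have c_exp: "?c = stirling_ratio m / (stirling_ratio i * stirling_ratio j * stirling_ratio j * stirling_ratio g) * exp U"
    unfolding cm U_def by (rule multinomial_stirling_exp) (rule sum_m)
  have C_exp: "?C = stirling_ratio (l * m) / (stirling_ratio (l * i) * stirling_ratio (l * j) * stirling_ratio (l * j) * stirling_ratio (l * g)) * exp (real l * U)"
  proof -
    define v where "v = real l * ln (real l)"
    have "xlnx (l * m) - xlnx (l * i) - 2 * xlnx (l * j) - xlnx (l * g)
        = v * (real m - real i - 2 * real j - real g) + real l * U"
      unfolding xlnx_mult v_def U_def by algebra
    also have "\<dots> = real l * U" using sum_m by simp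
    finally have e: "real l * U = xlnx (l * m) - xlnx (l * i) - 2 * xlnx (l * j) - xlnx (l * g)" by simp
    have "real (l * m) = real (l * i) + 2 * real (l * j) + real (l * g)"
      using sum_m by (simp add: distrib_left mult.left_commute)
    then show ?thesis unfolding cl e by (rule multinomial_stirling_exp)
  qed
  have U: "U = - real m * (y * ln y + 2 * ((\<beta> - y) * ln (\<beta> - y)) + (1 - 2 * \<beta> + y) * ln (1 - 2 * \<beta> + y))"
    unfolding U_def xlnx_scale[OF m ry(1)] xlnx_scale[OF m ry(2)] xlnx_scale[OF m ry(3)] by algebra
  have expo: "U + real n * ln Q \<le> 2 * real m * Phi d l \<beta> + (real l * U + (real (l * i) * ln w + 2 * (real (l * j) * ln s)))"
  proof -
    have "real m * ((real l - 1) * (y * ln y + 2 * ((\<beta> - y) * ln (\<beta> - y)) + (1 - 2 * \<beta> + y) * ln (1 - 2 * \<beta> + y))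
       + real l / real d * ln Q - real l * (y * ln w + 2 * ((\<beta> - y) * ln s))) \<le> real m * (2 * Phi d l \<beta>)"
      using le unfolding Q_def by (intro mult_left_mono) auto
    moreover have "real m * ((real l - 1) * (y * ln y + 2 * ((\<beta> - y) * ln (\<beta> - y)) + (1 - 2 * \<beta> + y) * ln (1 - 2 * \<beta> + y))
       + real l / real d * ln Q - real l * (y * ln w + 2 * ((\<beta> - y) * ln s)))
       = (U + real n * ln Q) - (real l * U + (real (l * i) * ln w + 2 * (real (l * j) * ln s)))"
      unfolding U rn of_nat_mult ry by algebra
    ultimately show ?thesis by simp
  qed
  define S1 where "S1 = stirling_ratio i * stirling_ratio j * stirling_ratio j * stirling_ratio g"
  define S2 where "S2 = stirling_ratio (l * i) * stirling_ratio (l * j) * stirling_ratio (l * j) * stirling_ratio (l * g)"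
  have ge2: "1 \<le> a * b" if "1 \<le> a" "1 \<le> b" for a b :: real
    using mult_mono[of 1 a 1 b] that by simp
  have S1: "1 \<le> S1" and S2p: "1 \<le> S2" unfolding S1_def S2_def by (intro ge2 stirling_ratio_ge_1)+
  have st: "stirling_ratio k \<le> 3 * r" if "k \<le> l * m" for k
  proof -
    have "real k \<le> real (l * m)" using that by (simp only: of_nat_le_iff)
    then have "sqrt (real k + 1) \<le> r" unfolding r_def by simp
    then show ?thesis using stirling_ratio_le[of k] by linarith
  qed
  have le5: "l * i \<le> l * m" "l * j \<le> l * m" "l * g \<le> l * m" "m \<le> l * m"
    using lij ijm l by (auto simp: g_def)
  \<comment> \<open>Five ratios give 243 = 3^5; r^5 is raised to r^6 = (l * m + 1)^3 to get an
    integral power.\<close>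
  have "S2 * stirling_ratio m \<le> (3 * r) * (3 * r) * (3 * r) * (3 * r) * (3 * r)"
    unfolding S2_def using r1
    by (intro mult_mono st le5 mult_nonneg_nonneg less_imp_le[OF stirling_ratio_pos]) auto
  also have "\<dots> = 243 * r ^ 5" by (simp add: eval_nat_numeral)
  also have "\<dots> \<le> 243 * r ^ 6" using r1 by (intro mult_left_mono power_increasing) auto
  also have "r ^ 6 = (real (l * m) + 1) ^ 3"
  proof -
    have "r ^ 6 = (r\<^sup>2) ^ 3" by (simp flip: power_mult)
    then show ?thesis by (simp add: r_def)
  qed
  finally have S: "S2 * stirling_ratio m \<le> 243 * (real (l * m) + 1) ^ 3" .
  have coef: "stirling_ratio m / S1 \<le> 243 * (real (l * m) + 1) ^ 3 * (stirling_ratio (l * m) / S2)"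
  proof -
    have "stirling_ratio m / S1 \<le> stirling_ratio m / 1"
      using S1 stirling_ratio_pos[of m] by (intro divide_left_mono) auto
    also have "\<dots> \<le> 243 * (real (l * m) + 1) ^ 3 * (1 / S2)"
      using S S2p by (simp add: field_simps)
    also have "\<dots> \<le> 243 * (real (l * m) + 1) ^ 3 * (stirling_ratio (l * m) / S2)"
      using S2p stirling_ratio_ge_1[of "l * m"] by (intro mult_left_mono divide_right_mono) auto
    finally show ?thesis .
  qed
  have "?c * Q ^ n = stirling_ratio m / S1 * exp (U + real n * ln Q)"
    unfolding c_exp S1_def Qn exp_add by simp
  also have "\<dots> \<le> (243 * (real (l * m) + 1) ^ 3 * (stirling_ratio (l * m) / S2))
      * exp (2 * real m * Phi d l \<beta> + (real l * U + (real (l * i) * ln w + 2 * (real (l * j) * ln s))))"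
    using coef expo S2p stirling_ratio_ge_1[of "l * m"] by (intro mult_mono) auto
  also have "\<dots> = K * (?C * W)"
    unfolding C_exp W K_def S2_def exp_add by simp
  finally have "?c * Q ^ n \<le> K * (?C * W)" .
  moreover have "0 < W" unfolding W by simp
  ultimately show "\<exists>s\<ge>0. \<exists>w\<ge>0. 0 < w ^ (l * i) * s ^ (l * (h - i) + l * (h - i)) \<and>
      real (card (pairs_of_type {1..m} i (h - i) (h - i))) *
        (1 + 2 * real d * s + real d * (real d - 1) * s\<^sup>2 + real d * w) ^ (l * m div d)
      \<le> 243 * (real (l * m) + 1) ^ 3 * exp (2 * real m * Phi d l (real h / real m)) *
        (real (card (pairs_of_type {1..l * m} (l * i) (l * (h - i)) (l * (h - i))))
        * (w ^ (l * i) * s ^ (l * (h - i) + l * (h - i))))"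
    using sw unfolding W_def Q_def K_def j_def n_def \<beta>_def by blast
qed

section \<open>Convergence in probability\<close>

text \<open>The Paley-Zygmund inequality at half the mean: values below \<mu> / 2 carry at most half
  of the total, and Cauchy-Schwarz on the remaining configurations bounds the other half by their
  number and the second moment.\<close>

lemma second_moment_lower_tail:
  fixes X :: "'a \<Rightarrow> real"
  assumes C: "finite C" "C \<noteq> {}" and X: "\<And>P. P \<in> C \<Longrightarrow> 0 \<le> X P"
  defines "\<mu> \<equiv> (\<Sum>P\<in>C. X P) / real (card C)"
  shows "\<mu>\<^sup>2 * real (card C) \<le> 4 * ((\<Sum>P\<in>C. (X P)\<^sup>2) / real (card C)) * real (card {P\<in>C. \<mu> / 2 \<le> X P})"
proof -
  define A where "A = {P\<in>C. \<mu> / 2 \<le> X P}"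
  define S where "S = (\<Sum>P\<in>C. (X P)\<^sup>2)"
  define N where "N = real (card C)"
  have N: "N > 0" using C by (simp add: N_def card_gt_0_iff)
  have finA: "finite A" using C by (simp add: A_def)
  have \<mu>0: "0 \<le> \<mu>" unfolding \<mu>_def using X by (simp add: sum_nonneg)
  have "\<mu> * N = (\<Sum>P\<in>C. X P)" using N by (simp add: \<mu>_def N_def)
  also have "\<dots> = (\<Sum>P\<in>A. X P) + (\<Sum>P\<in>C - A. X P)"
    using C by (subst sum.subset_diff[of A C]) (auto simp: A_def)
  also have "(\<Sum>P\<in>C - A. X P) \<le> (\<Sum>P\<in>C - A. \<mu> / 2)" by (intro sum_mono) (auto simp: A_def)
  also have "\<dots> \<le> N * (\<mu> / 2)"
  proof -
    have "real (card (C - A)) \<le> N" unfolding N_def using C card_mono[of C "C - A"] by auto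
    then show ?thesis using \<mu>0 by (simp add: mult_right_mono)
  qed
  finally have half: "N * \<mu> / 2 \<le> (\<Sum>P\<in>A. X P)" by (simp add: mult.commute)
  have "(N * \<mu> / 2)\<^sup>2 \<le> (\<Sum>P\<in>A. X P)\<^sup>2" using half N \<mu>0 by (intro power_mono) auto
  also have "\<dots> = (\<Sum>P\<in>A. 1 * X P)\<^sup>2" by simp
  also have "\<dots> \<le> (\<Sum>P\<in>A. 1\<^sup>2) * (\<Sum>P\<in>A. (X P)\<^sup>2)" by (rule Cauchy_Schwarz_ineq_sum)
  also have "\<dots> \<le> real (card A) * S"
    unfolding S_def using C finA by (auto intro!: mult_left_mono sum_mono2 simp: A_def)
  finally have "N\<^sup>2 * \<mu>\<^sup>2 \<le> 4 * (real (card A) * S)" by (simp add: power_mult_distrib power_divide)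
  then have "\<mu>\<^sup>2 * N \<le> 4 * (S / N) * real (card A)" using N by (simp add: field_simps power2_eq_square)
  then show ?thesis by (simp add: N_def S_def A_def)
qed

lemma card_configurations_orbit:
  assumes P0: "P0 \<in> configurations m d l"
  shows "real (card {P\<in>configurations m d l. Q P}) * fact (l * m)
    = real (card {\<sigma>. \<sigma> permutes {1..l * m} \<and> Q ((`) \<sigma> ` P0)}) * real (card (configurations m d l))"
proof -
  let ?C = "configurations m d l"
  have c0: "real (card ?C) \<noteq> 0" using P0 finite_configurations[of m d l] by auto
  have 1: "(\<Sum>P\<in>?C. if Q P then 1 else 0 :: real) = real (card {P\<in>?C. Q P})"
    using finite_configurations[of m d l] by (simp add: sum.If_cases Int_def)
  have "finite {\<sigma>. \<sigma> permutes {1..l * m}}" by (rule finite_permutations) simp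
  then have 2: "(\<Sum>\<sigma> | \<sigma> permutes {1..l * m}. if Q ((`) \<sigma> ` P0) then 1 else 0 :: real)
      = real (card {\<sigma>. \<sigma> permutes {1..l * m} \<and> Q ((`) \<sigma> ` P0)})"
    by (simp add: sum.If_cases Int_def)
  show ?thesis
    using average_configurations[OF P0, of "\<lambda>P. if Q P then 1 else 0"] c0 unfolding 1 2
    by (simp add: frac_eq_eq mult.commute)
qed

text \<open>Left composition of the relabelling permutation with a transposition acts on the
  configuration itself, so the Lipschitz condition on configurations is the one needed on
  permutations.\<close>

lemma configuration_concentration:
  fixes F :: "nat set set \<Rightarrow> real" and c \<epsilon> :: real
  assumes P0: "P0 \<in> configurations m d l"
    and lip: "\<And>P u v. P \<in> configurations m d l \<Longrightarrow> u \<in> {1..l * m} \<Longrightarrow> v \<in> {1..l * m} \<Longrightarrow>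
      \<bar>F ((`) (Transposition.transpose u v) ` P) - F P\<bar> \<le> c"
    and c: "0 < c" and \<epsilon>: "0 < \<epsilon>" "\<epsilon> \<le> 4 * c"
  defines "\<mu> \<equiv> (\<Sum>P\<in>configurations m d l. F P) / real (card (configurations m d l))"
  shows "real (card {P\<in>configurations m d l. F P \<ge> \<mu> + \<epsilon> * real (l * m)})
      \<le> real (card (configurations m d l)) * exp (- (\<epsilon> / (4 * c))\<^sup>2 * real (l * m))"
    and "real (card {P\<in>configurations m d l. F P \<le> \<mu> - \<epsilon> * real (l * m)})
      \<le> real (card (configurations m d l)) * exp (- (\<epsilon> / (4 * c))\<^sup>2 * real (l * m))"
proof -
  let ?C = "configurations m d l"
  define f where "f \<sigma> = F ((`) \<sigma> ` P0)" for \<sigma>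
  define A where "A = {1..l * m}"
  have cA: "card A = l * m" by (simp add: A_def)
  have \<mu>: "\<mu> = (\<Sum>\<sigma> | \<sigma> permutes A. f \<sigma>) / fact (card A)"
    unfolding \<mu>_def average_configurations[OF P0] f_def A_def by simp
  have finA: "finite A" by (simp add: A_def)
  have lipf: "\<bar>f (Transposition.transpose x y \<circ> \<sigma>) - f \<sigma>\<bar> \<le> c" if "\<sigma> permutes A" "x \<in> A" "y \<in> A" for \<sigma> x y
  proof -
    have "(`) (Transposition.transpose x y \<circ> \<sigma>) ` P0 = (`) (Transposition.transpose x y) ` (`) \<sigma> ` P0"
      by (simp add: image_image image_comp)
    moreover have "(`) \<sigma> ` P0 \<in> ?C" using that P0 by (intro configurations_act) (auto simp: A_def)
    ultimately show ?thesis using lip[of "(`) \<sigma> ` P0" x y] that by (simp add: f_def A_def)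
  qed
  note conc = permutation_concentration[OF finA lipf c \<epsilon>, folded \<mu>, unfolded cA]
  have fpos: "(0 :: real) < fact (l * m)" by simp
  have transfer: "real (card {P\<in>?C. Q P}) \<le> real (card ?C) * e"
    if "real (card {\<sigma>. \<sigma> permutes A \<and> Q ((`) \<sigma> ` P0)}) \<le> fact (l * m) * e" for Q e
  proof -
    have "real (card {P\<in>?C. Q P}) * fact (l * m) \<le> (fact (l * m) * e) * real (card ?C)"
      unfolding card_configurations_orbit[OF P0, of Q] using that unfolding A_def by (intro mult_right_mono) auto
    then have "real (card {P\<in>?C. Q P}) * fact (l * m) \<le> (real (card ?C) * e) * fact (l * m)" by (simp add: mult_ac)
    then show ?thesis using fpos by (rule mult_right_le_imp_le)
  qed
  show "real (card {P\<in>?C. F P \<ge> \<mu> + \<epsilon> * real (l * m)}) \<le> real (card ?C) * exp (- (\<epsilon> / (4 * c))\<^sup>2 * real (l * m))"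
    by (rule transfer) (use conc(1) in \<open>simp add: f_def\<close>)
  show "real (card {P\<in>?C. F P \<le> \<mu> - \<epsilon> * real (l * m)}) \<le> real (card ?C) * exp (- (\<epsilon> / (4 * c))\<^sup>2 * real (l * m))"
    by (rule transfer) (use conc(2) in \<open>simp add: f_def\<close>)
qed

lemma polynomial_exp_tendsto_0:
  fixes a b :: real
  assumes a: "0 < a" and b: "0 \<le> b"
  shows "(\<lambda>m. (b * real m + 1) ^ k * exp (- a * real m)) \<longlonglongrightarrow> 0"
proof -
  have lim: "filterlim (\<lambda>m. a * real m) at_top sequentially"
    using a by (intro filterlim_tendsto_pos_mult_at_top[OF tendsto_const] filterlim_real_sequentially)
  have "(\<lambda>m. (a * real m) ^ k / exp (a * real m)) \<longlonglongrightarrow> 0"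
    using filterlim_compose[OF tendsto_power_div_exp_0 lim] by simp
  then have "(\<lambda>m. ((b + 1) / a) ^ k * ((a * real m) ^ k / exp (a * real m))) \<longlonglongrightarrow> ((b + 1) / a) ^ k * 0"
    by (rule tendsto_mult_left)
  then have L: "(\<lambda>m. ((b + 1) / a) ^ k * ((a * real m) ^ k / exp (a * real m))) \<longlonglongrightarrow> 0" by simp
  show ?thesis
  proof (rule tendsto_sandwich[OF _ _ tendsto_const L])
    show "\<forall>\<^sub>F m in sequentially. 0 \<le> (b * real m + 1) ^ k * exp (- a * real m)" using b by simp
    show "\<forall>\<^sub>F m in sequentially. (b * real m + 1) ^ k * exp (- a * real m)
        \<le> ((b + 1) / a) ^ k * ((a * real m) ^ k / exp (a * real m))"
      using eventually_ge_at_top[of 1]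
    proof eventually_elim
      case (elim m)
      have "(b * real m + 1) ^ k \<le> ((b + 1) * real m) ^ k"
        using elim b by (intro power_mono) (auto simp: distrib_right)
      then have "(b * real m + 1) ^ k * exp (- a * real m) \<le> ((b + 1) * real m) ^ k * exp (- a * real m)"
        by (rule mult_right_mono) simp
      also have "\<dots> = ((b + 1) / a) ^ k * ((a * real m) ^ k / exp (a * real m))"
      proof -
        have "((b + 1) / a) ^ k * (a * real m) ^ k = ((b + 1) * real m) ^ k"
          using a by (simp flip: power_mult_distrib)
        then show ?thesis by (simp add: exp_minus divide_inverse flip: mult.assoc)
      qed
      finally show ?case .
    qed
  qed
qed

lemma eventually_admissible: "eventually Q (admissible d l) \<longleftrightarrow> (\<forall>\<^sub>F m in sequentially. d dvd l * m \<longrightarrow> Q m)"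
  by (simp add: admissible_def eventually_inf_principal)

lemma tendsto_admissible: "(f \<longlongrightarrow> c) sequentially \<Longrightarrow> (f \<longlongrightarrow> c) (admissible d l)"
  unfolding admissible_def by (rule tendsto_mono[OF inf_le1])

section \<open>Tail bounds for the weighted count\<close>

lemma sum_Z_weighted_le:
  assumes d: "d \<ge> 2" and l: "l \<ge> 2" and m: "m > 0" and dvd: "d dvd l * m" and x: "x > 0"
  defines "\<phi> \<equiv> Phi d l (beta_star_at d l x) + beta_star_at d l x * ln x"
  shows "(\<Sum>P\<in>configurations m d l. Z_weighted m d l x P)
    \<le> real (card (configurations m d l)) * (27 * (real (l * m) + 1) ^ 3 * exp (real m * \<phi>))"
proof -
  let ?C = "configurations m d l"
  define M where "M = real (l * m) + 1"
  have d0: "d > 0" using d by simp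
  have "?C \<noteq> {}" using d0 dvd by (rule configurations_nonempty)
  then have c0: "real (card ?C) > 0" using finite_configurations by (simp add: card_gt_0_iff)
  have E: "(\<Sum>P\<in>?C. real (Z_count m l h P)) \<le> real (card ?C) * (27 * M\<^sup>2 * exp (real m * Phi d l (real h / real m)))"
    and e: "exp (real m * Phi d l (real h / real m)) * x ^ h \<le> exp (real m * \<phi>)" if h: "h \<le> m div d" for h
  proof -
    have hm: "h \<le> m" using h by (meson div_le_dividend le_trans)
    have "(\<Sum>P\<in>?C. real (Z_count m l h P)) = real (card ?C) * (Z_count_prefactor m d l h * exp (real m * Phi d l (real h / real m)))"
      using expectation_Z_count_exp[OF d l m dvd h] c0 unfolding expectation_random_hypergraph[OF d0 dvd] by (simp add: field_simps)
    also have "\<dots> \<le> real (card ?C) * (27 * M\<^sup>2 * exp (real m * Phi d l (real h / real m)))"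
      unfolding M_def using Z_count_prefactor_bounds(2)[OF hm] l by (intro mult_left_mono mult_right_mono) auto
    finally show "(\<Sum>P\<in>?C. real (Z_count m l h P)) \<le> real (card ?C) * (27 * M\<^sup>2 * exp (real m * Phi d l (real h / real m)))" .
    have "h * d \<le> m" using h d0 by (simp add: less_eq_div_iff_mult_less_eq)
    then have "real h * real d \<le> real m" by (metis of_nat_le_iff of_nat_mult)
    then have "real h / real m \<le> 1 / real d" using m d0 by (simp add: field_simps)
    then have "Phi d l (real h / real m) + real h / real m * ln x \<le> \<phi> - real d / 2 * (real h / real m - beta_star_at d l x)\<^sup>2"
      unfolding \<phi>_def using Phi_le[OF d l x, of "real h / real m"] by simp
    moreover have "0 \<le> real d / 2 * (real h / real m - beta_star_at d l x)\<^sup>2" by simp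
    ultimately have "Phi d l (real h / real m) + real h / real m * ln x \<le> \<phi>" by linarith
    then have "real m * (Phi d l (real h / real m) + real h / real m * ln x) \<le> real m * \<phi>"
      by (rule mult_left_mono) simp
    then have "real m * Phi d l (real h / real m) + real h * ln x \<le> real m * \<phi>"
      using m by (simp add: distrib_left)
    moreover have "x ^ h = exp (real h * ln x)" using x by (simp add: exp_of_nat_mult)
    ultimately show "exp (real m * Phi d l (real h / real m)) * x ^ h \<le> exp (real m * \<phi>)"
      by (simp flip: exp_add)
  qed
  have "(\<Sum>P\<in>?C. Z_weighted m d l x P) = (\<Sum>h = 0..m div d. (\<Sum>P\<in>?C. real (Z_count m l h P)) * x ^ h)"
    unfolding Z_weighted_def by (subst sum.swap) (simp add: sum_distrib_right)
  also have "\<dots> \<le> (\<Sum>h = 0..m div d. real (card ?C) * (27 * M\<^sup>2 * exp (real m * \<phi>)))"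
  proof (rule sum_mono)
    fix h assume "h \<in> {0..m div d}"
    then have h: "h \<le> m div d" by simp
    have "(\<Sum>P\<in>?C. real (Z_count m l h P)) * x ^ h
        \<le> real (card ?C) * (27 * M\<^sup>2 * exp (real m * Phi d l (real h / real m))) * x ^ h"
      using E[OF h] x by (intro mult_right_mono) auto
    also have "\<dots> = real (card ?C) * (27 * M\<^sup>2 * (exp (real m * Phi d l (real h / real m)) * x ^ h))" by simp
    also have "\<dots> \<le> real (card ?C) * (27 * M\<^sup>2 * exp (real m * \<phi>))"
      using e[OF h] by (intro mult_left_mono) auto
    finally show "(\<Sum>P\<in>?C. real (Z_count m l h P)) * x ^ h \<le> real (card ?C) * (27 * M\<^sup>2 * exp (real m * \<phi>))" .
  qed
  also have "\<dots> = real (Suc (m div d)) * (real (card ?C) * (27 * M\<^sup>2 * exp (real m * \<phi>)))" by simp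
  also have "\<dots> \<le> M * (real (card ?C) * (27 * M\<^sup>2 * exp (real m * \<phi>)))"
  proof (rule mult_right_mono)
    have "m div d \<le> m" by simp
    also have "m \<le> l * m" using l by simp
    finally have "real (Suc (m div d)) \<le> real (Suc (l * m))" by (simp only: of_nat_le_iff Suc_le_mono)
    then show "real (Suc (m div d)) \<le> M" by (simp add: M_def)
  qed simp
  finally show ?thesis by (simp add: M_def power2_eq_square power3_eq_cube mult_ac)
qed

lemma Z_weighted_upper_tail:
  assumes d: "d \<ge> 2" and l: "l \<ge> 2" and m: "m > 0" and dvd: "d dvd l * m" and x: "x > 0"
  defines "\<phi> \<equiv> Phi d l (beta_star_at d l x) + beta_star_at d l x * ln x"
  shows "real (card {P\<in>configurations m d l. ln (Z_weighted m d l x P) > real m * (\<phi> + \<epsilon>)})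
    \<le> real (card (configurations m d l)) * (27 * (real (l * m) + 1) ^ 3 * exp (- \<epsilon> * real m))"
proof -
  let ?C = "configurations m d l"
  define A where "A = {P\<in>?C. ln (Z_weighted m d l x P) > real m * (\<phi> + \<epsilon>)}"
  have Z1: "1 \<le> Z_weighted m d l x P" if "P \<in> ?C" for P
    using Z_weighted_pos[OF that] d l x by simp
  have "real (card A) * exp (real m * (\<phi> + \<epsilon>)) = (\<Sum>P\<in>A. exp (real m * (\<phi> + \<epsilon>)))" by simp
  also have "\<dots> \<le> (\<Sum>P\<in>A. Z_weighted m d l x P)"
  proof (rule sum_mono)
    fix P assume P: "P \<in> A"
    then have "real m * (\<phi> + \<epsilon>) \<le> ln (Z_weighted m d l x P)" by (simp add: A_def)
    moreover have "0 < Z_weighted m d l x P" using Z1[of P] P by (auto simp: A_def)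
    ultimately show "exp (real m * (\<phi> + \<epsilon>)) \<le> Z_weighted m d l x P" by (simp add: ln_ge_iff)
  qed
  also have "\<dots> \<le> (\<Sum>P\<in>?C. Z_weighted m d l x P)"
  proof (rule sum_mono2)
    show "0 \<le> Z_weighted m d l x P" if "P \<in> ?C - A" for P using Z1[of P] that by auto
  qed (auto simp: A_def finite_configurations)
  also have "\<dots> \<le> real (card ?C) * (27 * (real (l * m) + 1) ^ 3 * exp (real m * \<phi>))"
    unfolding \<phi>_def by (rule sum_Z_weighted_le[OF d l m dvd x])
  also have "exp (real m * \<phi>) = exp (- \<epsilon> * real m) * exp (real m * (\<phi> + \<epsilon>))"
    by (simp add: exp_add[symmetric] algebra_simps)
  finally have "real (card A) * exp (real m * (\<phi> + \<epsilon>))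
      \<le> (real (card ?C) * (27 * (real (l * m) + 1) ^ 3 * exp (- \<epsilon> * real m))) * exp (real m * (\<phi> + \<epsilon>))"
    by (simp add: mult.assoc)
  then show ?thesis unfolding A_def[symmetric] by (rule mult_right_le_imp_le) simp
qed

text \<open>The single term Z_h * x^h bounds the weighted count from below. Half of the bound 1 /
  (81 * M^2) on the prefactor gives 162 = 2 * 81; Paley-Zygmund gives 6377292 = 4 * 243 * 81^2 and
  M^8 = M^4 * (M^2)^2, where M = l * m + 1.\<close>

lemma Z_weighted_moderate_lower_tail:
  assumes d: "d \<ge> 2" and l: "l \<ge> 2" and m: "m > 0" and dvd: "d dvd l * m" and x: "x > 0"
    and h: "h > 0" "real h / real m < 1 / real d"
    and c: "second_moment_cond (real d - 1) (l - 1) (real h / real m / (1 - real h / real m))"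
  shows "real (card (configurations m d l)) \<le> 6377292 * (real (l * m) + 1) ^ 8 *
    real (card {P\<in>configurations m d l. real m * (Phi d l (real h / real m) + real h / real m * ln x)
      - ln (162 * (real (l * m) + 1) ^ 2) \<le> ln (Z_weighted m d l x P)})"
proof -
  let ?C = "configurations m d l"
  define M where "M = real (l * m) + 1"
  have M1: "1 \<le> M" by (simp add: M_def)
  have d0: "d > 0" and l0: "l > 0" using d l by auto
  have "?C \<noteq> {}" using d0 dvd by (rule configurations_nonempty)
  have fC: "finite ?C" by (rule finite_configurations)
  define e where "e = exp (real m * Phi d l (real h / real m))"
  have e: "e > 0" by (simp add: e_def)
  have "real h * real d < real m" using h(2) m d0 by (simp add: field_simps)
  then have "h * d < m" by (metis of_nat_less_iff of_nat_mult)
  then have hd: "h \<le> m div d" using d0 by (simp add: less_eq_div_iff_mult_less_eq)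
  then have hm: "h \<le> m" by (meson div_le_dividend le_trans)
  define X where "X P = real (Z_count m l h P)" for P
  define \<mu> where "\<mu> = (\<Sum>P\<in>?C. X P) / real (card ?C)"
  have \<mu>: "\<mu> = Z_count_prefactor m d l h * e"
    using expectation_Z_count_exp[OF d l m dvd hd] unfolding expectation_random_hypergraph[OF d0 dvd] X_def \<mu>_def e_def .
  have \<mu>ge: "1 / (81 * M\<^sup>2) * e \<le> \<mu>"
    unfolding \<mu> M_def using Z_count_prefactor_bounds(1)[OF hm] l e by (intro mult_right_mono) auto
  have S: "(\<Sum>P\<in>?C. (X P)\<^sup>2) / real (card ?C) \<le> 243 * M ^ 4 * e\<^sup>2"
  proof -
    have "(\<Sum>P\<in>?C. (X P)\<^sup>2) / real (card ?C) \<le> real (Suc h) * (243 * M ^ 3 * exp (2 * real m * Phi d l (real h / real m)))"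
      using expectation_Z_count_square_exp_le[OF d l m dvd h c] unfolding expectation_random_hypergraph[OF d0 dvd] X_def M_def .
    also have "exp (2 * real m * Phi d l (real h / real m)) = e\<^sup>2"
      by (simp add: e_def power2_eq_square exp_add[symmetric])
    also have "real (Suc h) * (243 * M ^ 3 * e\<^sup>2) \<le> M * (243 * M ^ 3 * e\<^sup>2)"
    proof (rule mult_right_mono)
      have "m \<le> l * m" using l by simp
      then have "real h \<le> real (l * m)" using hm by (simp only: of_nat_le_iff)
      then show "real (Suc h) \<le> M" unfolding M_def by simp
    qed (use M1 in simp)
    finally show ?thesis by (simp add: power4_eq_xxxx power3_eq_cube mult_ac)
  qed
  define B where "B = {P\<in>?C. \<mu> / 2 \<le> X P}"
  have "\<mu>\<^sup>2 * real (card ?C) \<le> 4 * ((\<Sum>P\<in>?C. (X P)\<^sup>2) / real (card ?C)) * real (card B)"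
    unfolding \<mu>_def B_def by (rule second_moment_lower_tail[OF fC \<open>?C \<noteq> {}\<close>]) (simp add: X_def)
  also have "\<dots> \<le> 4 * (243 * M ^ 4 * e\<^sup>2) * real (card B)"
    using S by (intro mult_right_mono mult_left_mono) auto
  finally have 1: "\<mu>\<^sup>2 * real (card ?C) \<le> 4 * (243 * M ^ 4 * e\<^sup>2) * real (card B)" .
  have "(1 / (81 * M\<^sup>2) * e)\<^sup>2 \<le> \<mu>\<^sup>2" using \<mu>ge e M1 by (intro power_mono) auto
  then have "(1 / (81 * M\<^sup>2) * e)\<^sup>2 * real (card ?C) \<le> 4 * (243 * M ^ 4 * e\<^sup>2) * real (card B)"
    using 1 mult_right_mono[of "(1 / (81 * M\<^sup>2) * e)\<^sup>2" "\<mu>\<^sup>2" "real (card ?C)"] by linarith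
  then have "(81 * M\<^sup>2)\<^sup>2 / e\<^sup>2 * ((1 / (81 * M\<^sup>2) * e)\<^sup>2 * real (card ?C)) \<le> (81 * M\<^sup>2)\<^sup>2 / e\<^sup>2 * (4 * (243 * M ^ 4 * e\<^sup>2) * real (card B))"
    by (rule mult_left_mono) simp
  moreover have "(81 * M\<^sup>2)\<^sup>2 / e\<^sup>2 * ((1 / (81 * M\<^sup>2) * e)\<^sup>2 * z) = z" for z
    using e M1 by (simp add: power_mult_distrib power_divide)
  moreover have "(81 * M\<^sup>2)\<^sup>2 / e\<^sup>2 * (4 * (243 * M ^ 4 * e\<^sup>2) * z) = 6377292 * M ^ 8 * z" for z
  proof -
    have "(81 * M\<^sup>2)\<^sup>2 / e\<^sup>2 * (4 * (243 * M ^ 4 * e\<^sup>2) * z) = 6561 * (M\<^sup>2)\<^sup>2 * (4 * (243 * M ^ 4) * z)"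
      using e by (simp add: power_mult_distrib)
    also have "\<dots> = 6377292 * ((M\<^sup>2)\<^sup>2 * M ^ 4) * z" by simp
    also have "(M\<^sup>2)\<^sup>2 * M ^ 4 = M ^ 8" by (simp flip: power_mult power_add)
    finally show ?thesis .
  qed
  ultimately have 2: "real (card ?C) \<le> 6377292 * M ^ 8 * real (card B)" by simp
  have "B \<subseteq> {P\<in>?C. real m * (Phi d l (real h / real m) + real h / real m * ln x) - ln (162 * M\<^sup>2) \<le> ln (Z_weighted m d l x P)}"
  proof
    fix P assume P: "P \<in> B"
    have xh: "x ^ h = exp (real h * ln x)" using x by (simp add: exp_of_nat_mult)
    have "e * x ^ h / (162 * M\<^sup>2) = 1 / (81 * M\<^sup>2) * e / 2 * x ^ h" by simp
    also have "\<dots> \<le> \<mu> / 2 * x ^ h" using \<mu>ge x by (intro mult_right_mono divide_right_mono) auto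
    also have "\<dots> \<le> X P * x ^ h" using P x by (intro mult_right_mono) (auto simp: B_def)
    also have "\<dots> \<le> Z_weighted m d l x P" unfolding X_def using x hd by (intro Z_weighted_ge) auto
    finally have le: "e * x ^ h / (162 * M\<^sup>2) \<le> Z_weighted m d l x P" .
    have pos: "0 < e * x ^ h / (162 * M\<^sup>2)" using e x M1 by simp
    have "ln (e * x ^ h / (162 * M\<^sup>2)) = ln (e * x ^ h) - ln (162 * M\<^sup>2)"
      using e x M1 by (subst ln_div) auto
    also have "ln (e * x ^ h) = real m * Phi d l (real h / real m) + real h * ln x"
      unfolding e_def xh by (simp flip: exp_add)
    also have "\<dots> = real m * (Phi d l (real h / real m) + real h / real m * ln x)"
      using m by (simp add: distrib_left)
    finally have "real m * (Phi d l (real h / real m) + real h / real m * ln x) - ln (162 * M\<^sup>2) = ln (e * x ^ h / (162 * M\<^sup>2))" by simp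
    also have "\<dots> \<le> ln (Z_weighted m d l x P)" using le pos by simp
    finally show "P \<in> {P\<in>?C. real m * (Phi d l (real h / real m) + real h / real m * ln x) - ln (162 * M\<^sup>2) \<le> ln (Z_weighted m d l x P)}"
      using P by (simp add: B_def)
  qed
  then have "card B \<le> card {P\<in>?C. real m * (Phi d l (real h / real m) + real h / real m * ln x) - ln (162 * M\<^sup>2) \<le> ln (Z_weighted m d l x P)}"
    using fC by (intro card_mono) auto
  then have "6377292 * M ^ 8 * real (card B) \<le> 6377292 * M ^ 8 * real (card {P\<in>?C. real m * (Phi d l (real h / real m) + real h / real m * ln x) - ln (162 * M\<^sup>2) \<le> ln (Z_weighted m d l x P)})"
    using M1 by (intro mult_left_mono) auto
  then show ?thesis using 2 unfolding M_def by linarith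
qed

lemma floor_ratio_tendsto:
  fixes \<beta> :: real assumes "0 \<le> \<beta>"
  shows "(\<lambda>m. real (nat \<lfloor>\<beta> * real m\<rfloor>) / real m) \<longlonglongrightarrow> \<beta>"
proof (rule tendsto_sandwich)
  have fl: "real (nat \<lfloor>\<beta> * real m\<rfloor>) = of_int \<lfloor>\<beta> * real m\<rfloor>" for m
    using assms by (intro of_nat_nat) simp
  show "\<forall>\<^sub>F m in sequentially. \<beta> - 1 / real m \<le> real (nat \<lfloor>\<beta> * real m\<rfloor>) / real m"
    using eventually_gt_at_top[of 0]
  proof eventually_elim
    case (elim m)
    have "\<beta> * real m - 1 \<le> of_int \<lfloor>\<beta> * real m\<rfloor>" by linarith
    then have "(\<beta> * real m - 1) / real m \<le> of_int \<lfloor>\<beta> * real m\<rfloor> / real m" by (rule divide_right_mono) simp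
    then show ?case using elim unfolding fl by (simp add: diff_divide_distrib)
  qed
  show "\<forall>\<^sub>F m in sequentially. real (nat \<lfloor>\<beta> * real m\<rfloor>) / real m \<le> \<beta>"
    using eventually_gt_at_top[of 0]
  proof eventually_elim
    case (elim m)
    then show ?case unfolding fl by (simp add: divide_le_eq)
  qed
  have "(\<lambda>m. \<beta> - 1 / real m) \<longlonglongrightarrow> \<beta> - 0" by (intro tendsto_intros lim_1_over_n)
  then show "(\<lambda>m. \<beta> - 1 / real m) \<longlonglongrightarrow> \<beta>" by simp
qed simp

lemma ln_Z_weighted_tendsto:
  assumes d: "d \<ge> 2" and l: "l \<ge> 2" and x: "x > 0"
    and c: "l = 2 \<or> l \<ge> 3 \<and> beta_star_at d l x \<le> L_cert d l"
  defines "\<phi> \<equiv> Phi d l (beta_star_at d l x) + beta_star_at d l x * ln x"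
  shows "tendsto_in_prob (\<lambda>m. random_hypergraph m d l) (\<lambda>m P. 1 / real m * ln (Z_weighted m d l x P)) \<phi> (admissible d l)"
  unfolding tendsto_in_prob_def
proof (intro allI impI)
  fix \<epsilon> :: real assume \<epsilon>: "\<epsilon> > 0"
  have d0: "d > 0" and l0: "l > 0" using d l by auto
  define \<beta> where "\<beta> = beta_star_at d l x"
  note b = beta_star_at[OF d l x, folded \<beta>_def]
  define cc where "cc = 2 * ln (1 + x)"
  have cc: "cc > 0" using x by (simp add: cc_def)
  \<comment> \<open>The factor l converts deviations per half-edge into deviations per hyperedge;
    the cap 4 * cc is the range in which the concentration bound is available.\<close>
  define \<eta> where "\<eta> = min (\<epsilon> / (3 * real l)) (4 * cc)"
  have \<eta>: "0 < \<eta>" "\<eta> \<le> 4 * cc" "\<eta> * real l \<le> \<epsilon> / 3"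
  proof -
    show "0 < \<eta>" "\<eta> \<le> 4 * cc" using \<epsilon> cc l0 by (auto simp: \<eta>_def)
    have "\<eta> * real l \<le> \<epsilon> / (3 * real l) * real l" by (intro mult_right_mono) (auto simp: \<eta>_def)
    then show "\<eta> * real l \<le> \<epsilon> / 3" using l0 by simp
  qed
  define \<kappa> where "\<kappa> = (\<eta> / (4 * cc))\<^sup>2"
  have \<kappa>: "\<kappa> > 0" using \<eta> cc by (simp add: \<kappa>_def)
  \<comment> \<open>Rounding down keeps the density at most \<beta>, so it inherits the bound by
    \<open>L_cert\<close>.\<close>
  define hh where "hh m = nat \<lfloor>\<beta> * real m\<rfloor>" for m :: nat
  define y where "y m = real (hh m) / real m" for m
  have ylim: "y \<longlonglongrightarrow> \<beta>" unfolding y_def hh_def using b by (intro floor_ratio_tendsto) simp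
  have yle: "y m \<le> \<beta>" for m
  proof (cases "m = 0")
    case False
    have "real (hh m) \<le> \<beta> * real m" unfolding hh_def using b by (subst of_nat_nat) auto
    then show ?thesis using False by (simp add: y_def divide_le_eq)
  qed (use b in \<open>simp add: y_def\<close>)
  have "(\<lambda>m. Phi d l (y m) + y m * ln x) \<longlonglongrightarrow> Phi d l \<beta> + \<beta> * ln x"
  proof (intro tendsto_add tendsto_mult ylim tendsto_const)
    show "(\<lambda>m. Phi d l (y m)) \<longlonglongrightarrow> Phi d l \<beta>"
      by (rule isCont_tendsto_compose[OF DERIV_isCont[OF Phi_deriv[OF d l b(1)]] ylim])
  qed
  \<comment> \<open>A loss of \<epsilon> / 3 is allowed in the lower bound on the mean: \<epsilon> /
    6 for the rounding of \<beta> and \<epsilon> / 6 for the logarithm of the polynomial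
    factor.\<close>
  then have "\<forall>\<^sub>F m in sequentially. \<phi> - \<epsilon> / 6 < Phi d l (y m) + y m * ln x"
    unfolding \<phi>_def \<beta>_def[symmetric] using \<epsilon> by (intro order_tendstoD) auto
  moreover have "\<forall>\<^sub>F m in sequentially. 0 < y m" using ylim b by (intro order_tendstoD) auto
  moreover have "\<forall>\<^sub>F m in sequentially. (real l * real m + 1) ^ 2 * exp (- (\<epsilon> / 6) * real m) < 1 / 162"
    using polynomial_exp_tendsto_0[of "\<epsilon> / 6" "real l" 2] \<epsilon> by (intro order_tendstoD) auto
  \<comment> \<open>From here on the concentration tail is smaller than the inverse polynomial
    probability supplied by the second moment; this produces the contradiction if the mean is too
    small.\<close>
  moreover have "\<forall>\<^sub>F m in sequentially. (real l * real m + 1) ^ 8 * exp (- (\<kappa> * real l) * real m) < 1 / 6377292"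
    using polynomial_exp_tendsto_0[of "\<kappa> * real l" "real l" 8] \<kappa> l0 by (intro order_tendstoD) auto
  \<comment> \<open>The power with exponent 0 puts the second summand into the form of
    \<open>polynomial_exp_tendsto_0\<close>.\<close>
  ultimately have ev: "\<forall>\<^sub>F m in sequentially. d dvd l * m \<longrightarrow>
      measure_pmf.prob (random_hypergraph m d l) {P. \<bar>1 / real m * ln (Z_weighted m d l x P) - \<phi>\<bar> > \<epsilon>}
      \<le> 27 * ((real l * real m + 1) ^ 3 * exp (- \<epsilon> * real m)) + (real l * real m + 1) ^ 0 * exp (- (\<kappa> * real l) * real m)"
    using eventually_gt_at_top[of 0]
  proof eventually_elim
    case (elim m)
    show ?case
    proof
      assume dvd: "d dvd l * m"
      let ?C = "configurations m d l"
      have m: "m > 0" using elim by simp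
      define M where "M = real l * real m + 1"
      have Mlm: "real (l * m) + 1 = M" by (simp add: M_def)
      have M1: "1 \<le> M" by (simp add: M_def)
      have C: "?C \<noteq> {}" using d0 dvd by (rule configurations_nonempty)
      then obtain P0 where P0: "P0 \<in> ?C" by blast
      have c0: "real (card ?C) > 0" using C finite_configurations by (simp add: card_gt_0_iff)
      define F where "F P = ln (Z_weighted m d l x P)" for P
      define \<mu> where "\<mu> = (\<Sum>P\<in>?C. F P) / real (card ?C)"
      have lip: "\<bar>F ((`) (Transposition.transpose u v) ` P) - F P\<bar> \<le> cc"
        if "P \<in> ?C" "u \<in> {1..l * m}" "v \<in> {1..l * m}" for P u v
        unfolding F_def cc_def by (rule ln_Z_weighted_lipschitz[OF that(1) l0 d0 x that(2,3)])
      note conc = configuration_concentration[OF P0 lip cc \<eta>(1,2), folded \<mu>_def \<kappa>_def]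
      have yd: "y m < 1 / real d" using yle[of m] b by auto
      have h0: "hh m > 0" using elim(2) by (auto simp: y_def intro: Nat.gr0I)
      have sm: "second_moment_cond (real d - 1) (l - 1) (y m / (1 - y m))"
        using second_moment_cond_cert[OF d l, of "y m"] elim(2) yd c yle[of m] unfolding \<beta>_def by auto
      have lower: "real (card ?C) \<le> 6377292 * M ^ 8 * real (card {P\<in>?C. real m * (Phi d l (y m) + y m * ln x) - ln (162 * M ^ 2) \<le> F P})"
        using Z_weighted_moderate_lower_tail[OF d l m dvd x h0 yd[unfolded y_def] sm[unfolded y_def]]
        unfolding F_def y_def Mlm .
      have "162 * M ^ 2 * exp (- (\<epsilon> / 6) * real m) \<le> 1" using elim(3) unfolding M_def by simp
      then have "162 * M ^ 2 \<le> exp (\<epsilon> / 6 * real m)" by (simp add: exp_minus field_simps)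
      then have "ln (162 * M ^ 2) \<le> ln (exp (\<epsilon> / 6 * real m))"
        using M1 by (subst ln_le_cancel_iff) auto
      then have lnM: "ln (162 * M ^ 2) \<le> \<epsilon> / 6 * real m" by simp
      have "real m * (\<phi> - \<epsilon> / 6) \<le> real m * (Phi d l (y m) + y m * ln x)"
        using elim(1) by (intro mult_left_mono) auto
      then have base: "real m * (\<phi> - \<epsilon> / 3) \<le> real m * (Phi d l (y m) + y m * ln x) - ln (162 * M ^ 2)"
        using lnM by (simp add: algebra_simps)
      have \<eta>m: "\<eta> * real (l * m) \<le> \<epsilon> / 3 * real m"
        using mult_right_mono[OF \<eta>(3), of "real m"] by (simp add: mult_ac)
      have mean: "real m * (\<phi> - \<epsilon> / 3) \<le> \<mu> + \<eta> * real (l * m)"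
      proof (rule ccontr)
        assume neg: "\<not> ?thesis"
        have "{P\<in>?C. real m * (Phi d l (y m) + y m * ln x) - ln (162 * M ^ 2) \<le> F P} \<subseteq> {P\<in>?C. F P \<ge> \<mu> + \<eta> * real (l * m)}"
          using neg base by auto
        then have "card {P\<in>?C. real m * (Phi d l (y m) + y m * ln x) - ln (162 * M ^ 2) \<le> F P} \<le> card {P\<in>?C. F P \<ge> \<mu> + \<eta> * real (l * m)}"
          using finite_configurations by (intro card_mono) auto
        then have "real (card {P\<in>?C. real m * (Phi d l (y m) + y m * ln x) - ln (162 * M ^ 2) \<le> F P}) \<le> real (card ?C) * exp (- \<kappa> * real (l * m))"
          using conc(1) by linarith
        then have "6377292 * M ^ 8 * real (card {P\<in>?C. real m * (Phi d l (y m) + y m * ln x) - ln (162 * M ^ 2) \<le> F P})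
            \<le> 6377292 * M ^ 8 * (real (card ?C) * exp (- \<kappa> * real (l * m)))"
          using M1 by (intro mult_left_mono) auto
        also have "\<dots> = real (card ?C) * (6377292 * (M ^ 8 * exp (- (\<kappa> * real l) * real m)))" by (simp add: mult_ac)
        also have "\<dots> < real (card ?C) * 1"
          using elim(4) c0 unfolding M_def by (intro mult_strict_left_mono) auto
        finally show False using lower by simp
      qed
      have up: "real (card {P\<in>?C. F P > real m * (\<phi> + \<epsilon>)}) \<le> real (card ?C) * (27 * M ^ 3 * exp (- \<epsilon> * real m))"
        using Z_weighted_upper_tail[OF d l m dvd x, of \<epsilon>] unfolding F_def \<phi>_def Mlm .
      have "?C \<inter> {P. \<bar>1 / real m * ln (Z_weighted m d l x P) - \<phi>\<bar> > \<epsilon>}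
          \<subseteq> {P\<in>?C. F P > real m * (\<phi> + \<epsilon>)} \<union> {P\<in>?C. F P \<le> \<mu> - \<eta> * real (l * m)}"
      proof
        fix P assume P: "P \<in> ?C \<inter> {P. \<bar>1 / real m * ln (Z_weighted m d l x P) - \<phi>\<bar> > \<epsilon>}"
        then have "1 / real m * F P > \<phi> + \<epsilon> \<or> 1 / real m * F P < \<phi> - \<epsilon>" by (auto simp: F_def)
        then show "P \<in> {P\<in>?C. F P > real m * (\<phi> + \<epsilon>)} \<union> {P\<in>?C. F P \<le> \<mu> - \<eta> * real (l * m)}"
        proof
          assume "1 / real m * F P > \<phi> + \<epsilon>"
          then have "F P > real m * (\<phi> + \<epsilon>)" using m by (simp add: pos_less_divide_eq mult.commute)
          then show ?thesis using P by auto
        next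
          assume "1 / real m * F P < \<phi> - \<epsilon>"
          then have "F P < real m * (\<phi> - \<epsilon>)" using m by (simp add: pos_divide_less_eq mult.commute)
          also have "\<dots> = real m * (\<phi> - \<epsilon> / 3) - \<epsilon> / 3 * real m - \<epsilon> / 3 * real m" by (simp add: algebra_simps)
          also have "\<dots> \<le> \<mu> - \<eta> * real (l * m)" using mean \<eta>m by linarith
          finally show ?thesis using P by auto
        qed
      qed
      then have "card (?C \<inter> {P. \<bar>1 / real m * ln (Z_weighted m d l x P) - \<phi>\<bar> > \<epsilon>})
          \<le> card ({P\<in>?C. F P > real m * (\<phi> + \<epsilon>)} \<union> {P\<in>?C. F P \<le> \<mu> - \<eta> * real (l * m)})"
        using finite_configurations by (intro card_mono) auto
      also have "\<dots> \<le> card {P\<in>?C. F P > real m * (\<phi> + \<epsilon>)} + card {P\<in>?C. F P \<le> \<mu> - \<eta> * real (l * m)}"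
        by (rule card_Un_le)
      finally have "real (card (?C \<inter> {P. \<bar>1 / real m * ln (Z_weighted m d l x P) - \<phi>\<bar> > \<epsilon>}))
          \<le> real (card {P\<in>?C. F P > real m * (\<phi> + \<epsilon>)}) + real (card {P\<in>?C. F P \<le> \<mu> - \<eta> * real (l * m)})"
        unfolding of_nat_add[symmetric] by (simp only: of_nat_le_iff)
      also have "\<dots> \<le> real (card ?C) * (27 * M ^ 3 * exp (- \<epsilon> * real m)) + real (card ?C) * exp (- \<kappa> * real (l * m))"
        using up conc(2) by (rule add_mono)
      also have "\<dots> = (27 * (M ^ 3 * exp (- \<epsilon> * real m)) + M ^ 0 * exp (- (\<kappa> * real l) * real m)) * real (card ?C)"
      proof -
        have "exp (- \<kappa> * real (l * m)) = exp (- (\<kappa> * real l) * real m)" by (simp add: mult.assoc)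
        then show ?thesis by (simp only: power_0 mult_1_left distrib_right) (simp only: mult_ac)
      qed
      finally show "measure_pmf.prob (random_hypergraph m d l) {P. \<bar>1 / real m * ln (Z_weighted m d l x P) - \<phi>\<bar> > \<epsilon>}
        \<le> 27 * ((real l * real m + 1) ^ 3 * exp (- \<epsilon> * real m)) + (real l * real m + 1) ^ 0 * exp (- (\<kappa> * real l) * real m)"
        unfolding prob_random_hypergraph[OF d0 dvd] M_def pos_divide_le_eq[OF c0] .
    qed
  qed
  have "(\<lambda>m. 27 * ((real l * real m + 1) ^ 3 * exp (- \<epsilon> * real m)) + (real l * real m + 1) ^ 0 * exp (- (\<kappa> * real l) * real m)) \<longlonglongrightarrow> 27 * 0 + 0"
    using \<epsilon> \<kappa> l0 by (intro tendsto_add tendsto_mult_left polynomial_exp_tendsto_0) auto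
  then have lim: "((\<lambda>m. 27 * ((real l * real m + 1) ^ 3 * exp (- \<epsilon> * real m)) + (real l * real m + 1) ^ 0 * exp (- (\<kappa> * real l) * real m)) \<longlongrightarrow> 0) (admissible d l)"
    by (intro tendsto_admissible) simp
  show "((\<lambda>m. measure_pmf.prob (random_hypergraph m d l) {P. \<bar>1 / real m * ln (Z_weighted m d l x P) - \<phi>\<bar> > \<epsilon>}) \<longlongrightarrow> 0) (admissible d l)"
    by (rule tendsto_sandwich[OF _ _ tendsto_const lim]) (use ev in \<open>simp_all add: eventually_admissible\<close>)
qed

section \<open>Laplace asymptotics of the first moment\<close>

lemma gaussian_integral:
  fixes b :: real assumes b: "b > 0"
  shows "integrable lborel (\<lambda>u. exp (- b * u\<^sup>2))" "(\<integral>u. exp (- b * u\<^sup>2) \<partial>lborel) = sqrt (pi / b)"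
proof -
  define \<sigma> where "\<sigma> = 1 / sqrt (2 * b)"
  have \<sigma>: "\<sigma> > 0" and \<sigma>2: "\<sigma>\<^sup>2 = 1 / (2 * b)" using b by (auto simp: \<sigma>_def power_divide)
  have e: "exp (- b * u\<^sup>2) = sqrt (pi / b) * normal_density 0 \<sigma> u" for u
  proof -
    have 1: "2 * pi * \<sigma>\<^sup>2 = pi / b" unfolding \<sigma>2 using b by simp
    have 2: "- (u - 0)\<^sup>2 / (2 * \<sigma>\<^sup>2) = - b * u\<^sup>2" unfolding \<sigma>2 using b by simp
    have "sqrt (pi / b) \<noteq> 0" using b pi_gt_zero by simp
    then show ?thesis unfolding normal_density_def 1 2 by simp
  qed
  show "integrable lborel (\<lambda>u. exp (- b * u\<^sup>2))"
    unfolding e using integrable_normal_density[OF \<sigma>, of 0] by (rule integrable_mult_right)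
  show "(\<integral>u. exp (- b * u\<^sup>2) \<partial>lborel) = sqrt (pi / b)"
    unfolding e using integral_normal_density[OF \<sigma>, of 0] by simp
qed

text \<open>Laplace's method on a lattice: the sum is the integral of a step function, to which
  dominated convergence applies. Outside \<open>S\<close> the integrand is replaced by its limit.\<close>

lemma lattice_gaussian_sum:
  fixes T :: "nat \<Rightarrow> nat \<Rightarrow> real" and N :: "nat \<Rightarrow> nat" and a b \<beta> C K :: real
  assumes a: "a > 0" and b: "b > 0" and C: "C \<ge> 0"
    and bound: "\<And>m h. m \<in> S \<Longrightarrow> m > 0 \<Longrightarrow> h \<le> N m \<Longrightarrow>
      \<bar>T m h\<bar> \<le> C * exp (- a * ((real h - real m * \<beta>) / sqrt (real m))\<^sup>2)"
    and lim: "\<And>u. ((\<lambda>m. if 0 \<le> \<lfloor>real m * \<beta> + sqrt (real m) * u\<rfloor> \<and> \<lfloor>real m * \<beta> + sqrt (real m) * u\<rfloor> \<le> int (N m)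
        then T m (nat \<lfloor>real m * \<beta> + sqrt (real m) * u\<rfloor>) else 0) \<longlongrightarrow> K * exp (- b * u\<^sup>2)) (inf sequentially (principal S))"
  shows "((\<lambda>m. (\<Sum>h = 0..N m. T m h) / sqrt (real m)) \<longlongrightarrow> K * sqrt (pi / b)) (inf sequentially (principal S))"
proof -
  \<comment> \<open>The cell of u consists of the points with floor (m * \<beta> + sqrt m * u) = h
    and has length 1 / sqrt m, so integrating the step function G reproduces the normalised
    sum.\<close>
  define I where "I m h = {(real h - real m * \<beta>) / sqrt (real m) ..< (real h + 1 - real m * \<beta>) / sqrt (real m)}" for m h :: nat
  define Q where "Q m \<longleftrightarrow> m \<in> S \<and> m > 0" for m
  define G where "G m u = (if Q m then (\<Sum>h = 0..N m. T m h * indicator (I m h) u) else K * exp (- b * u\<^sup>2))" for m u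
  define fl where "fl m u = \<lfloor>real m * \<beta> + sqrt (real m) * u\<rfloor>" for m :: nat and u
  have ind: "indicator (I m h) u = (if int h = fl m u then 1 else 0 :: real)" if "m > 0" for m h u
  proof -
    have s: "sqrt (real m) > 0" using that by simp
    have "u \<in> I m h \<longleftrightarrow> real h \<le> real m * \<beta> + sqrt (real m) * u \<and> real m * \<beta> + sqrt (real m) * u < real h + 1"
      unfolding I_def using s by (auto simp: pos_divide_le_eq pos_less_divide_eq mult.commute)
    also have "\<dots> \<longleftrightarrow> int h = fl m u" unfolding fl_def eq_commute[of "int h"] floor_eq_iff by simp
    finally show ?thesis by (simp add: indicator_def)
  qed
  have G_eval: "G m u = (if 0 \<le> fl m u \<and> fl m u \<le> int (N m) then T m (nat (fl m u)) else 0)" if Q: "Q m" for m u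
  proof -
    have m: "m > 0" using Q by (simp add: Q_def)
    have "G m u = (\<Sum>h = 0..N m. if int h = fl m u then T m h else 0)"
      using Q by (auto simp: G_def ind[OF m] intro!: sum.cong)
    also have "\<dots> = (if 0 \<le> fl m u \<and> fl m u \<le> int (N m) then T m (nat (fl m u)) else 0)"
    proof (cases "0 \<le> fl m u")
      case True
      then have "int h = fl m u \<longleftrightarrow> h = nat (fl m u)" for h by auto
      then show ?thesis using True by (auto simp: nat_le_iff)
    next
      case False
      then have "int h \<noteq> fl m u" for h by linarith
      then show ?thesis using False by simp
    qed
    finally show ?thesis .
  qed
  \<comment> \<open>A point u and the left end v of its cell differ by at most 1, so u^2 / 2 - 1
    \<le> v^2. Passing from v to u therefore halves the Gaussian rate and costs a factor exp a. The
    second summand dominates the limit used outside S.\<close>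
  define w where "w u = C * exp a * exp (- (a / 2) * u\<^sup>2) + \<bar>K\<bar> * exp (- b * u\<^sup>2)" for u
  have dom: "norm (G m u) \<le> w u" for m u
  proof (cases "Q m")
    case False
    then show ?thesis using C by (simp add: G_def w_def abs_mult)
  next
    case True
    then have m: "m \<in> S" "m > 0" by (auto simp: Q_def)
    have w0: "0 \<le> \<bar>K\<bar> * exp (- b * u\<^sup>2)" "0 \<le> C * exp a * exp (- (a / 2) * u\<^sup>2)" using C by auto
    show ?thesis
    proof (cases "0 \<le> fl m u \<and> fl m u \<le> int (N m)")
      case True
      define h where "h = nat (fl m u)"
      have h: "h \<le> N m" "int h = fl m u" using True by (auto simp: h_def)
      define v where "v = (real h - real m * \<beta>) / sqrt (real m)"
      have s: "sqrt (real m) \<ge> 1" using m by simp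
      have "indicator (I m h) u = (1 :: real)" using ind[OF m(2), of h u] h by simp
      then have "u \<in> I m h" by (simp add: indicator_def split: if_splits)
      then have uv: "v \<le> u" "u < v + 1 / sqrt (real m)" by (auto simp: I_def v_def add_divide_distrib diff_divide_distrib)
      have "1 / sqrt (real m) \<le> 1" using s by simp
      then have "\<bar>u - v\<bar> \<le> 1" using uv by linarith
      then have "(u - v)\<^sup>2 \<le> 1" by (simp add: abs_square_le_1)
      moreover have "u\<^sup>2 \<le> 2 * v\<^sup>2 + 2 * (u - v)\<^sup>2"
      proof -
        have "0 \<le> (2 * v - u)\<^sup>2" by simp
        then show ?thesis by (simp add: power2_eq_square algebra_simps)
      qed
      ultimately have "u\<^sup>2 / 2 - 1 \<le> v\<^sup>2" by linarith
      then have "a * (u\<^sup>2 / 2 - 1) \<le> a * v\<^sup>2" using a by (intro mult_left_mono) auto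
      then have "exp (- a * v\<^sup>2) \<le> exp (a + - (a / 2) * u\<^sup>2)" by (simp add: algebra_simps)
      then have "C * exp (- a * v\<^sup>2) \<le> C * (exp a * exp (- (a / 2) * u\<^sup>2))"
        unfolding exp_add by (intro mult_left_mono C)
      moreover have "\<bar>T m h\<bar> \<le> C * exp (- a * v\<^sup>2)" unfolding v_def by (rule bound[OF m h(1)])
      moreover have "G m u = T m h" using G_eval[OF \<open>Q m\<close>, of u] True by (simp add: h_def)
      ultimately have "norm (G m u) \<le> C * (exp a * exp (- (a / 2) * u\<^sup>2))" by simp
      then show ?thesis using w0(1) unfolding w_def mult.assoc by linarith
    next
      case False
      then have "G m u = 0" using G_eval[OF \<open>Q m\<close>, of u] by presburger
      then show ?thesis using w0 by (simp add: w_def)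
    qed
  qed
  have pw: "(\<lambda>m. G m u) \<longlonglongrightarrow> K * exp (- b * u\<^sup>2)" for u
  proof -
    have "G m u = (if Q m then (if 0 \<le> fl m u \<and> fl m u \<le> int (N m) then T m (nat (fl m u)) else 0) else K * exp (- b * u\<^sup>2))" for m
      using G_eval[of m u] by (auto simp: G_def)
    moreover have "(\<lambda>m. if Q m then (if 0 \<le> fl m u \<and> fl m u \<le> int (N m) then T m (nat (fl m u)) else 0) else K * exp (- b * u\<^sup>2)) \<longlonglongrightarrow> K * exp (- b * u\<^sup>2)"
    proof (rule filterlim_If)
      have "inf sequentially (principal {m. Q m}) \<le> inf sequentially (principal S)"
        by (intro inf_mono order_refl) (auto simp: Q_def)
      then show "((\<lambda>m. if 0 \<le> fl m u \<and> fl m u \<le> int (N m) then T m (nat (fl m u)) else 0) \<longlongrightarrow> K * exp (- b * u\<^sup>2)) (inf sequentially (principal {m. Q m}))"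
        using lim[of u] unfolding fl_def by (rule tendsto_mono)
    qed (rule tendsto_const)
    ultimately show ?thesis by presburger
  qed
  have meas: "G m \<in> borel_measurable lborel" for m
  proof (cases "Q m")
    case True
    have "(\<lambda>u. \<Sum>h = 0..N m. T m h * indicator (I m h) u) \<in> borel_measurable borel"
      unfolding I_def
      by (intro borel_measurable_sum borel_measurable_times borel_measurable_const borel_measurable_indicator) simp
    then show ?thesis using True by (simp add: G_def[abs_def])
  next
    case False
    then show ?thesis by (simp add: G_def[abs_def])
  qed
  have wi: "integrable lborel w"
    unfolding w_def[abs_def]
  proof (rule Bochner_Integration.integrable_add)
    show "integrable lborel (\<lambda>u. C * exp a * exp (- (a / 2) * u\<^sup>2))"
      using a by (intro integrable_mult_right gaussian_integral(1)) simp
    show "integrable lborel (\<lambda>u. \<bar>K\<bar> * exp (- b * u\<^sup>2))"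
      by (intro integrable_mult_right gaussian_integral(1) b)
  qed
  have "(\<lambda>m. integral\<^sup>L lborel (G m)) \<longlonglongrightarrow> integral\<^sup>L lborel (\<lambda>u. K * exp (- b * u\<^sup>2))"
    by (rule integral_dominated_convergence[OF _ meas wi]) (use pw dom in auto)
  then have L: "(\<lambda>m. integral\<^sup>L lborel (G m)) \<longlonglongrightarrow> K * sqrt (pi / b)"
    using gaussian_integral(2)[OF b] by simp
  have int: "integral\<^sup>L lborel (G m) = (\<Sum>h = 0..N m. T m h) / sqrt (real m)" if Q: "Q m" for m
  proof -
    have m: "m > 0" using Q by (simp add: Q_def)
    have le: "(real h - real m * \<beta>) / sqrt (real m) \<le> (real h + 1 - real m * \<beta>) / sqrt (real m)" for h
      using m by (intro divide_right_mono) auto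
    have Ii: "integrable lborel (indicator (I m h) :: real \<Rightarrow> real)" for h
    proof (rule integrable_real_indicator)
      show "emeasure lborel (I m h) < \<infinity>" unfolding I_def by (subst emeasure_lborel_Ico[OF le]) simp
    qed (simp add: I_def)
    have mI: "(\<integral>u. indicator (I m h) u \<partial>lborel) = 1 / sqrt (real m)" for h
      unfolding I_def using le[of h] by (simp add: diff_divide_distrib add_divide_distrib)
    have "integral\<^sup>L lborel (G m) = (\<integral>u. (\<Sum>h = 0..N m. T m h * indicator (I m h) u) \<partial>lborel)"
      using Q by (simp add: G_def[abs_def])
    also have "\<dots> = (\<Sum>h = 0..N m. (\<integral>u. T m h * indicator (I m h) u \<partial>lborel))"
      by (rule Bochner_Integration.integral_sum) (intro integrable_mult_right Ii)
    also have "\<dots> = (\<Sum>h = 0..N m. T m h * (1 / sqrt (real m)))" by (simp only: integral_mult_right_zero mI)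
    finally show ?thesis by (simp add: sum_divide_distrib)
  qed
  have "((\<lambda>m. integral\<^sup>L lborel (G m)) \<longlongrightarrow> K * sqrt (pi / b)) (inf sequentially (principal S))"
    using L by (rule tendsto_mono[OF inf_le1])
  moreover have "\<forall>\<^sub>F m in inf sequentially (principal S). integral\<^sup>L lborel (G m) = (\<Sum>h = 0..N m. T m h) / sqrt (real m)"
    unfolding eventually_inf_principal using eventually_gt_at_top[of 0] by eventually_elim (simp add: int Q_def)
  ultimately show ?thesis by (rule Lim_transform_eventually)
qed

section \<open>Local expansion at the maximum and sharp prefactors\<close>

lemma Phi_second_order:
  assumes d: "d \<ge> 2" and l: "l \<ge> 2"
  defines "\<beta> \<equiv> beta_star_at d l 1"
  shows "((\<lambda>y. (Phi d l y - Phi d l \<beta>) / (y - \<beta>)\<^sup>2) \<longlongrightarrow> phi'' d l \<beta> / 2) (at \<beta>)"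
proof (rule lhopital[where f' = "phi' d l" and g' = "\<lambda>y. 2 * (y - \<beta>)"])
  note b = beta_star_at[OF d l zero_less_one, folded \<beta>_def]
  have "((\<lambda>y. Phi d l y) \<longlongrightarrow> Phi d l \<beta>) (at \<beta>)"
    using DERIV_isCont[OF Phi_deriv[OF d l b(1)]] by (simp add: isCont_def)
  from tendsto_diff[OF this tendsto_const[of "Phi d l \<beta>"]]
  show "((\<lambda>y. Phi d l y - Phi d l \<beta>) \<longlongrightarrow> 0) (at \<beta>)" by simp
  have "((\<lambda>y. (y - \<beta>)\<^sup>2) \<longlongrightarrow> (\<beta> - \<beta>)\<^sup>2) (at \<beta>)" by (intro tendsto_intros)
  then show "((\<lambda>y. (y - \<beta>)\<^sup>2) \<longlongrightarrow> 0) (at \<beta>)" by simp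
  show "\<forall>\<^sub>F y in at \<beta>. (y - \<beta>)\<^sup>2 \<noteq> 0" "\<forall>\<^sub>F y in at \<beta>. 2 * (y - \<beta>) \<noteq> 0"
    by (auto simp: eventually_at_filter)
  have "\<forall>\<^sub>F y in at \<beta>. y \<in> {0<..<1 / real d}"
    by (rule eventually_at_in_open') (use b(1) in auto)
  then show "\<forall>\<^sub>F y in at \<beta>. ((\<lambda>y. Phi d l y - Phi d l \<beta>) has_real_derivative phi' d l y) (at y)"
  proof eventually_elim
    case (elim y)
    from DERIV_diff[OF Phi_deriv[OF d l elim] DERIV_const[of "Phi d l \<beta>"]] show ?case by simp
  qed
  show "\<forall>\<^sub>F y in at \<beta>. ((\<lambda>y. (y - \<beta>)\<^sup>2) has_real_derivative 2 * (y - \<beta>)) (at y)"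
    by (intro always_eventually allI) (auto intro!: derivative_eq_intros)
  have "((\<lambda>y. (phi' d l y - phi' d l \<beta>) / (y - \<beta>)) \<longlongrightarrow> phi'' d l \<beta>) (at \<beta>)"
    using phi'_deriv[OF d l b(1)] by (simp add: has_field_derivative_iff)
  then have "((\<lambda>y. phi' d l y / (y - \<beta>) * (1 / 2)) \<longlongrightarrow> phi'' d l \<beta> * (1 / 2)) (at \<beta>)"
    using b(2) by (intro tendsto_mult tendsto_const) simp
  then show "((\<lambda>y. phi' d l y / (2 * (y - \<beta>))) \<longlongrightarrow> phi'' d l \<beta> / 2) (at \<beta>)"
    by (simp add: divide_divide_eq_left mult.commute)
qed

text \<open>The second-order remainder becomes a function q continuous at \<beta>, so limits can be
  taken along sequences that may hit \<beta> itself.\<close>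

lemma Phi_expansion:
  assumes d: "d \<ge> 2" and l: "l \<ge> 2"
  defines "\<beta> \<equiv> beta_star_at d l 1"
  obtains q where "isCont q \<beta>" "q \<beta> = phi'' d l \<beta> / 2" "\<And>y. Phi d l y = Phi d l \<beta> + q y * (y - \<beta>)\<^sup>2"
proof -
  define q where "q y = (if y = \<beta> then phi'' d l \<beta> / 2 else (Phi d l y - Phi d l \<beta>) / (y - \<beta>)\<^sup>2)" for y
  have qb: "q \<beta> = phi'' d l \<beta> / 2" by (simp add: q_def)
  have qy: "q y = (Phi d l y - Phi d l \<beta>) / (y - \<beta>)\<^sup>2" if "y \<noteq> \<beta>" for y using that by (simp add: q_def)
  have "(q \<longlongrightarrow> phi'' d l \<beta> / 2) (at \<beta>)"
  proof (rule Lim_transform_eventually[OF Phi_second_order[OF d l, folded \<beta>_def]])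
    show "\<forall>\<^sub>F y in at \<beta>. (Phi d l y - Phi d l \<beta>) / (y - \<beta>)\<^sup>2 = q y"
      unfolding eventually_at_filter by (intro always_eventually allI impI) (rule qy[symmetric])
  qed
  then have 1: "isCont q \<beta>" unfolding isCont_def qb .
  have 2: "Phi d l y = Phi d l \<beta> + q y * (y - \<beta>)\<^sup>2" for y
    by (cases "y = \<beta>") (simp_all add: qy)
  show thesis using that[OF 1 qb 2] .
qed

lemma ratio_tendsto_at_top:
  fixes k :: "nat \<Rightarrow> nat"
  assumes F: "F \<le> sequentially" and lim: "((\<lambda>m. real (k m) / real m) \<longlongrightarrow> c) F" and c: "c > 0"
  shows "filterlim k at_top F"
proof -
  have "filterlim (\<lambda>m. real m) at_top F"
    by (rule filterlim_mono[OF filterlim_real_sequentially order_refl F])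
  then have "filterlim (\<lambda>m. real (k m) / real m * real m) at_top F"
    by (rule filterlim_tendsto_pos_mult_at_top[OF lim c])
  moreover have "\<forall>\<^sub>F m in F. real (k m) / real m * real m = real (k m)"
  proof -
    have "\<forall>\<^sub>F m in sequentially. real (k m) / real m * real m = real (k m)"
      using eventually_gt_at_top[of 0] by eventually_elim simp
    then show ?thesis using F by (rule filter_leD[rotated])
  qed
  ultimately have "filterlim (\<lambda>m. real (k m)) at_top F"
    by (simp only: filterlim_cong[OF refl refl])
  then show ?thesis by (simp add: filterlim_sequentially_iff_filterlim_real)
qed

lemma admissible_le: "admissible d l \<le> sequentially"
  by (simp add: admissible_def)

text \<open>The leading sqrt M balances three roots above against four below, so every scale cancels
  and only the densities remain.\<close>

lemma sqrt_quotient_aux: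
  fixes M L D y :: real
  assumes "M > 0" "L > 0" "D > 0" "0 < y" "D * y < 1" "y < 1"
  shows "sqrt M * (sqrt M * sqrt (L / D * M) * sqrt (L * (1 - y) * M)
      / (sqrt (y * M) * sqrt ((1 - y) * M) * sqrt (L / D * (1 - D * y) * M) * sqrt (L * M)))
    = sqrt (1 / (y * (1 - D * y)))"
proof -
  have "sqrt M * (sqrt M * sqrt (L / D * M) * sqrt (L * (1 - y) * M)
      / (sqrt (y * M) * sqrt ((1 - y) * M) * sqrt (L / D * (1 - D * y) * M) * sqrt (L * M)))
    = sqrt (M * (M * (L / D * M) * (L * (1 - y) * M) / (y * M * ((1 - y) * M) * (L / D * (1 - D * y) * M) * (L * M))))"
    by (simp only: real_sqrt_mult real_sqrt_divide)
  also have "M * (M * (L / D * M) * (L * (1 - y) * M) / (y * M * ((1 - y) * M) * (L / D * (1 - D * y) * M) * (L * M)))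
     = 1 / (y * (1 - D * y))"
    using assms by (simp add: divide_simps)
  finally show ?thesis .
qed

lemma prefactor_sizes:
  assumes d: "d \<ge> 2" and l: "l \<ge> 2" and m: "m > 0" and dvd: "d dvd l * m"
    and h: "h > 0" "real d * real h < real m"
  defines "y \<equiv> real h / real m"
  shows "real (l * m div d) = real l / real d * real m" "real (l * m - l * h) = real l * (1 - y) * real m"
    "real h = y * real m" "real (m - h) = (1 - y) * real m"
    "real (l * m div d - l * h) = real l / real d * (1 - real d * y) * real m" "real (l * m) = real l * real m"
    "0 < y" "real d * y < 1" "y < 1"
proof -
  define n where "n = l * m div d"
  have nd: "d * n = l * m" unfolding n_def using dvd by simp
  have dh: "d * h < m" using h(2) by (metis of_nat_less_iff of_nat_mult)
  have "h \<le> d * h" using d by (cases d) auto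
  then have hm: "h < m" using dh by (rule le_less_trans)
  have "d * (l * h) \<le> d * n" unfolding nd using dh by (simp add: mult.left_commute)
  then have lhn: "l * h \<le> n" using d by simp
  have lhm: "l * h \<le> l * m" using hm by simp
  show y: "real h = y * real m" using m by (simp add: y_def)
  show rn: "real (l * m div d) = real l / real d * real m"
  proof -
    have "real d * real n = real l * real m" using nd by (metis of_nat_mult)
    then show ?thesis using d by (simp add: n_def field_simps)
  qed
  show "real (l * m - l * h) = real l * (1 - y) * real m" "real (m - h) = (1 - y) * real m"
    using hm lhm y by (simp_all add: of_nat_diff algebra_simps)
  have "real (n - l * h) = real n - real l * real h" using lhn by (simp add: of_nat_diff)
  also have "\<dots> = real l / real d * (1 - real d * y) * real m"
    unfolding n_def rn y using d by (simp add: algebra_simps)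
  finally show "real (l * m div d - l * h) = real l / real d * (1 - real d * y) * real m" by (simp add: n_def)
  show "real (l * m) = real l * real m" by simp
  show "0 < y" "real d * y < 1" "y < 1" using h hm m by (auto simp: y_def)
qed

text \<open>All seven Stirling arguments are positive strictly inside the range, so the two-sided
  bound by sqrt n applies to each; 27 = 3^3 comes from the three ratios in the numerator. Unlike the
  polynomial bound, this has the true order.\<close>

lemma prefactor_local_bound:
  assumes d: "d \<ge> 2" and l: "l \<ge> 2" and m: "m > 0" and dvd: "d dvd l * m"
    and h: "h > 0" "real d * real h < real m"
  defines "y \<equiv> real h / real m"
  shows "sqrt (real m) * Z_count_prefactor m d l h \<le> 27 * sqrt (1 / (y * (1 - real d * y)))"
proof -
  note sz = prefactor_sizes[OF d l m dvd h, folded y_def]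
  have M: "real m > 0" "real l > 0" "real d > 0" using m l d by auto
  have pos: "m > 0" "l * m div d > 0" "l * m - l * h > 0" "h > 0" "m - h > 0" "l * m div d - l * h > 0" "l * m > 0"
  proof -
    have "0 < real (l * m div d)" "0 < real (l * m - l * h)" "0 < real (m - h)" "0 < real (l * m div d - l * h)" "0 < real (l * m)"
      unfolding sz(1,2,4,5,6) using sz(7,8,9) M by (auto intro!: mult_pos_pos)
    then show "l * m div d > 0" "l * m - l * h > 0" "m - h > 0" "l * m div d - l * h > 0" "l * m > 0"
      by (simp_all only: of_nat_0_less_iff)
  qed (use m h in auto)
  note lo = stirling_ratio_bounds(1) and hi = stirling_ratio_bounds(2) and p = less_imp_le[OF stirling_ratio_pos]
  have s: "0 < sqrt (real k)" if "k > 0" for k using that by simp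
  have "Z_count_prefactor m d l h \<le> (3 * sqrt (real m) * (3 * sqrt (real (l * m div d))) * (3 * sqrt (real (l * m - l * h))))
     / (sqrt (real h) * sqrt (real (m - h)) * sqrt (real (l * m div d - l * h)) * sqrt (real (l * m)))"
    unfolding Z_count_prefactor_def
  proof (rule frac_le)
    show "stirling_ratio m * stirling_ratio (l * m div d) * stirling_ratio (l * m - l * h)
      \<le> 3 * sqrt (real m) * (3 * sqrt (real (l * m div d))) * (3 * sqrt (real (l * m - l * h)))"
      by (intro mult_mono hi pos mult_nonneg_nonneg p) auto
    show "sqrt (real h) * sqrt (real (m - h)) * sqrt (real (l * m div d - l * h)) * sqrt (real (l * m))
      \<le> stirling_ratio h * stirling_ratio (m - h) * stirling_ratio (l * m div d - l * h) * stirling_ratio (l * m)"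
      by (intro mult_mono lo pos mult_nonneg_nonneg p) auto
    show "0 < sqrt (real h) * sqrt (real (m - h)) * sqrt (real (l * m div d - l * h)) * sqrt (real (l * m))"
      by (intro mult_pos_pos s pos)
  qed (intro mult_nonneg_nonneg; simp)
  also have "\<dots> = 27 * (sqrt (real m) * sqrt (real (l * m div d)) * sqrt (real (l * m - l * h))
     / (sqrt (real h) * sqrt (real (m - h)) * sqrt (real (l * m div d - l * h)) * sqrt (real (l * m))))" by simp
  finally have "sqrt (real m) * Z_count_prefactor m d l h \<le> sqrt (real m) * (27 * (sqrt (real m) * sqrt (real (l * m div d)) * sqrt (real (l * m - l * h))
     / (sqrt (real h) * sqrt (real (m - h)) * sqrt (real (l * m div d - l * h)) * sqrt (real (l * m)))))"
    by (rule mult_left_mono) simp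
  also have "\<dots> = 27 * (sqrt (real m) * (sqrt (real m) * sqrt (real (l * m div d)) * sqrt (real (l * m - l * h))
     / (sqrt (real h) * sqrt (real (m - h)) * sqrt (real (l * m div d - l * h)) * sqrt (real (l * m)))))" by simp
  also have "sqrt (real m) * (sqrt (real m) * sqrt (real (l * m div d)) * sqrt (real (l * m - l * h))
     / (sqrt (real h) * sqrt (real (m - h)) * sqrt (real (l * m div d - l * h)) * sqrt (real (l * m))))
     = sqrt (1 / (y * (1 - real d * y)))"
    unfolding sz(1) sz(2) sz(3) sz(4) sz(5) sz(6) using sqrt_quotient_aux[OF M sz(7,8,9)] .
  finally show ?thesis .
qed

text \<open>Each Stirling ratio, divided by its root, tends to sqrt (2 * pi); with three above and
  four below, a factor 1 / sqrt (2 * pi) is left.\<close>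

lemma prefactor_tendsto:
  assumes d: "d \<ge> 2" and l: "l \<ge> 2"
    and lim: "((\<lambda>m. real (h m) / real m) \<longlongrightarrow> \<beta>) (admissible d l)" and \<beta>: "0 < \<beta>" "real d * \<beta> < 1"
  shows "((\<lambda>m. sqrt (real m) * Z_count_prefactor m d l (h m)) \<longlongrightarrow> 1 / sqrt (2 * pi) * sqrt (1 / (\<beta> * (1 - real d * \<beta>)))) (admissible d l)"
proof -
  let ?F = "admissible d l"
  define y where "y m = real (h m) / real m" for m
  have ylim: "(y \<longlongrightarrow> \<beta>) ?F" using lim by (simp add: y_def[abs_def])
  have M: "real l > 0" "real d > 0" using l d by auto
  have "1 * \<beta> \<le> real d * \<beta>" using d \<beta> by (intro mult_right_mono) auto
  then have \<beta>1: "\<beta> < 1" using \<beta> by linarith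
  have dylim: "((\<lambda>m. real d * y m) \<longlongrightarrow> real d * \<beta>) ?F" by (intro tendsto_intros ylim)
  have e1: "\<forall>\<^sub>F m in ?F. 0 < y m" using ylim \<beta> by (intro order_tendstoD) auto
  have e2: "\<forall>\<^sub>F m in ?F. real d * y m < 1" using dylim \<beta> by (intro order_tendstoD) auto
  have e3: "\<forall>\<^sub>F m in ?F. d dvd l * m" by (simp add: eventually_admissible)
  have e4: "\<forall>\<^sub>F m in ?F. m > 0"
    using eventually_gt_at_top[of "0 :: nat"] admissible_le by (rule filter_leD[rotated])
  have good: "\<forall>\<^sub>F m in ?F. m > 0 \<and> d dvd l * m \<and> h m > 0 \<and> real d * real (h m) < real m"
    using e1 e2 e3 e4
  proof eventually_elim
    case (elim m)
    then have "h m > 0" by (auto simp: y_def intro: Nat.gr0I)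
    moreover have "real d * real (h m) < real m" using elim by (simp add: y_def divide_less_eq)
    ultimately show ?case using elim by simp
  qed
  define R where "R k = stirling_ratio k / sqrt (real k)" for k
  have Rl: "((\<lambda>m. R (k m)) \<longlongrightarrow> sqrt (2 * pi)) ?F"
    if "\<forall>\<^sub>F m in ?F. real (k m) / real m = g m" "(g \<longlongrightarrow> c) ?F" "c > 0" for k g c
  proof -
    have "((\<lambda>m. real (k m) / real m) \<longlongrightarrow> c) ?F"
    proof (rule Lim_transform_eventually[OF that(2)])
      show "\<forall>\<^sub>F m in ?F. g m = real (k m) / real m" using that(1) by eventually_elim simp
    qed
    then have "filterlim k at_top ?F" using that(3) by (rule ratio_tendsto_at_top[OF admissible_le])
    then show ?thesis unfolding R_def by (rule stirling_ratio_asymp)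
  qed
  have L1: "((\<lambda>m. R m) \<longlongrightarrow> sqrt (2 * pi)) ?F"
    using e4 by (intro Rl[where g = "\<lambda>_. 1" and c = 1] tendsto_const) (auto elim!: eventually_mono)
  have L2: "((\<lambda>m. R (l * m div d)) \<longlongrightarrow> sqrt (2 * pi)) ?F"
  proof (rule Rl[where g = "\<lambda>_. real l / real d" and c = "real l / real d"])
    show "\<forall>\<^sub>F m in ?F. real (l * m div d) / real m = real l / real d"
      using good by eventually_elim (use prefactor_sizes(1)[OF d l] in force)
  qed (use M in auto)
  have L3: "((\<lambda>m. R (l * m - l * h m)) \<longlongrightarrow> sqrt (2 * pi)) ?F"
  proof (rule Rl[where g = "\<lambda>m. real l * (1 - y m)" and c = "real l * (1 - \<beta>)"])
    show "\<forall>\<^sub>F m in ?F. real (l * m - l * h m) / real m = real l * (1 - y m)"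
      using good by eventually_elim (use prefactor_sizes(2)[OF d l] in \<open>force simp: y_def\<close>)
  qed (use M \<beta>1 in \<open>auto intro!: tendsto_intros ylim\<close>)
  have L4: "((\<lambda>m. R (h m)) \<longlongrightarrow> sqrt (2 * pi)) ?F"
    using ylim \<beta> by (intro Rl[where g = y and c = \<beta>]) (auto simp: y_def)
  have L5: "((\<lambda>m. R (m - h m)) \<longlongrightarrow> sqrt (2 * pi)) ?F"
  proof (rule Rl[where g = "\<lambda>m. 1 - y m" and c = "1 - \<beta>"])
    show "\<forall>\<^sub>F m in ?F. real (m - h m) / real m = 1 - y m"
      using good by eventually_elim (use prefactor_sizes(4)[OF d l] in \<open>force simp: y_def\<close>)
  qed (use \<beta>1 in \<open>auto intro!: tendsto_intros ylim\<close>)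
  have L6: "((\<lambda>m. R (l * m div d - l * h m)) \<longlongrightarrow> sqrt (2 * pi)) ?F"
  proof (rule Rl[where g = "\<lambda>m. real l / real d * (1 - real d * y m)" and c = "real l / real d * (1 - real d * \<beta>)"])
    show "\<forall>\<^sub>F m in ?F. real (l * m div d - l * h m) / real m = real l / real d * (1 - real d * y m)"
      using good by eventually_elim (use prefactor_sizes(5)[OF d l] in \<open>force simp: y_def\<close>)
  qed (use M \<beta> in \<open>auto intro!: tendsto_intros ylim\<close>)
  have L7: "((\<lambda>m. R (l * m)) \<longlongrightarrow> sqrt (2 * pi)) ?F"
    using e4 M by (intro Rl[where g = "\<lambda>_. real l" and c = "real l"] tendsto_const) (auto elim!: eventually_mono)
  have "((\<lambda>m. R m * R (l * m div d) * R (l * m - l * h m) / (R (h m) * R (m - h m) * R (l * m div d - l * h m) * R (l * m))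
      * sqrt (1 / (y m * (1 - real d * y m)))) \<longlongrightarrow>
      sqrt (2 * pi) * sqrt (2 * pi) * sqrt (2 * pi) / (sqrt (2 * pi) * sqrt (2 * pi) * sqrt (2 * pi) * sqrt (2 * pi))
      * sqrt (1 / (\<beta> * (1 - real d * \<beta>)))) ?F"
    using \<beta> by (intro tendsto_intros L1 L2 L3 L4 L5 L6 L7 ylim) auto
  then have lim': "((\<lambda>m. R m * R (l * m div d) * R (l * m - l * h m) / (R (h m) * R (m - h m) * R (l * m div d - l * h m) * R (l * m))
      * sqrt (1 / (y m * (1 - real d * y m)))) \<longlongrightarrow> 1 / sqrt (2 * pi) * sqrt (1 / (\<beta> * (1 - real d * \<beta>)))) ?F"
    by simp
  show ?thesis
  proof (rule Lim_transform_eventually[OF lim'])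
    show "\<forall>\<^sub>F m in ?F. R m * R (l * m div d) * R (l * m - l * h m) / (R (h m) * R (m - h m) * R (l * m div d - l * h m) * R (l * m))
      * sqrt (1 / (y m * (1 - real d * y m))) = sqrt (real m) * Z_count_prefactor m d l (h m)"
      using good
    proof eventually_elim
      case (elim m)
      then have g: "m > 0" "d dvd l * m" "h m > 0" "real d * real (h m) < real m" by auto
      note sz = prefactor_sizes[OF d l g, folded y_def]
      have sq: "sqrt (1 / (y m * (1 - real d * y m))) = sqrt (real m) * (sqrt (real m) * sqrt (real (l * m div d)) * sqrt (real (l * m - l * h m))
        / (sqrt (real (h m)) * sqrt (real (m - h m)) * sqrt (real (l * m div d - l * h m)) * sqrt (real (l * m))))"
        unfolding sz(1) sz(2) sz(3) sz(4) sz(5) sz(6)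
        using sqrt_quotient_aux[of "real m" "real l" "real d" "y m"] sz(7,8,9) M g(1) by simp
      have pos: "real (l * m div d) > 0" "real (l * m - l * h m) > 0" "real (m - h m) > 0" "real (l * m div d - l * h m) > 0" "real (l * m) > 0"
        unfolding sz(1,2,4,5,6) using sz(7,8,9) M g by (auto intro!: mult_pos_pos)
      have alg: "a / sa * (b / sb) * (c / sc) / (e / se * (f / sf) * (g' / sg) * (k / sk)) * (sm * (sa * sb * sc / (se * sf * sg * sk)))
        = sm * (a * b * c / (e * f * g' * k))"
        if "sa > 0" "sb > 0" "sc > 0" "se > 0" "sf > 0" "sg > 0" "sk > 0" for a b c e f g' k sa sb sc se sf sg sk sm :: real
        using that by (simp add: mult_ac)
      show ?case unfolding R_def Z_count_prefactor_def sq
        by (intro alg real_sqrt_gt_zero pos) (use g in simp_all)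
    qed
  qed
qed

text \<open>Near \<beta> the prefactor has its true order and the strong concavity of
  \<open>Phi\<close> gives the Gaussian. At distance at least \<eta> only the polynomial bound is
  used, and half of the Gaussian decay absorbs it; this is why the rate drops from d / 2 to d /
  4.\<close>

lemma lattice_term_bound:
  assumes d: "d \<ge> 2" and l: "l \<ge> 2"
  defines "\<beta> \<equiv> beta_star_at d l 1"
  obtains C where "C \<ge> 0" "\<And>m h. d dvd l * m \<Longrightarrow> m > 0 \<Longrightarrow> h \<le> m div d \<Longrightarrow>
    \<bar>sqrt (real m) * Z_count_prefactor m d l h * exp (real m * (Phi d l (real h / real m) - Phi d l \<beta>))\<bar>
      \<le> C * exp (- (real d / 4) * ((real h - real m * \<beta>) / sqrt (real m))\<^sup>2)"
proof -
  note b = beta_star_at[OF d l zero_less_one, folded \<beta>_def]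
  note bi = open_unit_interval[OF d l b(1)]
  have d0: "real d > 0" using d by simp
  define g where "g = 1 - real d * \<beta>"
  have g: "g > 0" using bi by (simp add: g_def)
  \<comment> \<open>Chosen so that within distance \<eta> of \<beta> both y and 1 - d * y keep at
    least half of their values at \<beta>.\<close>
  define \<eta> where "\<eta> = min (\<beta> / 2) (g / (2 * real d))"
  have \<eta>: "0 < \<eta>" "\<eta> \<le> \<beta> / 2" "real d * \<eta> \<le> g / 2"
  proof -
    show "0 < \<eta>" "\<eta> \<le> \<beta> / 2" using bi g d0 by (auto simp: \<eta>_def)
    have "real d * \<eta> \<le> real d * (g / (2 * real d))" by (intro mult_left_mono) (auto simp: \<eta>_def)
    then show "real d * \<eta> \<le> g / 2" using d0 by simp
  qed
  have "(\<lambda>m. (real l * real m + 1) ^ 3 * exp (- (real d / 4 * \<eta>\<^sup>2) * real m)) \<longlonglongrightarrow> 0"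
    using d0 \<eta> by (intro polynomial_exp_tendsto_0) auto
  then have "Bseq (\<lambda>m. (real l * real m + 1) ^ 3 * exp (- (real d / 4 * \<eta>\<^sup>2) * real m))"
    by (intro convergent_imp_Bseq) (auto simp: convergent_def)
  then obtain B where B: "B > 0" "\<And>m. norm ((real l * real m + 1) ^ 3 * exp (- (real d / 4 * \<eta>\<^sup>2) * real m)) \<le> B"
    by (elim BseqE) blast
  define C1 where "C1 = 27 * sqrt (4 / (\<beta> * g))"
  define C where "C = C1 + 27 * B"
  have C1: "C1 \<ge> 0" using bi g by (simp add: C1_def)
  show thesis
  proof (rule that[of C])
    show "C \<ge> 0" using C1 B by (simp add: C_def)
    fix m h assume dvd: "d dvd l * m" and m: "m > 0" and h: "h \<le> m div d"
    define y where "y = real h / real m"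
    define v where "v = (real h - real m * \<beta>) / sqrt (real m)"
    define pre where "pre = Z_count_prefactor m d l h"
    have hm: "h \<le> m" using h by (meson div_le_dividend le_trans)
    have M: "real m > 0" using m by simp
    have "h * d \<le> m" using h d by (simp add: less_eq_div_iff_mult_less_eq)
    then have "real h * real d \<le> real m" by (metis of_nat_le_iff of_nat_mult)
    then have y: "0 \<le> y" "y \<le> 1 / real d" using M d0 by (simp_all add: y_def field_simps)
    have "real h - real m * \<beta> = real m * (y - \<beta>)" using M by (simp add: y_def right_diff_distrib)
    then have v2: "v\<^sup>2 = real m * (y - \<beta>)\<^sup>2"
      unfolding v_def using M by (simp add: power_divide power_mult_distrib power2_eq_square[of "real m"])
    have "Phi d l y - Phi d l \<beta> \<le> - (real d / 2 * (y - \<beta>)\<^sup>2)"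
      using Phi_le[OF d l zero_less_one y, folded \<beta>_def] by simp
    then have "real m * (Phi d l y - Phi d l \<beta>) \<le> real m * (- (real d / 2 * (y - \<beta>)\<^sup>2))"
      using M by (intro mult_left_mono) auto
    then have e: "exp (real m * (Phi d l y - Phi d l \<beta>)) \<le> exp (- (real d / 2) * v\<^sup>2)"
      unfolding v2 by (simp add: mult_ac)
    have pre0: "0 \<le> pre" unfolding pre_def Z_count_prefactor_def
      by (intro divide_nonneg_nonneg mult_nonneg_nonneg less_imp_le[OF stirling_ratio_pos])
    have main: "sqrt (real m) * pre * exp (- (real d / 2) * v\<^sup>2) \<le> C * exp (- (real d / 4) * v\<^sup>2)"
    proof (cases "\<bar>y - \<beta>\<bar> \<le> \<eta>")
      case True
      then have yl: "\<beta> / 2 \<le> y" using \<eta>(2) by linarith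
      have "real d * y \<le> real d * (\<beta> + \<eta>)" using True d0 by (intro mult_left_mono) auto
      then have yu: "g / 2 \<le> 1 - real d * y" using \<eta>(3) by (simp add: g_def distrib_left)
      have "h > 0" using yl bi by (auto simp: y_def intro: Nat.gr0I)
      moreover have "real d * real h < real m"
      proof -
        have "real d * y < 1" using yu g by simp
        then show ?thesis using M by (simp add: y_def divide_less_eq)
      qed
      ultimately have "sqrt (real m) * pre \<le> 27 * sqrt (1 / (y * (1 - real d * y)))"
        unfolding pre_def y_def by (rule prefactor_local_bound[OF d l m dvd])
      also have "\<dots> \<le> C1"
      proof -
        have "\<beta> / 2 * (g / 2) \<le> y * (1 - real d * y)" using yl yu bi g by (intro mult_mono) auto
        then have "1 / (y * (1 - real d * y)) \<le> 1 / (\<beta> / 2 * (g / 2))"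
        proof -
          have "0 < y" "0 < 1 - real d * y" using yl yu bi g by linarith+
          then show ?thesis using \<open>\<beta> / 2 * (g / 2) \<le> y * (1 - real d * y)\<close> bi g
            by (intro divide_left_mono mult_pos_pos) simp_all
        qed
        also have "\<dots> = 4 / (\<beta> * g)" by simp
        finally show ?thesis unfolding C1_def by simp
      qed
      also have "\<dots> \<le> C" using B by (simp add: C_def)
      finally have "sqrt (real m) * pre \<le> C" .
      moreover have "exp (- (real d / 2) * v\<^sup>2) \<le> exp (- (real d / 4) * v\<^sup>2)"
        using d0 by (simp add: mult_right_mono)
      ultimately show ?thesis using C1 B pre0 by (intro mult_mono) (auto simp: C_def)
    next
      case False
      then have "\<eta>\<^sup>2 \<le> (y - \<beta>)\<^sup>2" using \<eta>(1) by (simp add: abs_le_square_iff[symmetric])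
      then have "real m * \<eta>\<^sup>2 \<le> v\<^sup>2" unfolding v2 using M by (intro mult_left_mono) auto
      then have "real d / 4 * (real m * \<eta>\<^sup>2) \<le> real d / 4 * v\<^sup>2" using d0 by (intro mult_left_mono) auto
      then have "- (real d / 2) * v\<^sup>2 \<le> - (real d / 4 * \<eta>\<^sup>2) * real m + - (real d / 4) * v\<^sup>2"
        by (simp add: algebra_simps)
      then have ee: "exp (- (real d / 2) * v\<^sup>2) \<le> exp (- (real d / 4 * \<eta>\<^sup>2) * real m) * exp (- (real d / 4) * v\<^sup>2)"
        unfolding exp_add[symmetric] exp_le_cancel_iff .
      have "sqrt (real m) \<le> real l * real m + 1"
      proof -
        have "real m * 1 \<le> (real m + 1)\<^sup>2" by (simp add: power2_eq_square algebra_simps)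
        then have "sqrt (real m) \<le> real m + 1" by (intro real_le_lsqrt) auto
        also have "\<dots> \<le> real l * real m + 1" using l M mult_right_mono[of 1 "real l" "real m"] by simp
        finally show ?thesis .
      qed
      moreover have "pre \<le> 27 * (real l * real m + 1)\<^sup>2"
        unfolding pre_def using Z_count_prefactor_bounds(2)[OF hm, of l d] l by simp
      ultimately have "sqrt (real m) * pre \<le> (real l * real m + 1) * (27 * (real l * real m + 1)\<^sup>2)"
        using pre0 by (intro mult_mono) auto
      also have "\<dots> = 27 * (real l * real m + 1) ^ 3" by (simp add: power2_eq_square power3_eq_cube)
      finally have p: "sqrt (real m) * pre \<le> 27 * (real l * real m + 1) ^ 3" .
      have "sqrt (real m) * pre * exp (- (real d / 2) * v\<^sup>2)
          \<le> (27 * (real l * real m + 1) ^ 3) * (exp (- (real d / 4 * \<eta>\<^sup>2) * real m) * exp (- (real d / 4) * v\<^sup>2))"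
        by (rule mult_mono[OF p ee]) simp_all
      also have "\<dots> = 27 * ((real l * real m + 1) ^ 3 * exp (- (real d / 4 * \<eta>\<^sup>2) * real m)) * exp (- (real d / 4) * v\<^sup>2)" by simp
      also have "\<dots> \<le> C * exp (- (real d / 4) * v\<^sup>2)"
      proof (rule mult_right_mono)
        have "(real l * real m + 1) ^ 3 * exp (- (real d / 4 * \<eta>\<^sup>2) * real m) \<le> B"
          using B(2)[of m] unfolding real_norm_def by linarith
        then show "27 * ((real l * real m + 1) ^ 3 * exp (- (real d / 4 * \<eta>\<^sup>2) * real m)) \<le> C"
          using C1 unfolding C_def by linarith
      qed simp
      finally show ?thesis .
    qed
    have "\<bar>sqrt (real m) * pre * exp (real m * (Phi d l y - Phi d l \<beta>))\<bar> = sqrt (real m) * pre * exp (real m * (Phi d l y - Phi d l \<beta>))"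
      using pre0 by simp
    also have "\<dots> \<le> sqrt (real m) * pre * exp (- (real d / 2) * v\<^sup>2)"
      using e pre0 by (intro mult_left_mono) auto
    also note main
    finally show "\<bar>sqrt (real m) * Z_count_prefactor m d l h * exp (real m * (Phi d l (real h / real m) - Phi d l \<beta>))\<bar>
      \<le> C * exp (- (real d / 4) * ((real h - real m * \<beta>) / sqrt (real m))\<^sup>2)"
      unfolding y_def v_def pre_def .
  qed
qed

text \<open>Rounding to the lattice moves u by at most 1 / sqrt m, so the rescaled deviation w tends
  to u. As m * (y - \<beta>)^2 = w^2 holds exactly, the exponent is q (y) * w^2 and converges by
  continuity of q.\<close>

lemma lattice_term_tendsto:
  assumes d: "d \<ge> 2" and l: "l \<ge> 2"
  defines "\<beta> \<equiv> beta_star_at d l 1"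
  defines "K \<equiv> 1 / sqrt (2 * pi) * sqrt (1 / (\<beta> * (1 - real d * \<beta>)))"
  shows "((\<lambda>m. if 0 \<le> \<lfloor>real m * \<beta> + sqrt (real m) * u\<rfloor> \<and> \<lfloor>real m * \<beta> + sqrt (real m) * u\<rfloor> \<le> int (m div d)
        then sqrt (real m) * Z_count_prefactor m d l (nat \<lfloor>real m * \<beta> + sqrt (real m) * u\<rfloor>)
          * exp (real m * (Phi d l (real (nat \<lfloor>real m * \<beta> + sqrt (real m) * u\<rfloor>) / real m) - Phi d l \<beta>)) else 0)
      \<longlongrightarrow> K * exp (- (- phi'' d l \<beta> / 2) * u\<^sup>2)) (admissible d l)"
proof -
  let ?F = "admissible d l"
  note b = beta_star_at[OF d l zero_less_one, folded \<beta>_def]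
  note bi = open_unit_interval[OF d l b(1)]
  have d0: "real d > 0" using d by simp
  define k where "k m = \<lfloor>real m * \<beta> + sqrt (real m) * u\<rfloor>" for m :: nat
  define h where "h m = nat (k m)" for m
  define w where "w m = (of_int (k m) - real m * \<beta>) / sqrt (real m)" for m
  have inv: "(\<lambda>m. 1 / sqrt (real m)) \<longlonglongrightarrow> 0"
    by (rule tendsto_divide_0[OF tendsto_const])
       (rule filterlim_at_top_imp_at_infinity[OF filterlim_compose[OF sqrt_at_top filterlim_real_sequentially]])
  have wlim: "w \<longlonglongrightarrow> u"
  proof (rule tendsto_sandwich)
    show "\<forall>\<^sub>F m in sequentially. u - 1 / sqrt (real m) \<le> w m"
      using eventually_gt_at_top[of 0]
    proof eventually_elim
      case (elim m)
      have s: "sqrt (real m) > 0" using elim by simp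
      have "real m * \<beta> + sqrt (real m) * u - 1 \<le> of_int (k m)" unfolding k_def by linarith
      then have "(sqrt (real m) * u - 1) / sqrt (real m) \<le> w m"
        unfolding w_def using s by (intro divide_right_mono) auto
      then show ?case using s by (simp add: diff_divide_distrib)
    qed
    show "\<forall>\<^sub>F m in sequentially. w m \<le> u"
      using eventually_gt_at_top[of 0]
    proof eventually_elim
      case (elim m)
      have s: "sqrt (real m) > 0" using elim by simp
      have "of_int (k m) \<le> real m * \<beta> + sqrt (real m) * u" unfolding k_def by linarith
      then show ?case unfolding w_def using s by (simp add: pos_divide_le_eq mult.commute)
    qed
    have "(\<lambda>m. u - 1 / sqrt (real m)) \<longlonglongrightarrow> u - 0" by (intro tendsto_diff tendsto_const inv)
    then show "(\<lambda>m. u - 1 / sqrt (real m)) \<longlonglongrightarrow> u" by simp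
  qed simp
  define y where "y m = of_int (k m) / real m" for m
  have yw: "y m = \<beta> + w m * (1 / sqrt (real m))" "real m * (y m - \<beta>)\<^sup>2 = (w m)\<^sup>2" if "m > 0" for m
  proof -
    have M: "real m > 0" using that by simp
    have ss: "sqrt (real m) * sqrt (real m) = real m" by simp
    have wd: "w m * (1 / sqrt (real m)) = (of_int (k m) - real m * \<beta>) / real m"
      unfolding w_def times_divide_times_eq ss by simp
    then show 1: "y m = \<beta> + w m * (1 / sqrt (real m))"
      unfolding y_def using M by (simp add: diff_divide_distrib)
    have "(y m - \<beta>)\<^sup>2 = (w m)\<^sup>2 * (1 / real m)" unfolding 1 using M by (simp add: power_mult_distrib power_divide)
    then show "real m * (y m - \<beta>)\<^sup>2 = (w m)\<^sup>2" using M by simp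
  qed
  have "(\<lambda>m. \<beta> + w m * (1 / sqrt (real m))) \<longlonglongrightarrow> \<beta> + u * 0"
    by (intro tendsto_add tendsto_mult tendsto_const wlim inv)
  then have lim0: "(\<lambda>m. \<beta> + w m * (1 / sqrt (real m))) \<longlonglongrightarrow> \<beta>" by simp
  have ylim: "y \<longlonglongrightarrow> \<beta>"
  proof (rule Lim_transform_eventually[OF lim0])
    show "\<forall>\<^sub>F m in sequentially. \<beta> + w m * (1 / sqrt (real m)) = y m"
      using eventually_gt_at_top[of 0] by eventually_elim (rule yw(1)[symmetric])
  qed
  have "\<forall>\<^sub>F m in sequentially. 0 < y m" using ylim bi by (intro order_tendstoD) auto
  moreover have "\<forall>\<^sub>F m in sequentially. y m < 1 / real d" using ylim b by (intro order_tendstoD) auto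
  ultimately have good: "\<forall>\<^sub>F m in sequentially. m > 0 \<and> 0 \<le> k m \<and> k m \<le> int (m div d) \<and> real (h m) / real m = y m"
    using eventually_gt_at_top[of 0]
  proof eventually_elim
    case (elim m)
    have M: "real m > 0" using elim by simp
    have k0: "0 < k m" using elim(1) M by (simp add: y_def zero_less_divide_iff)
    have hk: "real (h m) = of_int (k m)" unfolding h_def using k0 by simp
    have "real (h m) * real d < real m" using elim(2) M d0 by (simp add: y_def hk field_simps)
    then have "h m * d < m" by (metis of_nat_less_iff of_nat_mult)
    then have "h m \<le> m div d" using d by (simp add: less_eq_div_iff_mult_less_eq)
    then have "k m \<le> int (m div d)" unfolding h_def by linarith
    then show ?case using k0 hk M by (simp add: y_def)
  qed
  have goodF: "\<forall>\<^sub>F m in ?F. m > 0 \<and> 0 \<le> k m \<and> k m \<le> int (m div d) \<and> real (h m) / real m = y m"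
    using good admissible_le by (rule filter_leD[rotated])
  have ylimF: "(y \<longlongrightarrow> \<beta>) ?F" and wlimF: "(w \<longlongrightarrow> u) ?F"
    using ylim wlim by (auto intro: tendsto_admissible)
  have hlim: "((\<lambda>m. real (h m) / real m) \<longlongrightarrow> \<beta>) ?F"
  proof (rule Lim_transform_eventually[OF ylimF])
    show "\<forall>\<^sub>F m in ?F. y m = real (h m) / real m" using goodF by eventually_elim simp
  qed
  obtain q where q: "isCont q \<beta>" "q \<beta> = phi'' d l \<beta> / 2" "\<And>y. Phi d l y = Phi d l \<beta> + q y * (y - \<beta>)\<^sup>2"
    using Phi_expansion[OF d l, folded \<beta>_def] by blast
  have qlim: "((\<lambda>m. q (y m)) \<longlongrightarrow> phi'' d l \<beta> / 2) ?F"
    using isCont_tendsto_compose[OF q(1) ylimF] unfolding q(2) .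
  have "((\<lambda>m. sqrt (real m) * Z_count_prefactor m d l (h m) * exp (q (y m) * (w m)\<^sup>2)) \<longlongrightarrow> K * exp (phi'' d l \<beta> / 2 * u\<^sup>2)) ?F"
    unfolding K_def by (intro tendsto_mult tendsto_exp tendsto_power prefactor_tendsto[OF d l hlim bi(1,2)] qlim wlimF)
  then have lim: "((\<lambda>m. sqrt (real m) * Z_count_prefactor m d l (h m) * exp (q (y m) * (w m)\<^sup>2)) \<longlongrightarrow> K * exp (- (- phi'' d l \<beta> / 2) * u\<^sup>2)) ?F"
    by simp
  show ?thesis
  proof (rule Lim_transform_eventually[OF lim])
    show "\<forall>\<^sub>F m in ?F. sqrt (real m) * Z_count_prefactor m d l (h m) * exp (q (y m) * (w m)\<^sup>2)
      = (if 0 \<le> \<lfloor>real m * \<beta> + sqrt (real m) * u\<rfloor> \<and> \<lfloor>real m * \<beta> + sqrt (real m) * u\<rfloor> \<le> int (m div d)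
        then sqrt (real m) * Z_count_prefactor m d l (nat \<lfloor>real m * \<beta> + sqrt (real m) * u\<rfloor>)
          * exp (real m * (Phi d l (real (nat \<lfloor>real m * \<beta> + sqrt (real m) * u\<rfloor>) / real m) - Phi d l \<beta>)) else 0)"
      using goodF
    proof eventually_elim
      case (elim m)
      have "real m * (Phi d l (y m) - Phi d l \<beta>) = q (y m) * (real m * (y m - \<beta>)\<^sup>2)"
        by (subst q(3)) simp
      also have "\<dots> = q (y m) * (w m)\<^sup>2" using yw(2)[of m] elim by simp
      finally have "real m * (Phi d l (real (h m) / real m) - Phi d l \<beta>) = q (y m) * (w m)\<^sup>2" using elim by simp
      then show ?case using elim unfolding k_def[symmetric] h_def[symmetric] by simp
    qed
  qed
qed

lemma expectation_Z_total_tendsto: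
  assumes d: "d \<ge> 2" and l: "l \<ge> 2"
  defines "\<beta> \<equiv> beta_star_at d l 1"
  shows "((\<lambda>m. exp (- real m * Phi d l \<beta>) *
      measure_pmf.expectation (random_hypergraph m d l) (\<lambda>P. real (Z_total m d l P)))
    \<longlongrightarrow> sqrt ((1 - \<beta>) / (1 + (real l * real d - real d - real l) * \<beta>))) (admissible d l)"
proof -
  note b = beta_star_at[OF d l zero_less_one, folded \<beta>_def]
  note bi = open_unit_interval[OF d l b(1)]
  have d0: "real d > 0" and d00: "d > 0" using d by auto
  define T where "T m h = sqrt (real m) * Z_count_prefactor m d l h * exp (real m * (Phi d l (real h / real m) - Phi d l \<beta>))" for m h
  define K where "K = 1 / sqrt (2 * pi) * sqrt (1 / (\<beta> * (1 - real d * \<beta>)))"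
  define c where "c = - phi'' d l \<beta> / 2"
  have c: "c > 0" using phi''_le(2)[OF d l b(1)] d0 by (simp add: c_def)
  obtain C where C: "C \<ge> 0" "\<And>m h. d dvd l * m \<Longrightarrow> m > 0 \<Longrightarrow> h \<le> m div d \<Longrightarrow>
    \<bar>T m h\<bar> \<le> C * exp (- (real d / 4) * ((real h - real m * \<beta>) / sqrt (real m))\<^sup>2)"
    using lattice_term_bound[OF d l, folded \<beta>_def, folded T_def] by blast
  have L: "((\<lambda>m. (\<Sum>h = 0..m div d. T m h) / sqrt (real m)) \<longlongrightarrow> K * sqrt (pi / c)) (admissible d l)"
    unfolding admissible_def
  proof (rule lattice_gaussian_sum[where a = "real d / 4" and \<beta> = \<beta> and C = C])
    show "real d / 4 > 0" "c > 0" "C \<ge> 0" using d0 c C by auto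
    show "\<bar>T m h\<bar> \<le> C * exp (- (real d / 4) * ((real h - real m * \<beta>) / sqrt (real m))\<^sup>2)"
      if "m \<in> {m. d dvd l * m}" "m > 0" "h \<le> m div d" for m h
      using C(2)[of m h] that by blast
    show "((\<lambda>m. if 0 \<le> \<lfloor>real m * \<beta> + sqrt (real m) * u\<rfloor> \<and> \<lfloor>real m * \<beta> + sqrt (real m) * u\<rfloor> \<le> int (m div d)
        then T m (nat \<lfloor>real m * \<beta> + sqrt (real m) * u\<rfloor>) else 0) \<longlongrightarrow> K * exp (- c * u\<^sup>2)) (inf sequentially (principal {m. d dvd l * m}))" for u
      using lattice_term_tendsto[OF d l, folded \<beta>_def, folded T_def K_def c_def, of u] unfolding admissible_def .
  qed
  have val: "K * sqrt (pi / c) = sqrt ((1 - \<beta>) / (1 + (real l * real d - real d - real l) * \<beta>))"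
  proof -
    define D where "D = 1 + (real l * real d - real d - real l) * \<beta>"
    \<comment> \<open>Clearing denominators in - phi'' at \<beta> produces the denominator of the
      claimed limit; the factor \<beta> * (1 - d * \<beta>) is the one contributed by the
      prefactor.\<close>
    have cc: "2 * c * (\<beta> * (1 - real d * \<beta>)) * (1 - \<beta>) = D"
    proof -
      define i1 i2 i3 where "i1 = 1 / \<beta>" and "i2 = 1 / (1 - \<beta>)" and "i3 = 1 / (1 - real d * \<beta>)"
      have i: "i1 * \<beta> = 1" "i2 * (1 - \<beta>) = 1" "i3 * (1 - real d * \<beta>) = 1"
        using bi by (simp_all add: i1_def i2_def i3_def)
      have "2 * c = - phi'' d l \<beta>" by (simp add: c_def)
      also have "\<dots> = i1 - (real l - 1) * i2 + real l * real d * i3"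
        by (simp add: phi''_def i1_def i2_def i3_def)
      finally show ?thesis unfolding D_def using i by algebra
    qed
    have g: "\<beta> * (1 - real d * \<beta>) > 0" using bi by simp
    have "K * sqrt (pi / c) = sqrt (1 / (2 * pi) * (1 / (\<beta> * (1 - real d * \<beta>))) * (pi / c))"
      unfolding K_def by (simp only: real_sqrt_mult real_sqrt_divide real_sqrt_one)
    also have "1 / (2 * pi) * (1 / (\<beta> * (1 - real d * \<beta>))) * (pi / c) = 1 / (2 * c * (\<beta> * (1 - real d * \<beta>)))"
      using c g by (simp add: mult_ac)
    also have "\<dots> = (1 - \<beta>) / (2 * c * (\<beta> * (1 - real d * \<beta>)) * (1 - \<beta>))"
      using bi by simp
    finally show ?thesis unfolding cc D_def .
  qed
  have "\<forall>\<^sub>F m in admissible d l. (\<Sum>h = 0..m div d. T m h) / sqrt (real m) = exp (- real m * Phi d l \<beta>) *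
      measure_pmf.expectation (random_hypergraph m d l) (\<lambda>P. real (Z_total m d l P))"
    unfolding eventually_admissible using eventually_gt_at_top[of 0]
  proof eventually_elim
    case (elim m)
    show ?case
    proof
      assume dvd: "d dvd l * m"
      have m: "m > 0" using elim by simp
      have "measure_pmf.expectation (random_hypergraph m d l) (\<lambda>P. real (Z_total m d l P))
        = (\<Sum>h = 0..m div d. measure_pmf.expectation (random_hypergraph m d l) (\<lambda>P. real (Z_count m l h P)))"
      proof -
        have "(\<Sum>P\<in>configurations m d l. real (Z_total m d l P)) = (\<Sum>h = 0..m div d. \<Sum>P\<in>configurations m d l. real (Z_count m l h P))"
          unfolding Z_total_def of_nat_sum by (rule sum.swap)
        then show ?thesis unfolding expectation_random_hypergraph[OF d00 dvd] by (simp only: sum_divide_distrib)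
      qed
      also have "\<dots> = (\<Sum>h = 0..m div d. Z_count_prefactor m d l h * exp (real m * Phi d l (real h / real m)))"
        by (intro sum.cong refl expectation_Z_count_exp[OF d l m dvd]) simp
      finally have E: "measure_pmf.expectation (random_hypergraph m d l) (\<lambda>P. real (Z_total m d l P))
        = (\<Sum>h = 0..m div d. Z_count_prefactor m d l h * exp (real m * Phi d l (real h / real m)))" .
      have t: "T m h / sqrt (real m) = exp (- real m * Phi d l \<beta>) * (Z_count_prefactor m d l h * exp (real m * Phi d l (real h / real m)))" for h
      proof -
        have "exp (real m * (Phi d l (real h / real m) - Phi d l \<beta>)) = exp (- real m * Phi d l \<beta>) * exp (real m * Phi d l (real h / real m))"
          by (simp add: exp_add[symmetric] algebra_simps)
        then show ?thesis unfolding T_def using m by simp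
      qed
      show "(\<Sum>h = 0..m div d. T m h) / sqrt (real m) = exp (- real m * Phi d l \<beta>) *
        measure_pmf.expectation (random_hypergraph m d l) (\<lambda>P. real (Z_total m d l P))"
        unfolding E sum_divide_distrib sum_distrib_left t ..
    qed
  qed
  with L show ?thesis unfolding val by (rule Lim_transform_eventually)
qed

theorem theorem1p1:
  fixes d l :: nat
  assumes d: "d \<ge> 2" and l: "l \<ge> 2"
  shows
    "(\<exists>!\<beta>. is_beta_star d l \<beta>) \<and>
     ((\<lambda>m. exp (- real m * Phi d l (beta_star d l)) *
          measure_pmf.expectation (random_hypergraph m d l) (\<lambda>P. real (Z_total m d l P)))
        \<longlongrightarrow> sqrt ((1 - beta_star d l) /
              (1 + (real l * real d - real d - real l) * beta_star d l))) (admissible d l) \<and>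
     (l \<ge> 3 \<longrightarrow> (beta_star d l \<le> L_cert d l \<longleftrightarrow> x_cert d l \<ge> 1)) \<and>
     (l = 2 \<or> (l \<ge> 3 \<and> beta_star d l \<le> L_cert d l) \<longrightarrow>
        tendsto_in_prob (\<lambda>m. random_hypergraph m d l)
          (\<lambda>m P. 1 / real m * ln (real (Z_total m d l P)))
          (Phi d l (beta_star d l)) (admissible d l)) \<and>
     (\<forall>x::real. x > 0 \<longrightarrow>
        (\<exists>!\<beta>. is_beta_star_at d l x \<beta>) \<and>
        (l \<ge> 3 \<longrightarrow> (x \<le> x_cert d l \<longleftrightarrow> beta_star_at d l x \<le> L_cert d l)) \<and>
        (l = 2 \<or> (l \<ge> 3 \<and> x \<le> x_cert d l) \<longrightarrow>
           tendsto_in_prob (\<lambda>m. random_hypergraph m d l)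
             (\<lambda>m P. 1 / real m * ln (Z_weighted m d l x P))
             (Phi d l (beta_star_at d l x) + beta_star_at d l x * ln x) (admissible d l)))"
proof (intro conjI)
  let ?\<beta> = "beta_star d l"
  have one: "?\<beta> = beta_star_at d l 1" using d l by (rule beta_star_eq)
  show "\<exists>!\<beta>. is_beta_star d l \<beta>"
    unfolding is_beta_star_eq[OF d l] by (rule is_beta_star_at_ex1[OF d l zero_less_one])
  show "((\<lambda>m. exp (- real m * Phi d l ?\<beta>) *
          measure_pmf.expectation (random_hypergraph m d l) (\<lambda>P. real (Z_total m d l P)))
        \<longlongrightarrow> sqrt ((1 - ?\<beta>) / (1 + (real l * real d - real d - real l) * ?\<beta>))) (admissible d l)"
    unfolding one by (rule expectation_Z_total_tendsto[OF d l])
  show cert: "l \<ge> 3 \<longrightarrow> (?\<beta> \<le> L_cert d l \<longleftrightarrow> x_cert d l \<ge> 1)"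
    using x_cert_iff[OF d l _ zero_less_one] by (simp add: one)
  show "l = 2 \<or> (l \<ge> 3 \<and> ?\<beta> \<le> L_cert d l) \<longrightarrow>
        tendsto_in_prob (\<lambda>m. random_hypergraph m d l)
          (\<lambda>m P. 1 / real m * ln (real (Z_total m d l P))) (Phi d l ?\<beta>) (admissible d l)"
    using ln_Z_weighted_tendsto[OF d l zero_less_one] by (simp add: one Z_weighted_one)
  show "\<forall>x::real. x > 0 \<longrightarrow>
        (\<exists>!\<beta>. is_beta_star_at d l x \<beta>) \<and>
        (l \<ge> 3 \<longrightarrow> (x \<le> x_cert d l \<longleftrightarrow> beta_star_at d l x \<le> L_cert d l)) \<and>
        (l = 2 \<or> (l \<ge> 3 \<and> x \<le> x_cert d l) \<longrightarrow>
           tendsto_in_prob (\<lambda>m. random_hypergraph m d l)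
             (\<lambda>m P. 1 / real m * ln (Z_weighted m d l x P))
             (Phi d l (beta_star_at d l x) + beta_star_at d l x * ln x) (admissible d l))"
    using is_beta_star_at_ex1[OF d l] x_cert_iff[OF d l] ln_Z_weighted_tendsto[OF d l] by blast
qed

end
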